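(* Let $H$ be the Hopf algebra associated to a group datum $(G,\chi,g,1)$ of non-nilpotent type, as in the context. Then the set $$\{M(k,i),\ P_{[j]}\mid i\in\Omega_0,\ 1\le k\le n,\ j\in\Omega_1\}$$ forms a complete set of finite-dimensional indecomposable $H$-modules up to isomorphism (where there is one module $P_{[j]}$ for each $\langle\tau\rangle$-orbit $[j]$ in $\Omega_1$).
   Context: $\Bbbk$ is an algebraically closed field of characteristic zero; modules are finite-dimensional left modules. Fix a finite group $G$, a $\Bbbk$-linear character $\chi$ of $G$ and a central element $g\in G$; let $n\ge 2$ be the order of $q=\chi(g)$, and assume $\chi^n=1$ and $g^n\neq 1$. $H$ is the Hopf algebra generated as an algebra by $y$ and $G$, with $\Bbbk G$ as a subalgebra and relations $y^n=g^n-1$, $yh=\chi(h)hy$ for $h\in G$ (with $\Delta(y)=y\otimes g+1\otimes y$ and elements of $G$ group-like). It has $\Bbbk$-basis $\{y^ih\mid h\in G,\ 0\le i\le n-1\}$. Let $\{V_i\mid i\in\Omega\}$ be a complete set of simple $\Bbbk G$-modules up to isomorphism; $g^n$ acts on $V_i$ by a nonzero scalar $\lambda_i$; $\Omega_0=\{i\in\Omega\mid\lambda_i=1\}$, $\Omega_1=\{i\in\Omega\mid\lambda_i\ne1\}$. For $k\ge0$, $x^kV_i=\{x^kv\mid v\in V_i\}$ is a copy of the vector space $V_i$ ($x$ a formal variable) with $G$-action $h(x^kv)=\chi^{-k}(h)x^k(hv)$. For $i\in\Omega_0$, $1\le k\le n$, $M(k,i)=V_i\oplus xV_i\oplus\cdots\oplus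 x^{k-1}V_i$ is the $H$-module with this $G$-action and $y(x^sv)=x^{s+1}v$ for $0\le s\le k-2$, $y(x^{k-1}v)=0$. For $j\in\Omega_1$, $P_j=V_j\oplus xV_j\oplus\cdots\oplus x^{n-1}V_j$ is the $H$-module with this $G$-action and $y(x^sv)=x^{s+1}v$ for $0\le s\le n-2$, $y(x^{n-1}v)=(\lambda_j-1)v$. Let $V_{\chi^{-1}}$ be the one-dimensional $\Bbbk G$-module with character $\chi^{-1}$; $\tau$ is the permutation of $\Omega$ with $V_{\chi^{-1}}\otimes V_s\cong V_{\tau(s)}$; it preserves $\Omega_0$ and $\Omega_1$. $[s]$ denotes the $\langle\tau\rangle$-orbit of $s$. For $i,j\in\Omega_1$, $P_i\cong P_j$ if and only if $[i]=[j]$; $P_{[j]}$ denotes a representative of the isomorphism class of $P_j$. *)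

theory Defs
  imports "HOL-Combinatorics.Orbits" "HOL-Computational_Algebra.Polynomial"
    "HOL-Algebra.Module" "HOL-Algebra.QuotRing" "HOL-Algebra.Multiplicative_Group"
begin

section \<open>Left modules over a not necessarily commutative ring\<close>

text \<open>The locale \<^locale>\<open>module\<close> of HOL-Algebra requires a commutative ring of scalars, so it
  cannot be used here. The record type, and the locale \<^locale>\<open>submodule\<close> (which makes no
  commutativity assumption), are reused. The inherited fields \<open>mult\<close> and \<open>one\<close> of the record
  carry no information.\<close>

locale left_module = R?: ring R + M?: abelian_group M
  for R :: "('a, 'r) ring_scheme" (structure) and M :: "('a, 'm, 's) module_scheme" (structure) +
  assumes smult_closed:
      "\<lbrakk>a \<in> carrier R; x \<in> carrier M\<rbrakk> \<Longrightarrow> a \<odot>\<^bsub>M\<^esub> x \<in> carrier M"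
    and smult_l_distr:
      "\<lbrakk>a \<in> carrier R; b \<in> carrier R; x \<in> carrier M\<rbrakk> \<Longrightarrow>
        (a \<oplus>\<^bsub>R\<^esub> b) \<odot>\<^bsub>M\<^esub> x = a \<odot>\<^bsub>M\<^esub> x \<oplus>\<^bsub>M\<^esub> b \<odot>\<^bsub>M\<^esub> x"
    and smult_r_distr:
      "\<lbrakk>a \<in> carrier R; x \<in> carrier M; y \<in> carrier M\<rbrakk> \<Longrightarrow>
        a \<odot>\<^bsub>M\<^esub> (x \<oplus>\<^bsub>M\<^esub> y) = a \<odot>\<^bsub>M\<^esub> x \<oplus>\<^bsub>M\<^esub> a \<odot>\<^bsub>M\<^esub> y"
    and smult_assoc:
      "\<lbrakk>a \<in> carrier R; b \<in> carrier R; x \<in> carrier M\<rbrakk> \<Longrightarrow>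
        (a \<otimes>\<^bsub>R\<^esub> b) \<odot>\<^bsub>M\<^esub> x = a \<odot>\<^bsub>M\<^esub> (b \<odot>\<^bsub>M\<^esub> x)"
    and smult_one:
      "x \<in> carrier M \<Longrightarrow> \<one>\<^bsub>R\<^esub> \<odot>\<^bsub>M\<^esub> x = x"

definition module_iso ::
    "('a, 'r) ring_scheme \<Rightarrow> ('a, 'm) module \<Rightarrow> ('a, 'l) module \<Rightarrow> bool" where
  "module_iso R M N \<longleftrightarrow>
     (\<exists>f. bij_betw f (carrier M) (carrier N) \<and>
          (\<forall>x\<in>carrier M. \<forall>y\<in>carrier M. f (x \<oplus>\<^bsub>M\<^esub> y) = f x \<oplus>\<^bsub>N\<^esub> f y) \<and>
          (\<forall>a\<in>carrier R. \<forall>x\<in>carrier M. f (a \<odot>\<^bsub>M\<^esub> x) = a \<odot>\<^bsub>N\<^esub> f x))"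

definition simple_module :: "('a, 'r) ring_scheme \<Rightarrow> ('a, 'm) module \<Rightarrow> bool" where
  "simple_module R M \<longleftrightarrow> left_module R M \<and> carrier M \<noteq> {\<zero>\<^bsub>M\<^esub>} \<and>
     (\<forall>N. submodule N R M \<longrightarrow> N = {\<zero>\<^bsub>M\<^esub>} \<or> N = carrier M)"

definition indecomposable_module :: "('a, 'r) ring_scheme \<Rightarrow> ('a, 'm) module \<Rightarrow> bool" where
  "indecomposable_module R M \<longleftrightarrow> left_module R M \<and> carrier M \<noteq> {\<zero>\<^bsub>M\<^esub>} \<and>
     (\<forall>N N'. submodule N R M \<and> submodule N' R M \<and>
        N \<inter> N' = {\<zero>\<^bsub>M\<^esub>} \<and> N <+>\<^bsub>M\<^esub> N' = carrier M \<longrightarrow>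
        N = {\<zero>\<^bsub>M\<^esub>} \<or> N' = {\<zero>\<^bsub>M\<^esub>})"

text \<open>A \<open>\<Bbbk>\<close>-algebra structure on \<open>R\<close> is given by its structure map \<open>\<eta> c = c \<cdot> 1\<close>; every left
  \<open>R\<close>-module is then a \<open>\<Bbbk>\<close>-vector space through \<open>\<eta>\<close>.\<close>

definition finite_dim :: "('k \<Rightarrow> 'a) \<Rightarrow> ('a, 'm) module \<Rightarrow> bool" where
  "finite_dim \<eta> M \<longleftrightarrow>
     (\<exists>B. finite B \<and> B \<subseteq> carrier M \<and>
          (\<forall>x\<in>carrier M. \<exists>c. x = (\<Oplus>\<^bsub>M\<^esub>b\<in>B. \<eta> (c b) \<odot>\<^bsub>M\<^esub> b)))"

definition quotient_module :: "('a, 'm) module \<Rightarrow> 'm set \<Rightarrow> ('a, 'm set) module" where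
  "quotient_module M N =
     \<lparr>carrier = a_rcosets\<^bsub>M\<^esub> N, mult = undefined, one = undefined,
      zero = N, add = set_add M,
      smult = (\<lambda>a C. \<Union>x\<in>C. N +>\<^bsub>M\<^esub> (a \<odot>\<^bsub>M\<^esub> x))\<rparr>"


section \<open>Monoid algebras\<close>

text \<open>Elements are the finitely supported \<open>\<Bbbk>\<close>-valued functions on the monoid, and
  \<open>single c a\<close> is \<open>c \<cdot> a\<close>. This yields group algebras and, for the monoid of words, free
  algebras.\<close>

definition single :: "'k \<Rightarrow> 'a \<Rightarrow> ('a \<Rightarrow> 'k::comm_ring_1)" where
  "single c a = (\<lambda>b. if b = a then c else 0)"

definition monoid_algebra :: "('a, 'e) monoid_scheme \<Rightarrow> ('a \<Rightarrow> 'k::comm_ring_1) ring" where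
  "monoid_algebra S =
     \<lparr>carrier = {f. finite {a. f a \<noteq> 0} \<and> {a. f a \<noteq> 0} \<subseteq> carrier S},
      mult = (\<lambda>f f' z. \<Sum>(a, b)\<in>{(a, b). f a \<noteq> 0 \<and> f' b \<noteq> 0 \<and> a \<otimes>\<^bsub>S\<^esub> b = z}. f a * f' b),
      one = single 1 \<one>\<^bsub>S\<^esub>,
      zero = (\<lambda>_. 0),
      add = (\<lambda>f f' z. f z + f' z)\<rparr>"

definition free_monoid :: "'a set \<Rightarrow> 'a list monoid" where
  "free_monoid X = \<lparr>carrier = lists X, mult = (@), one = []\<rparr>"

lemma monoid_algebra_mult_eq:
  assumes "finite A" "finite B" "{a. f a \<noteq> 0} \<subseteq> A" "{b. f' b \<noteq> 0} \<subseteq> B"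
  shows "(f \<otimes>\<^bsub>monoid_algebra S\<^esub> f') z = (\<Sum>a\<in>A. \<Sum>b\<in>B. if a \<otimes>\<^bsub>S\<^esub> b = z then f a * f' b else (0::'k::comm_ring_1))"
proof -
  have "(\<Sum>a\<in>A. \<Sum>b\<in>B. if a \<otimes>\<^bsub>S\<^esub> b = z then f a * f' b else 0)
     = (\<Sum>p\<in>A\<times>B. if fst p \<otimes>\<^bsub>S\<^esub> snd p = z then f (fst p) * f' (snd p) else 0)"
    by (simp add: sum.cartesian_product case_prod_beta)
  also have "\<dots> = (\<Sum>p\<in>{(a, b). f a \<noteq> 0 \<and> f' b \<noteq> 0 \<and> a \<otimes>\<^bsub>S\<^esub> b = z}. f (fst p) * f' (snd p))"
    by (rule sum.mono_neutral_cong_right) (use assms in \<open>auto\<close>)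
  finally show ?thesis by (simp add: monoid_algebra_def case_prod_beta)
qed

lemma monoid_algebra_supp_mult:
  "{z. (f \<otimes>\<^bsub>monoid_algebra S\<^esub> f') z \<noteq> (0::'k::comm_ring_1)} \<subseteq> (\<lambda>(a,b). a \<otimes>\<^bsub>S\<^esub> b) ` ({a. f a \<noteq> 0} \<times> {a. f' a \<noteq> 0})"
proof
  fix z assume "z \<in> {z. (f \<otimes>\<^bsub>monoid_algebra S\<^esub> f') z \<noteq> 0}"
  then have "(\<Sum>(a, b)\<in>{(a, b). f a \<noteq> 0 \<and> f' b \<noteq> 0 \<and> a \<otimes>\<^bsub>S\<^esub> b = z}. f a * f' b) \<noteq> 0"
    by (simp add: monoid_algebra_def)
  then obtain p where "p \<in> {(a, b). f a \<noteq> 0 \<and> f' b \<noteq> 0 \<and> a \<otimes>\<^bsub>S\<^esub> b = z}"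
    by (metis (no_types, lifting) sum.not_neutral_contains_not_neutral)
  then show "z \<in> (\<lambda>(a,b). a \<otimes>\<^bsub>S\<^esub> b) ` ({a. f a \<noteq> 0} \<times> {a. f' a \<noteq> 0})" by force
qed

lemma ring_monoid_algebra:
  fixes S :: "('a, 'e) monoid_scheme"
  assumes "Group.monoid S"
  shows "ring (monoid_algebra S :: ('a \<Rightarrow> 'k::comm_ring_1) ring)"
proof -
  interpret S: Group.monoid S by fact
  let ?A = "monoid_algebra S :: ('a \<Rightarrow> 'k) ring"
  let ?s = "\<lambda>f::'a\<Rightarrow>'k. {a. f a \<noteq> 0}"
  have carr: "f \<in> carrier ?A \<longleftrightarrow> finite (?s f) \<and> ?s f \<subseteq> carrier S" for f
    by (simp add: monoid_algebra_def)
  have mc: "f \<otimes>\<^bsub>?A\<^esub> f' \<in> carrier ?A" if "f \<in> carrier ?A" "f' \<in> carrier ?A" for f f'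
  proof -
    have fin: "finite (?s f)" "finite (?s f')" and sub: "?s f \<subseteq> carrier S" "?s f' \<subseteq> carrier S"
      using that by (auto simp: carr)
    let ?I = "(\<lambda>(a,b). a \<otimes>\<^bsub>S\<^esub> b) ` (?s f \<times> ?s f')"
    have "finite ?I" using fin by simp
    moreover have "?I \<subseteq> carrier S" using sub by (auto simp: subset_iff)
    ultimately show ?thesis unfolding carr using monoid_algebra_supp_mult[of S f f']
      by (meson finite_subset order_trans)
  qed
  have oc: "\<one>\<^bsub>?A\<^esub> \<in> carrier ?A"
    by (auto simp: monoid_algebra_def single_def intro: finite_subset[of _ "{\<one>\<^bsub>S\<^esub>}"])
  have addv: "(f \<oplus>\<^bsub>?A\<^esub> f') z = f z + f' z" for f f' z by (simp add: monoid_algebra_def)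
  have zv: "\<zero>\<^bsub>?A\<^esub> = (\<lambda>_. 0)" by (simp add: monoid_algebra_def)
  have ov: "\<one>\<^bsub>?A\<^esub> = single 1 \<one>\<^bsub>S\<^esub>" by (simp add: monoid_algebra_def)
  have ac: "f \<oplus>\<^bsub>?A\<^esub> f' \<in> carrier ?A" if "f \<in> carrier ?A" "f' \<in> carrier ?A" for f f'
  proof -
    have "?s (f \<oplus>\<^bsub>?A\<^esub> f') \<subseteq> ?s f \<union> ?s f'" by (auto simp: addv)
    then show ?thesis using that unfolding carr by (meson Un_least finite_Un finite_subset order_trans)
  qed
  have zc: "\<zero>\<^bsub>?A\<^esub> \<in> carrier ?A" by (simp add: carr zv)
  show ?thesis
  proof (rule ringI)
    show "abelian_group ?A"
    proof (rule abelian_groupI)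
      fix x assume x: "x \<in> carrier ?A"
      then have "(\<lambda>a. - x a) \<in> carrier ?A" by (simp add: carr)
      moreover have "(\<lambda>a. - x a) \<oplus>\<^bsub>?A\<^esub> x = \<zero>\<^bsub>?A\<^esub>" by (rule ext) (simp add: addv zv)
      ultimately show "\<exists>y\<in>carrier ?A. y \<oplus>\<^bsub>?A\<^esub> x = \<zero>\<^bsub>?A\<^esub>" by blast
    qed (auto intro: ac zc simp: zc[unfolded zv] fun_eq_iff addv zv algebra_simps)
    show "Group.monoid ?A"
    proof (rule monoidI)
      fix x y z assume c: "x \<in> carrier ?A" "y \<in> carrier ?A" "z \<in> carrier ?A"
      let ?X = "?s x" let ?Y = "?s y" let ?Z = "?s z"
      have fin: "finite ?X" "finite ?Y" "finite ?Z" and sub: "?X \<subseteq> carrier S" "?Y \<subseteq> carrier S" "?Z \<subseteq> carrier S" using c by (auto simp: carr)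
      let ?XY = "(\<lambda>(a,b). a \<otimes>\<^bsub>S\<^esub> b) ` (?X \<times> ?Y)" and ?YZ = "(\<lambda>(a,b). a \<otimes>\<^bsub>S\<^esub> b) ` (?Y \<times> ?Z)"
      have f2: "finite ?XY" "finite ?YZ" using fin by auto
      show "x \<otimes>\<^bsub>?A\<^esub> y \<otimes>\<^bsub>?A\<^esub> z = x \<otimes>\<^bsub>?A\<^esub> (y \<otimes>\<^bsub>?A\<^esub> z)"
      proof
        fix t
        have "(x \<otimes>\<^bsub>?A\<^esub> y \<otimes>\<^bsub>?A\<^esub> z) t = (\<Sum>u\<in>?XY. \<Sum>c\<in>?Z. if u \<otimes>\<^bsub>S\<^esub> c = t then (x \<otimes>\<^bsub>?A\<^esub> y) u * z c else 0)"
          using fin f2 monoid_algebra_supp_mult[of S x y] by (intro monoid_algebra_mult_eq) auto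
        also have "\<dots> = (\<Sum>u\<in>?XY. \<Sum>c\<in>?Z. \<Sum>a\<in>?X. \<Sum>b\<in>?Y. if a \<otimes>\<^bsub>S\<^esub> b = u then (if u \<otimes>\<^bsub>S\<^esub> c = t then x a * y b * z c else 0) else 0)"
          proof (intro sum.cong refl)
            fix u c
            show "(if u \<otimes>\<^bsub>S\<^esub> c = t then (x \<otimes>\<^bsub>?A\<^esub> y) u * z c else 0) = (\<Sum>a\<in>?X. \<Sum>b\<in>?Y. if a \<otimes>\<^bsub>S\<^esub> b = u then (if u \<otimes>\<^bsub>S\<^esub> c = t then x a * y b * z c else 0) else 0)"
              using fin by (cases "u \<otimes>\<^bsub>S\<^esub> c = t") (auto simp: monoid_algebra_mult_eq[of ?X ?Y] sum_distrib_right sum_distrib_left mult.assoc intro!: sum.cong sum.neutral)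
          qed
        also have "\<dots> = (\<Sum>c\<in>?Z. \<Sum>a\<in>?X. \<Sum>b\<in>?Y. \<Sum>u\<in>?XY. if a \<otimes>\<^bsub>S\<^esub> b = u then (if u \<otimes>\<^bsub>S\<^esub> c = t then x a * y b * z c else 0) else 0)"
          by (subst sum.swap, rule sum.cong, rule refl, subst sum.swap, rule sum.cong, rule refl, subst sum.swap, rule refl)
        also have "\<dots> = (\<Sum>c\<in>?Z. \<Sum>a\<in>?X. \<Sum>b\<in>?Y. if a \<otimes>\<^bsub>S\<^esub> b \<otimes>\<^bsub>S\<^esub> c = t then x a * y b * z c else 0)"
          using f2 by (intro sum.cong refl, subst sum.delta') auto
        finally have L: "(x \<otimes>\<^bsub>?A\<^esub> y \<otimes>\<^bsub>?A\<^esub> z) t = \<dots>" .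
        have "(x \<otimes>\<^bsub>?A\<^esub> (y \<otimes>\<^bsub>?A\<^esub> z)) t = (\<Sum>a\<in>?X. \<Sum>u\<in>?YZ. if a \<otimes>\<^bsub>S\<^esub> u = t then x a * (y \<otimes>\<^bsub>?A\<^esub> z) u else 0)"
          using fin f2 monoid_algebra_supp_mult[of S y z] by (intro monoid_algebra_mult_eq) auto
        also have "\<dots> = (\<Sum>a\<in>?X. \<Sum>u\<in>?YZ. \<Sum>b\<in>?Y. \<Sum>c\<in>?Z. if b \<otimes>\<^bsub>S\<^esub> c = u then (if a \<otimes>\<^bsub>S\<^esub> u = t then x a * y b * z c else 0) else 0)"
          proof (intro sum.cong refl)
            fix a u
            show "(if a \<otimes>\<^bsub>S\<^esub> u = t then x a * (y \<otimes>\<^bsub>?A\<^esub> z) u else 0) = (\<Sum>b\<in>?Y. \<Sum>c\<in>?Z. if b \<otimes>\<^bsub>S\<^esub> c = u then (if a \<otimes>\<^bsub>S\<^esub> u = t then x a * y b * z c else 0) else 0)"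
              using fin by (cases "a \<otimes>\<^bsub>S\<^esub> u = t") (auto simp: monoid_algebra_mult_eq[of ?Y ?Z] sum_distrib_right sum_distrib_left mult.assoc intro!: sum.cong sum.neutral)
          qed
        also have "\<dots> = (\<Sum>a\<in>?X. \<Sum>b\<in>?Y. \<Sum>c\<in>?Z. \<Sum>u\<in>?YZ. if b \<otimes>\<^bsub>S\<^esub> c = u then (if a \<otimes>\<^bsub>S\<^esub> u = t then x a * y b * z c else 0) else 0)"
          by (rule sum.cong, rule refl, subst sum.swap, rule sum.cong, rule refl, subst sum.swap, rule refl)
        also have "\<dots> = (\<Sum>a\<in>?X. \<Sum>b\<in>?Y. \<Sum>c\<in>?Z. if a \<otimes>\<^bsub>S\<^esub> b \<otimes>\<^bsub>S\<^esub> c = t then x a * y b * z c else 0)"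
          using f2 sub by (intro sum.cong refl, subst sum.delta') (auto simp: S.m_assoc subset_iff)
        also have "\<dots> = (\<Sum>c\<in>?Z. \<Sum>a\<in>?X. \<Sum>b\<in>?Y. if a \<otimes>\<^bsub>S\<^esub> b \<otimes>\<^bsub>S\<^esub> c = t then x a * y b * z c else 0)"
          by (subst (2) sum.swap, rule sum.cong, rule refl, rule sum.swap)
        finally show "(x \<otimes>\<^bsub>?A\<^esub> y \<otimes>\<^bsub>?A\<^esub> z) t = (x \<otimes>\<^bsub>?A\<^esub> (y \<otimes>\<^bsub>?A\<^esub> z)) t" using L by simp
      qed
    next
      fix x assume x: "x \<in> carrier ?A"
      then have fin: "finite (?s x)" and sub: "?s x \<subseteq> carrier S" by (auto simp: carr)
      show "\<one>\<^bsub>?A\<^esub> \<otimes>\<^bsub>?A\<^esub> x = x"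
      proof
        fix t
        have "(\<one>\<^bsub>?A\<^esub> \<otimes>\<^bsub>?A\<^esub> x) t = (\<Sum>a\<in>{\<one>\<^bsub>S\<^esub>}. \<Sum>b\<in>?s x. if a \<otimes>\<^bsub>S\<^esub> b = t then \<one>\<^bsub>?A\<^esub> a * x b else 0)"
          using fin by (intro monoid_algebra_mult_eq) (auto simp: ov single_def)
        also have "\<dots> = (\<Sum>b\<in>?s x. if b = t then x b else 0)"
          using sub by (auto simp: ov single_def subset_iff intro!: sum.cong)
        also have "\<dots> = x t" using fin by (subst sum.delta) auto
        finally show "(\<one>\<^bsub>?A\<^esub> \<otimes>\<^bsub>?A\<^esub> x) t = x t" .
      qed
      show "x \<otimes>\<^bsub>?A\<^esub> \<one>\<^bsub>?A\<^esub> = x"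
      proof
        fix t
        have "(x \<otimes>\<^bsub>?A\<^esub> \<one>\<^bsub>?A\<^esub>) t = (\<Sum>a\<in>?s x. \<Sum>b\<in>{\<one>\<^bsub>S\<^esub>}. if a \<otimes>\<^bsub>S\<^esub> b = t then x a * \<one>\<^bsub>?A\<^esub> b else 0)"
          using fin by (intro monoid_algebra_mult_eq) (auto simp: ov single_def)
        also have "\<dots> = (\<Sum>b\<in>?s x. if b = t then x b else 0)"
          using sub by (auto simp: ov single_def subset_iff intro!: sum.cong)
        also have "\<dots> = x t" using fin by (subst sum.delta) auto
        finally show "(x \<otimes>\<^bsub>?A\<^esub> \<one>\<^bsub>?A\<^esub>) t = x t" .
      qed
    qed (auto intro: mc oc)
    fix x y z assume c: "x \<in> carrier ?A" "y \<in> carrier ?A" "z \<in> carrier ?A"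
    let ?X = "?s x" let ?Y = "?s y" let ?Z = "?s z"
    have fin: "finite ?X" "finite ?Y" "finite ?Z" using c by (auto simp: carr)
    have sxy: "?s (x \<oplus>\<^bsub>?A\<^esub> y) \<subseteq> ?X \<union> ?Y" by (auto simp: addv)
    show "(x \<oplus>\<^bsub>?A\<^esub> y) \<otimes>\<^bsub>?A\<^esub> z = x \<otimes>\<^bsub>?A\<^esub> z \<oplus>\<^bsub>?A\<^esub> y \<otimes>\<^bsub>?A\<^esub> z"
      by (rule ext, subst monoid_algebra_mult_eq[of "?X \<union> ?Y" ?Z], use fin sxy in auto,
          subst addv, subst (1 2) monoid_algebra_mult_eq[of "?X \<union> ?Y" ?Z],
          use fin in \<open>auto simp: addv sum.distrib[symmetric] algebra_simps intro!: sum.cong\<close>)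
    show "z \<otimes>\<^bsub>?A\<^esub> (x \<oplus>\<^bsub>?A\<^esub> y) = z \<otimes>\<^bsub>?A\<^esub> x \<oplus>\<^bsub>?A\<^esub> z \<otimes>\<^bsub>?A\<^esub> y"
      by (rule ext, subst monoid_algebra_mult_eq[of ?Z "?X \<union> ?Y"], use fin sxy in auto,
          subst addv, subst (1 2) monoid_algebra_mult_eq[of ?Z "?X \<union> ?Y"],
          use fin in \<open>auto simp: addv sum.distrib[symmetric] algebra_simps intro!: sum.cong\<close>)
  qed
qed

lemma monoid_free_monoid: "Group.monoid (free_monoid X)"
  by (rule monoidI) (auto simp: free_monoid_def)


section \<open>The group datum\<close>

definition unit_group :: "'k::field monoid" where
  "unit_group = \<lparr>carrier = - {0}, mult = (*), one = 1\<rparr>"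

locale nonnilpotent_group_datum = group G for G :: "'g monoid" (structure) +
  fixes \<chi> :: "'g \<Rightarrow> 'k::{alg_closed_field, field_char_0}" and g :: 'g and n :: nat
  assumes finite_G: "finite (carrier G)"
    and character: "\<chi> \<in> hom G unit_group"
    and g_closed: "g \<in> carrier G"
    and g_central: "\<And>h. h \<in> carrier G \<Longrightarrow> g \<otimes> h = h \<otimes> g"
    and n_eq_ord: "n = group.ord unit_group (\<chi> g)"
    and n_ge_2: "n \<ge> 2"
    and character_pow_n: "\<And>h. h \<in> carrier G \<Longrightarrow> \<chi> h ^ n = 1"
    and g_pow_n: "g [^] n \<noteq> \<one>"


section \<open>Modules over the group algebra\<close>

text \<open>The group element \<open>h\<close> acts on a module \<open>V\<close> as \<open>single 1 h \<odot>\<^bsub>V\<^esub> _\<close>.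
  Every finite-dimensional module is isomorphic to one whose elements have the type
  \<open>nat \<Rightarrow> 'k\<close>, so completeness of a list of modules may be tested on that type.\<close>

definition group_algebra_scalar :: "('g, 'e) monoid_scheme \<Rightarrow> 'k \<Rightarrow> ('g \<Rightarrow> 'k::comm_ring_1)" where
  "group_algebra_scalar G c = single c \<one>\<^bsub>G\<^esub>"

definition character_module ::
    "('g, 'e) monoid_scheme \<Rightarrow> ('g \<Rightarrow> 'k::comm_ring_1) \<Rightarrow> ('g \<Rightarrow> 'k, 'k) module" where
  "character_module G \<psi> =
     \<lparr>carrier = UNIV, mult = undefined, one = undefined, zero = 0, add = (+),
      smult = (\<lambda>a c. \<Sum>h\<in>carrier G. a h * \<psi> h * c)\<rparr>"

text \<open>The tensor product over \<open>\<Bbbk>\<close> of two \<open>\<Bbbk>G\<close>-modules, with diagonal action: the free vector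
  space on pairs modulo the subspace spanned by the bilinearity relations.\<close>

definition free_on_pairs ::
    "('g, 'e) monoid_scheme \<Rightarrow> ('g \<Rightarrow> 'k::comm_ring_1, 'v) module \<Rightarrow> ('g \<Rightarrow> 'k, 'w) module \<Rightarrow>
     ('g \<Rightarrow> 'k, 'v \<times> 'w \<Rightarrow> 'k) module" where
  "free_on_pairs G V W =
     \<lparr>carrier = {f. finite {p. f p \<noteq> 0} \<and> {p. f p \<noteq> 0} \<subseteq> carrier V \<times> carrier W},
      mult = undefined, one = undefined, zero = (\<lambda>_. 0), add = (\<lambda>f f' p. f p + f' p),
      smult = (\<lambda>a f q. \<Sum>h\<in>carrier G.
        \<Sum>(v, w)\<in>{(v, w). f (v, w) \<noteq> 0 \<and> (single 1 h \<odot>\<^bsub>V\<^esub> v, single 1 h \<odot>\<^bsub>W\<^esub> w) = q}.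
          a h * f (v, w))\<rparr>"

definition bilinear_relations ::
    "('g, 'e) monoid_scheme \<Rightarrow> ('g \<Rightarrow> 'k::comm_ring_1, 'v) module \<Rightarrow> ('g \<Rightarrow> 'k, 'w) module \<Rightarrow>
     ('v \<times> 'w \<Rightarrow> 'k) set" where
  "bilinear_relations G V W =
     {\<lambda>p. single 1 (v \<oplus>\<^bsub>V\<^esub> v', w) p - single 1 (v, w) p - single 1 (v', w) p | v v' w.
        v \<in> carrier V \<and> v' \<in> carrier V \<and> w \<in> carrier W}
   \<union> {\<lambda>p. single 1 (v, w \<oplus>\<^bsub>W\<^esub> w') p - single 1 (v, w) p - single 1 (v, w') p | v w w'.
        v \<in> carrier V \<and> w \<in> carrier W \<and> w' \<in> carrier W}
   \<union> {\<lambda>p. single 1 (group_algebra_scalar G c \<odot>\<^bsub>V\<^esub> v, w) p - single c (v, w) p | c v w.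
        v \<in> carrier V \<and> w \<in> carrier W}
   \<union> {\<lambda>p. single 1 (v, group_algebra_scalar G c \<odot>\<^bsub>W\<^esub> w) p - single c (v, w) p | c v w.
        v \<in> carrier V \<and> w \<in> carrier W}"

definition subspace_spanned :: "('p \<Rightarrow> 'k::comm_ring_1) set \<Rightarrow> ('p \<Rightarrow> 'k) set" where
  "subspace_spanned B =
     \<Inter>{U. B \<subseteq> U \<and> (\<lambda>_. 0) \<in> U \<and> (\<forall>f\<in>U. \<forall>f'\<in>U. (\<lambda>p. f p + f' p) \<in> U) \<and>
         (\<forall>c. \<forall>f\<in>U. (\<lambda>p. c * f p) \<in> U)}"

definition tensor_module ::
    "('g, 'e) monoid_scheme \<Rightarrow> ('g \<Rightarrow> 'k::comm_ring_1, 'v) module \<Rightarrow> ('g \<Rightarrow> 'k, 'w) module \<Rightarrow>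
     ('g \<Rightarrow> 'k, ('v \<times> 'w \<Rightarrow> 'k) set) module" where
  "tensor_module G V W =
     quotient_module (free_on_pairs G V W) (subspace_spanned (bilinear_relations G V W))"

definition central_scalar ::
    "('g, 'e) monoid_scheme \<Rightarrow> 'g \<Rightarrow> nat \<Rightarrow> ('g \<Rightarrow> 'k::field, 'v) module \<Rightarrow> 'k" where
  "central_scalar G g n V =
     (THE c. \<forall>v\<in>carrier V. single 1 (g [^]\<^bsub>G\<^esub> n) \<odot>\<^bsub>V\<^esub> v = group_algebra_scalar G c \<odot>\<^bsub>V\<^esub> v)"

text \<open>As \<open>\<chi>\<^sup>n = 1\<close>, the permutation \<open>\<tau>\<close> below satisfies \<open>\<tau>\<^sup>n = id\<close>, so the library's
  \<^const>\<open>orbit\<close>, which collects the positive iterates, is the \<open>\<langle>\<tau>\<rangle>\<close>-orbit.\<close>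

definition twist_perm ::
    "('g, 'e) monoid_scheme \<Rightarrow> ('g \<Rightarrow> 'k::field) \<Rightarrow> 'i set \<Rightarrow> ('i \<Rightarrow> ('g \<Rightarrow> 'k, 'v) module) \<Rightarrow>
     'i \<Rightarrow> 'i" where
  "twist_perm G \<chi> \<Omega> V s =
     (THE t. t \<in> \<Omega> \<and>
        module_iso (monoid_algebra G)
          (tensor_module G (character_module G (\<lambda>h. inverse (\<chi> h))) (V s)) (V t))"

text \<open>\<open>V \<oplus> xV \<oplus> \<cdots> \<oplus> x\<^sup>k\<^sup>-\<^sup>1V\<close>, where \<open>f\<close> stands for \<open>\<Sum>s<k. x\<^sup>s (f s)\<close>. The action
  \<open>h (x\<^sup>s v) = \<chi>(h)\<^sup>-\<^sup>s x\<^sup>s (h v)\<close> of \<open>G\<close>, extended linearly to \<open>a = \<Sum>h. a h \<cdot> h\<close>, sends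
  \<open>x\<^sup>s v\<close> to \<open>x\<^sup>s ((\<Sum>h. a h \<chi>(h)\<^sup>-\<^sup>s \<cdot> h) v)\<close>.\<close>

definition tower ::
    "'g monoid \<Rightarrow> ('g \<Rightarrow> 'k::field) \<Rightarrow> nat \<Rightarrow> ('g \<Rightarrow> 'k, 'v) module \<Rightarrow>
     ('g \<Rightarrow> 'k, nat \<Rightarrow> 'v) module" where
  "tower G \<chi> k V =
     \<lparr>carrier = (\<Pi>\<^sub>E s\<in>{..<k}. carrier V), mult = undefined, one = undefined,
      zero = (\<lambda>s\<in>{..<k}. \<zero>\<^bsub>V\<^esub>),
      add = (\<lambda>f f'. \<lambda>s\<in>{..<k}. f s \<oplus>\<^bsub>V\<^esub> f' s),
      smult = (\<lambda>a f. \<lambda>s\<in>{..<k}. (\<lambda>h. a h * inverse (\<chi> h) ^ s) \<odot>\<^bsub>V\<^esub> f s)\<rparr>"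

text \<open>\<open>x\<^sup>s v \<mapsto> x\<^sup>s\<^sup>+\<^sup>1 v\<close> for \<open>s < k - 1\<close>, and \<open>x\<^sup>k\<^sup>-\<^sup>1 v \<mapsto> \<mu> v\<close>.\<close>

definition tower_shift ::
    "'g monoid \<Rightarrow> nat \<Rightarrow> ('g \<Rightarrow> 'k::field, 'v) module \<Rightarrow> 'k \<Rightarrow> (nat \<Rightarrow> 'v) \<Rightarrow> (nat \<Rightarrow> 'v)" where
  "tower_shift G k V \<mu> f =
     (\<lambda>s\<in>{..<k}. if s = 0 then group_algebra_scalar G \<mu> \<odot>\<^bsub>V\<^esub> f (k - 1) else f (s - 1))"


section \<open>The algebra H\<close>

datatype 'g generator = Y_gen | G_gen 'g

definition H_free :: "'g monoid \<Rightarrow> ('g generator list \<Rightarrow> 'k::field) ring" where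
  "H_free G = monoid_algebra (free_monoid (insert Y_gen (G_gen ` carrier G)))"

definition letter :: "'g generator \<Rightarrow> ('g generator list \<Rightarrow> 'k::field)" where
  "letter l = single 1 [l]"

text \<open>The first two families of relations make the letters of \<open>G\<close> multiply as in \<open>G\<close>, i.e. they
  produce a homomorphism from \<open>\<Bbbk>G\<close>; its injectivity is a consequence of the presentation.\<close>

definition H_relations ::
    "'g monoid \<Rightarrow> ('g \<Rightarrow> 'k::field) \<Rightarrow> 'g \<Rightarrow> nat \<Rightarrow> ('g generator list \<Rightarrow> 'k) set" where
  "H_relations G \<chi> g n = (let F = H_free G in
     {letter (G_gen a) \<otimes>\<^bsub>F\<^esub> letter (G_gen b) \<ominus>\<^bsub>F\<^esub> letter (G_gen (a \<otimes>\<^bsub>G\<^esub> b)) | a b.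
        a \<in> carrier G \<and> b \<in> carrier G}
   \<union> {letter (G_gen \<one>\<^bsub>G\<^esub>) \<ominus>\<^bsub>F\<^esub> \<one>\<^bsub>F\<^esub>}
   \<union> {letter Y_gen [^]\<^bsub>F\<^esub> n \<ominus>\<^bsub>F\<^esub> (letter (G_gen (g [^]\<^bsub>G\<^esub> n)) \<ominus>\<^bsub>F\<^esub> \<one>\<^bsub>F\<^esub>)}
   \<union> {letter Y_gen \<otimes>\<^bsub>F\<^esub> letter (G_gen h)
        \<ominus>\<^bsub>F\<^esub> single (\<chi> h) [] \<otimes>\<^bsub>F\<^esub> letter (G_gen h) \<otimes>\<^bsub>F\<^esub> letter Y_gen | h.
        h \<in> carrier G})"

definition H_ideal ::
    "'g monoid \<Rightarrow> ('g \<Rightarrow> 'k::field) \<Rightarrow> 'g \<Rightarrow> nat \<Rightarrow> ('g generator list \<Rightarrow> 'k) set" where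
  "H_ideal G \<chi> g n = genideal (H_free G) (H_relations G \<chi> g n)"

definition H_algebra ::
    "'g monoid \<Rightarrow> ('g \<Rightarrow> 'k::field) \<Rightarrow> 'g \<Rightarrow> nat \<Rightarrow> ('g generator list \<Rightarrow> 'k) set ring" where
  "H_algebra G \<chi> g n = H_free G Quot H_ideal G \<chi> g n"

definition H_scalar ::
    "'g monoid \<Rightarrow> ('g \<Rightarrow> 'k::field) \<Rightarrow> 'g \<Rightarrow> nat \<Rightarrow> 'k \<Rightarrow> ('g generator list \<Rightarrow> 'k) set" where
  "H_scalar G \<chi> g n c = H_ideal G \<chi> g n +>\<^bsub>H_free G\<^esub> single c []"

text \<open>A \<open>\<Bbbk>G\<close>-module \<open>T\<close> and a linear operator \<open>\<phi>\<close> on it determine an action of the free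
  algebra in which the letter \<open>y\<close> acts as \<open>\<phi>\<close>. If this action kills the relations of \<open>H\<close>, it
  does not depend on the representative \<open>f\<close> of an element \<open>C\<close> of \<open>H\<close>, and the following is the
  \<open>H\<close>-module on the space \<open>T\<close> with the given actions of \<open>G\<close> and of \<open>y\<close>.\<close>

fun letter_action ::
    "('g \<Rightarrow> 'k::field, 'm) module \<Rightarrow> ('m \<Rightarrow> 'm) \<Rightarrow> 'g generator \<Rightarrow> 'm \<Rightarrow> 'm" where
  "letter_action T \<phi> Y_gen m = \<phi> m"
| "letter_action T \<phi> (G_gen h) m = single 1 h \<odot>\<^bsub>T\<^esub> m"

definition H_module ::
    "'g monoid \<Rightarrow> ('g \<Rightarrow> 'k::field, 'm) module \<Rightarrow> ('m \<Rightarrow> 'm) \<Rightarrow>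
     (('g generator list \<Rightarrow> 'k) set, 'm) module" where
  "H_module G T \<phi> =
     \<lparr>carrier = carrier T, mult = undefined, one = undefined, zero = \<zero>\<^bsub>T\<^esub>, add = add T,
      smult = (\<lambda>C m. let f = (SOME f. f \<in> C) in
        \<Oplus>\<^bsub>T\<^esub>w\<in>{w. f w \<noteq> 0}.
          group_algebra_scalar G (f w) \<odot>\<^bsub>T\<^esub> foldr (letter_action T \<phi>) w m)\<rparr>"

definition M_module ::
    "'g monoid \<Rightarrow> ('g \<Rightarrow> 'k::field) \<Rightarrow> nat \<Rightarrow> ('g \<Rightarrow> 'k, 'v) module \<Rightarrow>
     (('g generator list \<Rightarrow> 'k) set, nat \<Rightarrow> 'v) module" where
  "M_module G \<chi> k V = H_module G (tower G \<chi> k V) (tower_shift G k V 0)"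

definition P_module ::
    "'g monoid \<Rightarrow> ('g \<Rightarrow> 'k::field) \<Rightarrow> 'g \<Rightarrow> nat \<Rightarrow> ('g \<Rightarrow> 'k, 'v) module \<Rightarrow>
     (('g generator list \<Rightarrow> 'k) set, nat \<Rightarrow> 'v) module" where
  "P_module G \<chi> g n V =
     H_module G (tower G \<chi> n V) (tower_shift G n V (central_scalar G g n V - 1))"

end

theory Submission
  imports Defs
begin

text \<open>An \<open>H\<close>-module is a \<open>\<Bbbk>G\<close>-module with an operator \<open>y\<close> satisfying \<open>y h = \<chi>(h) h y\<close> and
  \<open>y\<^sup>n = g\<^sup>n - 1\<close>. On an indecomposable module the central element \<open>g\<^sup>n\<close> acts as a scalar \<open>\<lambda>\<close>, so
  \<open>y\<^sup>n = \<lambda> - 1\<close>. Take a simple \<open>\<Bbbk>G\<close>-submodule \<open>W\<close> on which \<open>y\<^sup>k\<^sup>-\<^sup>1\<close> is injective, where \<open>k = n\<close> if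
  \<open>\<lambda> \<noteq> 1\<close> and \<open>k\<close> is the nilpotency index of \<open>y\<close> if \<open>\<lambda> = 1\<close>; in both cases \<open>y\<^sup>k\<close> is a scalar \<open>\<mu>\<close>.
  The element \<open>g\<close> acts on \<open>y\<^sup>s W\<close> as \<open>\<chi>(g)\<^sup>-\<^sup>s \<nu>\<close> for some \<open>\<nu>\<close>, and these scalars are distinct for
  \<open>s < k\<close>, so \<open>W, yW, \<dots>, y\<^sup>k\<^sup>-\<^sup>1 W\<close> are independent and span a tower over \<open>W\<close>. With an equivariant
  projection \<open>\<pi>\<close> onto \<open>y\<^sup>k\<^sup>-\<^sup>1 W\<close> that kills the other eigenspaces of \<open>g\<close>,
  \<open>x \<mapsto> \<Sum>s<k. y\<^sup>s (y\<^sup>k\<^sup>-\<^sup>1)\<^sup>-\<^sup>1 \<pi> (y\<^sup>k\<^sup>-\<^sup>1\<^sup>-\<^sup>s x)\<close> is an \<open>H\<close>-linear projection onto this tower,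
  which is therefore the whole module. Every nonzero submodule of a tower contains its top layer, so
  towers are indecomposable. By Schur's lemma, some component of an isomorphism of towers maps the
  bottom layer isomorphically onto a layer \<open>x\<^sup>s V\<close> of the target.\<close>

section \<open>Homomorphisms and submodules of left modules\<close>

text \<open>The operator y is not linear over the group algebra: \<open>y h = \<chi>(h) h y\<close>
  makes \<open>y^s\<close> a homomorphism on \<open>twist s V\<close>, that is, on V tensored with
  \<open>\<chi>^(-s)\<close>. Two difficulties follow. First, an equivariant complement of a layer
  has no reason to be stable under y, so Maschke's theorem alone does not split off a tower. Summing
  over all layers repairs this: multiplication by y moves each term to the next one, and the last
  term returns to the first with the factor \<mu> on both sides, because \<open>y^k = \<mu>\<close>.
  This is also why, for nilpotent y, the tower must be as long as the nilpotency index: a shorter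
  one need not be a summand. Second, for \<mu> \<noteq> 0 the operator y permutes the layers
  cyclically, so the module determines W only up to twisting; this is the origin of the
  \<tau>-orbits. For \<mu> = 0 the bottom layer is singled out as a complement of the range of y,
  and no twist can occur. That \<open>\<chi> g\<close> has order exactly n separates the layers, and
  \<open>\<chi>^n = 1\<close> lets a tower of height n close up.\<close>

context abelian_group
begin

lemma minus_self: "x \<in> carrier G \<Longrightarrow> x \<ominus> x = \<zero>"
  by (simp add: a_minus_def r_neg)

lemma minus_add_cancel: "\<lbrakk>x \<in> carrier G; y \<in> carrier G\<rbrakk> \<Longrightarrow> (x \<ominus> y) \<oplus> y = x"
  by (simp add: a_minus_def a_assoc l_neg)

lemma minus_eqI: "\<lbrakk>z \<oplus> y = x; y \<in> carrier G; z \<in> carrier G\<rbrakk> \<Longrightarrow> x \<ominus> y = z"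
  by (auto simp: a_minus_def a_assoc r_neg)

lemma minus_eq_zeroD: "\<lbrakk>x \<ominus> y = \<zero>; x \<in> carrier G; y \<in> carrier G\<rbrakk> \<Longrightarrow> x = y"
  using minus_add_cancel[of x y] by simp

end

definition left_module_hom ::
    "('a, 'r) ring_scheme \<Rightarrow> ('a, 'm, 's) module_scheme \<Rightarrow> ('a, 'l, 't) module_scheme \<Rightarrow> ('m \<Rightarrow> 'l) \<Rightarrow> bool" where
  "left_module_hom R M N f \<longleftrightarrow>
     f \<in> carrier M \<rightarrow> carrier N \<and>
     (\<forall>x\<in>carrier M. \<forall>y\<in>carrier M. f (x \<oplus>\<^bsub>M\<^esub> y) = f x \<oplus>\<^bsub>N\<^esub> f y) \<and>
     (\<forall>a\<in>carrier R. \<forall>x\<in>carrier M. f (a \<odot>\<^bsub>M\<^esub> x) = a \<odot>\<^bsub>N\<^esub> f x)"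

lemma left_module_homI:
  assumes "\<And>x. x \<in> carrier M \<Longrightarrow> f x \<in> carrier N"
    and "\<And>x y. \<lbrakk>x \<in> carrier M; y \<in> carrier M\<rbrakk> \<Longrightarrow> f (x \<oplus>\<^bsub>M\<^esub> y) = f x \<oplus>\<^bsub>N\<^esub> f y"
    and "\<And>a x. \<lbrakk>a \<in> carrier R; x \<in> carrier M\<rbrakk> \<Longrightarrow> f (a \<odot>\<^bsub>M\<^esub> x) = a \<odot>\<^bsub>N\<^esub> f x"
  shows "left_module_hom R M N f"
  using assms by (auto simp: left_module_hom_def)

lemma left_module_homD:
  assumes "left_module_hom R M N f"
  shows "x \<in> carrier M \<Longrightarrow> f x \<in> carrier N"
    and "\<lbrakk>x \<in> carrier M; y \<in> carrier M\<rbrakk> \<Longrightarrow> f (x \<oplus>\<^bsub>M\<^esub> y) = f x \<oplus>\<^bsub>N\<^esub> f y"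
    and "\<lbrakk>a \<in> carrier R; x \<in> carrier M\<rbrakk> \<Longrightarrow> f (a \<odot>\<^bsub>M\<^esub> x) = a \<odot>\<^bsub>N\<^esub> f x"
  using assms by (auto simp: left_module_hom_def)

lemma left_module_hom_comp:
  assumes "left_module_hom R M N f" "left_module_hom R N P h"
  shows "left_module_hom R M P (\<lambda>x. h (f x))"
  using assms by (auto simp: left_module_hom_def Pi_iff)

text \<open>The \<open>additive_\<close> lemmas assume additivity only, because they are also
  applied to \<open>\<phi>\<close> and its powers, which are not linear over the group algebra, and
  to maps out of a ring.\<close>

lemma additive_zero:
  assumes "abelian_group M" "abelian_group N" "f \<in> carrier M \<rightarrow> carrier N"
    and "\<And>x y. \<lbrakk>x \<in> carrier M; y \<in> carrier M\<rbrakk> \<Longrightarrow> f (x \<oplus>\<^bsub>M\<^esub> y) = f x \<oplus>\<^bsub>N\<^esub> f y"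
  shows "f \<zero>\<^bsub>M\<^esub> = \<zero>\<^bsub>N\<^esub>"
proof -
  interpret M: abelian_group M by fact
  interpret N: abelian_group N by fact
  have c: "f \<zero>\<^bsub>M\<^esub> \<in> carrier N" using assms(3) by auto
  have "f \<zero>\<^bsub>M\<^esub> \<oplus>\<^bsub>N\<^esub> f \<zero>\<^bsub>M\<^esub> = f \<zero>\<^bsub>M\<^esub>" using assms(4)[of "\<zero>\<^bsub>M\<^esub>" "\<zero>\<^bsub>M\<^esub>"] by simp
  then show ?thesis using c N.add.r_cancel_one' by metis
qed

lemma additive_minus:
  assumes "abelian_group M" "abelian_group N" "f \<in> carrier M \<rightarrow> carrier N"
    and "\<And>x y. \<lbrakk>x \<in> carrier M; y \<in> carrier M\<rbrakk> \<Longrightarrow> f (x \<oplus>\<^bsub>M\<^esub> y) = f x \<oplus>\<^bsub>N\<^esub> f y"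
    and "x \<in> carrier M" "y \<in> carrier M"
  shows "f (x \<ominus>\<^bsub>M\<^esub> y) = f x \<ominus>\<^bsub>N\<^esub> f y"
proof -
  interpret M: abelian_group M by fact
  interpret N: abelian_group N by fact
  have c: "f x \<in> carrier N" "f y \<in> carrier N" "f (x \<ominus>\<^bsub>M\<^esub> y) \<in> carrier N" using assms(3,5,6) by auto
  have "f (x \<ominus>\<^bsub>M\<^esub> y) \<oplus>\<^bsub>N\<^esub> f y = f ((x \<ominus>\<^bsub>M\<^esub> y) \<oplus>\<^bsub>M\<^esub> y)" using assms(4-6) by simp
  also have "\<dots> = f x" using assms(5,6) by (simp add: M.minus_add_cancel)
  finally show ?thesis by (rule N.minus_eqI[OF _ c(2,3), symmetric])
qed

lemma additive_inj_on:
  assumes "abelian_group M" "abelian_group N" "f \<in> carrier M \<rightarrow> carrier N"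
    and "\<And>x y. \<lbrakk>x \<in> carrier M; y \<in> carrier M\<rbrakk> \<Longrightarrow> f (x \<oplus>\<^bsub>M\<^esub> y) = f x \<oplus>\<^bsub>N\<^esub> f y"
    and "\<And>x. \<lbrakk>x \<in> carrier M; f x = \<zero>\<^bsub>N\<^esub>\<rbrakk> \<Longrightarrow> x = \<zero>\<^bsub>M\<^esub>"
  shows "inj_on f (carrier M)"
proof (rule inj_onI)
  interpret M: abelian_group M by fact
  interpret N: abelian_group N by fact
  fix x y assume xy: "x \<in> carrier M" "y \<in> carrier M" "f x = f y"
  then have "f (x \<ominus>\<^bsub>M\<^esub> y) = \<zero>\<^bsub>N\<^esub>"
    using additive_minus[OF assms(1-4), of x y] assms(3) by (simp add: N.minus_self Pi_iff)
  then have "x \<ominus>\<^bsub>M\<^esub> y = \<zero>\<^bsub>M\<^esub>" using assms(5) xy by simp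
  then show "x = y" using M.minus_eq_zeroD[of x y] xy by simp
qed

lemma additive_finsum:
  assumes "abelian_group M" "abelian_group N" "f \<in> carrier M \<rightarrow> carrier N"
    and "\<And>x y. \<lbrakk>x \<in> carrier M; y \<in> carrier M\<rbrakk> \<Longrightarrow> f (x \<oplus>\<^bsub>M\<^esub> y) = f x \<oplus>\<^bsub>N\<^esub> f y"
    and "u \<in> A \<rightarrow> carrier M"
  shows "f (\<Oplus>\<^bsub>M\<^esub>i\<in>A. u i) = (\<Oplus>\<^bsub>N\<^esub>i\<in>A. f (u i))"
proof -
  interpret M: abelian_group M by fact
  interpret N: abelian_group N by fact
  have z: "f \<zero>\<^bsub>M\<^esub> = \<zero>\<^bsub>N\<^esub>" by (rule additive_zero) (use assms in auto)
  show ?thesis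
  proof (cases "finite A")
    case True
    then show ?thesis using assms(5)
    proof (induct A)
      case empty then show ?case by (simp add: z)
    next
      case (insert a A)
      have "(\<Oplus>\<^bsub>M\<^esub>i\<in>A. u i) \<in> carrier M" using insert by (intro M.finsum_closed) auto
      moreover have "(\<lambda>i. f (u i)) \<in> A \<rightarrow> carrier N" using insert assms(3) by auto
      ultimately show ?case using insert assms(3,4)
        by (simp add: M.finsum_insert N.finsum_insert Pi_iff)
    qed
  next
    case False
    \<comment> \<open>Sums over infinite sets have the default value zero, which \<open>f\<close>
      preserves.\<close>
    then show ?thesis by (simp add: M.add.finprod_infinite N.add.finprod_infinite finsum_def finprod_def z)
  qed
qed

lemma module_iso_altdef:
  "module_iso R M N \<longleftrightarrow> (\<exists>f. left_module_hom R M N f \<and> bij_betw f (carrier M) (carrier N))"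
  unfolding module_iso_def left_module_hom_def by (auto dest: bij_betwE)

lemma module_isoI:
  "\<lbrakk>left_module_hom R M N f; bij_betw f (carrier M) (carrier N)\<rbrakk> \<Longrightarrow> module_iso R M N"
  by (auto simp: module_iso_altdef)

lemma module_iso_trans:
  "\<lbrakk>module_iso R M N; module_iso R N P\<rbrakk> \<Longrightarrow> module_iso R M P"
  unfolding module_iso_altdef
  using left_module_hom_comp bij_betw_trans[unfolded comp_def] by blast

lemma left_module_abelian_group: "left_module R M \<Longrightarrow> abelian_group M"
  and left_module_ring: "left_module R M \<Longrightarrow> ring R"
  by (auto simp: left_module_def)

lemma left_module_hom_inv:
  assumes "left_module R M" "left_module_hom R M N f" "bij_betw f (carrier M) (carrier N)"
  shows "left_module_hom R N M (the_inv_into (carrier M) f)"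
    and "bij_betw (the_inv_into (carrier M) f) (carrier N) (carrier M)"
proof -
  interpret left_module R M by fact
  let ?g = "the_inv_into (carrier M) f"
  note f = left_module_homD[OF assms(2)]
  have inj: "inj_on f (carrier M)" and img: "f ` carrier M = carrier N"
    using assms(3) by (auto simp: bij_betw_def)
  have gc: "?g y \<in> carrier M" and fg: "f (?g y) = y" if "y \<in> carrier N" for y
    using that inj img by (auto intro: the_inv_into_into f_the_inv_into_f)
  have gf: "?g (f x) = x" if "x \<in> carrier M" for x using that inj by (simp add: the_inv_into_f_f)
  show "bij_betw ?g (carrier N) (carrier M)" by (rule bij_betw_the_inv_into) fact
  show "left_module_hom R N M ?g"
  proof (rule left_module_homI)
    fix x y assume "x \<in> carrier N" "y \<in> carrier N"
    then show "?g (x \<oplus>\<^bsub>N\<^esub> y) = ?g x \<oplus>\<^bsub>M\<^esub> ?g y"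
      using gf[of "?g x \<oplus>\<^bsub>M\<^esub> ?g y"] by (simp add: f(2) gc fg)
  next
    fix a x assume "a \<in> carrier R" "x \<in> carrier N"
    then show "?g (a \<odot>\<^bsub>N\<^esub> x) = a \<odot>\<^bsub>M\<^esub> ?g x"
      using gf[of "a \<odot>\<^bsub>M\<^esub> ?g x"] by (simp add: f(3) gc fg smult_closed)
  qed (rule gc)
qed

lemma module_iso_sym: "\<lbrakk>left_module R M; module_iso R M N\<rbrakk> \<Longrightarrow> module_iso R N M"
  using left_module_hom_inv module_iso_altdef by metis

context left_module
begin

lemma smult_l_zero: "x \<in> carrier M \<Longrightarrow> \<zero>\<^bsub>R\<^esub> \<odot>\<^bsub>M\<^esub> x = \<zero>\<^bsub>M\<^esub>"
  by (rule additive_zero[OF R.is_abelian_group M.abelian_group_axioms, of "\<lambda>a. a \<odot>\<^bsub>M\<^esub> x"])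
    (auto simp: smult_closed smult_l_distr)

lemma smult_r_zero: "a \<in> carrier R \<Longrightarrow> a \<odot>\<^bsub>M\<^esub> \<zero>\<^bsub>M\<^esub> = \<zero>\<^bsub>M\<^esub>"
  by (rule additive_zero[OF M.abelian_group_axioms M.abelian_group_axioms, of "\<lambda>x. a \<odot>\<^bsub>M\<^esub> x"])
    (auto simp: smult_closed smult_r_distr)

lemma smult_minus_one: "x \<in> carrier M \<Longrightarrow> (\<ominus>\<^bsub>R\<^esub> \<one>\<^bsub>R\<^esub>) \<odot>\<^bsub>M\<^esub> x = \<ominus>\<^bsub>M\<^esub> x"
  using smult_l_distr[of "\<ominus>\<^bsub>R\<^esub> \<one>\<^bsub>R\<^esub>" "\<one>\<^bsub>R\<^esub>" x]
  by (simp add: R.l_neg smult_l_zero smult_one smult_closed M.minus_equality)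

lemma smult_finsum:
  assumes "a \<in> carrier R" "u \<in> A \<rightarrow> carrier M"
  shows "a \<odot>\<^bsub>M\<^esub> (\<Oplus>\<^bsub>M\<^esub>i\<in>A. u i) = (\<Oplus>\<^bsub>M\<^esub>i\<in>A. a \<odot>\<^bsub>M\<^esub> u i)"
  by (rule additive_finsum) (use assms in \<open>auto simp: smult_closed smult_r_distr M.abelian_group_axioms\<close>)

text \<open>The library's \<open>submodule\<close> also asks for negatives; they come from the
  scalar minus one.\<close>

lemma submoduleI:
  assumes "N \<subseteq> carrier M" "\<zero>\<^bsub>M\<^esub> \<in> N"
    and "\<And>x y. \<lbrakk>x \<in> N; y \<in> N\<rbrakk> \<Longrightarrow> x \<oplus>\<^bsub>M\<^esub> y \<in> N"
    and "\<And>a x. \<lbrakk>a \<in> carrier R; x \<in> N\<rbrakk> \<Longrightarrow> a \<odot>\<^bsub>M\<^esub> x \<in> N"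
  shows "submodule N R M"
proof (intro submodule.intro subgroup.intro)
  fix x assume "x \<in> N"
  then have "\<ominus>\<^bsub>M\<^esub> x \<in> N" using assms(4)[of "\<ominus>\<^bsub>R\<^esub> \<one>\<^bsub>R\<^esub>" x] assms(1) by (auto simp: smult_minus_one)
  then show "inv\<^bsub>add_monoid M\<^esub> x \<in> N" by (simp add: a_inv_def)
qed (use assms in \<open>auto simp: submodule_axioms_def\<close>)

lemma submoduleD:
  assumes "submodule N R M"
  shows "N \<subseteq> carrier M" "\<zero>\<^bsub>M\<^esub> \<in> N"
    and "\<lbrakk>x \<in> N; y \<in> N\<rbrakk> \<Longrightarrow> x \<oplus>\<^bsub>M\<^esub> y \<in> N"
    and "\<lbrakk>a \<in> carrier R; x \<in> N\<rbrakk> \<Longrightarrow> a \<odot>\<^bsub>M\<^esub> x \<in> N"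
    and "\<lbrakk>x \<in> N; y \<in> N\<rbrakk> \<Longrightarrow> x \<ominus>\<^bsub>M\<^esub> y \<in> N"
proof -
  interpret N: submodule N R M by fact
  show "N \<subseteq> carrier M" using N.subset by simp
  show "\<zero>\<^bsub>M\<^esub> \<in> N" using N.one_closed by simp
  show "\<lbrakk>x \<in> N; y \<in> N\<rbrakk> \<Longrightarrow> x \<oplus>\<^bsub>M\<^esub> y \<in> N" using N.m_closed by simp
  show "\<lbrakk>a \<in> carrier R; x \<in> N\<rbrakk> \<Longrightarrow> a \<odot>\<^bsub>M\<^esub> x \<in> N" by (rule N.smult_closed)
  show "\<lbrakk>x \<in> N; y \<in> N\<rbrakk> \<Longrightarrow> x \<ominus>\<^bsub>M\<^esub> y \<in> N" using N.m_closed N.m_inv_closed[of y]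
    by (simp add: a_minus_def a_inv_def)
qed

lemma submodule_left_module:
  assumes "submodule N R M" shows "left_module R (M\<lparr>carrier := N\<rparr>)"
proof -
  interpret N: submodule N R M by fact
  note D = submoduleD[OF assms]
  have mem: "x \<in> carrier M" if "x \<in> N" for x using D(1) that by auto
  have "abelian_group (M\<lparr>carrier := N\<rparr>)"
  proof (rule abelian_groupI)
    fix x assume "x \<in> carrier (M\<lparr>carrier := N\<rparr>)"
    then have "x \<in> N" by simp
    then have "\<ominus>\<^bsub>M\<^esub> x \<in> N" "\<ominus>\<^bsub>M\<^esub> x \<oplus>\<^bsub>M\<^esub> x = \<zero>\<^bsub>M\<^esub>"
      using N.m_inv_closed[of x] D(1) by (auto simp: a_inv_def intro: M.l_neg[unfolded a_inv_def])
    then show "\<exists>y\<in>carrier (M\<lparr>carrier := N\<rparr>). y \<oplus>\<^bsub>M\<lparr>carrier := N\<rparr>\<^esub> x = \<zero>\<^bsub>M\<lparr>carrier := N\<rparr>\<^esub>" by auto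
  qed (simp_all add: D(2,3) mem M.a_ac)
  then show ?thesis
    by (simp add: left_module_def left_module_axioms_def R.ring_axioms smult_l_distr smult_r_distr
        smult_assoc smult_one mem D(4))
qed

lemma submodule_kernel:
  assumes "left_module R N" "left_module_hom R M N f"
  shows "submodule {x \<in> carrier M. f x = \<zero>\<^bsub>N\<^esub>} R M"
proof -
  interpret N: left_module R N by fact
  note f = left_module_homD[OF assms(2)]
  have "f \<zero>\<^bsub>M\<^esub> = \<zero>\<^bsub>N\<^esub>" using f(1,2)
    by (intro additive_zero[OF M.abelian_group_axioms N.M.abelian_group_axioms]) auto
  then show ?thesis by (intro submoduleI) (auto simp: f N.smult_r_zero smult_closed)
qed

lemma submodule_image:
  assumes "left_module R N" "left_module_hom R M N f" "submodule K R M"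
  shows "submodule (f ` K) R N"
proof -
  interpret N: left_module R N by fact
  note f = left_module_homD[OF assms(2)] and K = submoduleD[OF assms(3)]
  have "f \<zero>\<^bsub>M\<^esub> = \<zero>\<^bsub>N\<^esub>" using f(1,2)
    by (intro additive_zero[OF M.abelian_group_axioms N.M.abelian_group_axioms]) auto
  moreover have "f x \<oplus>\<^bsub>N\<^esub> f y \<in> f ` K" if "x \<in> K" "y \<in> K" for x y
    using that f(2)[of x y] K by (metis image_eqI subsetD)
  moreover have "a \<odot>\<^bsub>N\<^esub> f x \<in> f ` K" if "a \<in> carrier R" "x \<in> K" for a x
    using that f(3)[of a x] K by (metis image_eqI subsetD)
  moreover have "f ` K \<subseteq> carrier N" using K(1) f(1) by auto
  ultimately show ?thesis using K(2) by (intro N.submoduleI) (auto simp del: image_iff intro: image_eqI[OF sym])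
qed

lemma submodule_carrier: "submodule (carrier M) R M"
  by (rule submoduleI) (auto simp: smult_closed)

lemma submodule_sum:
  assumes "submodule K R M" "submodule N R M"
  shows "submodule {x \<oplus>\<^bsub>M\<^esub> y | x y. x \<in> K \<and> y \<in> N} R M" (is "submodule ?S R M")
proof (rule submoduleI)
  note K = submoduleD[OF assms(1)] and N = submoduleD[OF assms(2)]
  show "?S \<subseteq> carrier M" using K(1) N(1) by auto
  show "\<zero>\<^bsub>M\<^esub> \<in> ?S" using K(2) N(2) by force
  fix u v assume "u \<in> ?S" "v \<in> ?S"
  then obtain x y x' y' where *: "u = x \<oplus>\<^bsub>M\<^esub> y" "v = x' \<oplus>\<^bsub>M\<^esub> y'" "x \<in> K" "y \<in> N" "x' \<in> K" "y' \<in> N"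
    by blast
  then have c: "x \<in> carrier M" "y \<in> carrier M" "x' \<in> carrier M" "y' \<in> carrier M" using K(1) N(1) by auto
  have "u \<oplus>\<^bsub>M\<^esub> v = (x \<oplus>\<^bsub>M\<^esub> x') \<oplus>\<^bsub>M\<^esub> (y \<oplus>\<^bsub>M\<^esub> y')" using c by (simp add: * M.a_ac)
  then show "u \<oplus>\<^bsub>M\<^esub> v \<in> ?S" using * K(3) N(3) by blast
next
  fix a u assume a: "a \<in> carrier R" and "u \<in> ?S"
  note K = submoduleD[OF assms(1)] and N = submoduleD[OF assms(2)]
  obtain x y where *: "u = x \<oplus>\<^bsub>M\<^esub> y" "x \<in> K" "y \<in> N" using \<open>u \<in> ?S\<close> by blast
  then have "x \<in> carrier M" "y \<in> carrier M" using K(1) N(1) by auto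
  then have "a \<odot>\<^bsub>M\<^esub> u = a \<odot>\<^bsub>M\<^esub> x \<oplus>\<^bsub>M\<^esub> a \<odot>\<^bsub>M\<^esub> y" using a *(1) by (simp add: smult_r_distr)
  then show "a \<odot>\<^bsub>M\<^esub> u \<in> ?S" using * a K(4) N(4) by blast
qed

lemma submodule_Int:
  "\<lbrakk>submodule K R M; submodule N R M\<rbrakk> \<Longrightarrow> submodule (K \<inter> N) R M"
  by (intro submoduleI) (auto dest: submoduleD submoduleD(1)[THEN subsetD])

text \<open>Upper bounds for the two applications of Zorn's lemma, to complements and to submodules
  that avoid a vector.\<close>

lemma submodule_Union_chain:
  assumes "C \<noteq> {}" "\<And>N. N \<in> C \<Longrightarrow> submodule N R M" "\<And>N N'. \<lbrakk>N \<in> C; N' \<in> C\<rbrakk> \<Longrightarrow> N \<subseteq> N' \<or> N' \<subseteq> N"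
  shows "submodule (\<Union>C) R M"
proof (rule submoduleI)
  show "\<Union>C \<subseteq> carrier M" using submoduleD(1)[OF assms(2)] by blast
  show "\<zero>\<^bsub>M\<^esub> \<in> \<Union>C" using assms(1) submoduleD(2)[OF assms(2)] by blast
  show "x \<oplus>\<^bsub>M\<^esub> y \<in> \<Union>C" if "x \<in> \<Union>C" "y \<in> \<Union>C" for x y
  proof -
    obtain N N' where "N \<in> C" "N' \<in> C" "x \<in> N" "y \<in> N'" using \<open>x \<in> \<Union>C\<close> \<open>y \<in> \<Union>C\<close> by blast
    then obtain P where "P \<in> C" "x \<in> P" "y \<in> P" using assms(3)[of N N'] by blast
    then show ?thesis using submoduleD(3)[OF assms(2)] by blast
  qed
  show "a \<odot>\<^bsub>M\<^esub> x \<in> \<Union>C" if "a \<in> carrier R" "x \<in> \<Union>C" for a x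
    using that submoduleD(4)[OF assms(2)] by blast
qed

end

text \<open>The retraction splits \<open>M\<close> into the image of \<open>J\<close> and the kernel
  of \<open>P\<close>. The image is nonzero because \<open>L\<close> is, so the kernel vanishes.
  This is applied to an eigenspace of \<open>g^n\<close> and to a tower inside the given
  module.\<close>

lemma indecomposable_retract:
  assumes "indecomposable_module R M" "left_module R L" "carrier L \<noteq> {\<zero>\<^bsub>L\<^esub>}"
    and J: "left_module_hom R L M J" and P: "left_module_hom R M L P"
    and PJ: "\<And>x. x \<in> carrier L \<Longrightarrow> P (J x) = x"
  shows "bij_betw P (carrier M) (carrier L)"
proof -
  interpret M: left_module R M using assms(1) by (simp add: indecomposable_module_def)
  interpret L: left_module R L by fact
  note j = left_module_homD[OF J] and p = left_module_homD[OF P]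
  let ?N = "J ` carrier L" and ?K = "{x \<in> carrier M. P x = \<zero>\<^bsub>L\<^esub>}"
  have sN: "submodule ?N R M"
    by (rule L.submodule_image[OF M.left_module_axioms J L.submodule_carrier])
  have sK: "submodule ?K R M" by (rule M.submodule_kernel[OF L.left_module_axioms P])
  have P0: "P \<zero>\<^bsub>M\<^esub> = \<zero>\<^bsub>L\<^esub>" and J0: "J \<zero>\<^bsub>L\<^esub> = \<zero>\<^bsub>M\<^esub>"
    using M.submoduleD(2)[OF sK] j(1,2)
    by (auto intro!: additive_zero[OF L.M.abelian_group_axioms M.M.abelian_group_axioms])
  have Pm: "P (x \<ominus>\<^bsub>M\<^esub> y) = P x \<ominus>\<^bsub>L\<^esub> P y" if "x \<in> carrier M" "y \<in> carrier M" for x y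
    using that p(1,2) by (intro additive_minus[OF M.M.abelian_group_axioms L.M.abelian_group_axioms]) auto
  have "?N \<inter> ?K = {\<zero>\<^bsub>M\<^esub>}"
    using PJ J0 P0 j(1)[of "\<zero>\<^bsub>L\<^esub>"] by (auto intro!: image_eqI[of _ J "\<zero>\<^bsub>L\<^esub>"])
  moreover have "?N <+>\<^bsub>M\<^esub> ?K = carrier M"
  proof
    show "?N <+>\<^bsub>M\<^esub> ?K \<subseteq> carrier M" using j(1) by (auto simp: set_add_def')
    show "carrier M \<subseteq> ?N <+>\<^bsub>M\<^esub> ?K"
    proof
      fix x assume x: "x \<in> carrier M"
      let ?y = "J (P x)"
      have y: "?y \<in> carrier M" using x j(1) p(1) by blast
      have "P (x \<ominus>\<^bsub>M\<^esub> ?y) = P x \<ominus>\<^bsub>L\<^esub> P ?y" by (rule Pm[OF x y])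
      also have "\<dots> = \<zero>\<^bsub>L\<^esub>" using PJ x p(1) by (simp add: L.M.minus_self)
      finally have "P (x \<ominus>\<^bsub>M\<^esub> ?y) = \<zero>\<^bsub>L\<^esub>" .
      then have "x \<ominus>\<^bsub>M\<^esub> ?y \<in> ?K" using x y by simp
      moreover have "x = ?y \<oplus>\<^bsub>M\<^esub> (x \<ominus>\<^bsub>M\<^esub> ?y)" using x y
        by (simp add: M.M.a_comm[of ?y] M.M.minus_add_cancel)
      moreover have "?y \<in> ?N" using x p(1) by simp
      ultimately show "x \<in> ?N <+>\<^bsub>M\<^esub> ?K" unfolding set_add_def' by blast
    qed
  qed
  ultimately have "?N = {\<zero>\<^bsub>M\<^esub>} \<or> ?K = {\<zero>\<^bsub>M\<^esub>}"
    using assms(1) sN sK by (simp add: indecomposable_module_def)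
  moreover have "?N \<noteq> {\<zero>\<^bsub>M\<^esub>}"
  proof
    assume "?N = {\<zero>\<^bsub>M\<^esub>}"
    then have "J x = \<zero>\<^bsub>M\<^esub>" if "x \<in> carrier L" for x using that by blast
    then have "x = \<zero>\<^bsub>L\<^esub>" if "x \<in> carrier L" for x using that PJ[OF that] P0 by simp
    then show False using assms(3) L.M.zero_closed by blast
  qed
  ultimately have K0: "?K = {\<zero>\<^bsub>M\<^esub>}" by blast
  have "inj_on P (carrier M)"
    by (rule additive_inj_on[OF M.M.abelian_group_axioms L.M.abelian_group_axioms])
      (use p(1,2) K0 in auto)
  moreover have "P ` carrier M = carrier L"
  proof
    show "P ` carrier M \<subseteq> carrier L" using p(1) by auto
    show "carrier L \<subseteq> P ` carrier M" using PJ j(1) by (metis image_eqI subsetI)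
  qed
  ultimately show ?thesis by (simp add: bij_betw_def)
qed

text \<open>Pullback along a map of rings. It yields an \<open>H\<close>-module seen over the group
  algebra or the free algebra, the vector space underlying a module, and the twists by powers of
  \<open>\<chi>\<close>.\<close>

definition restrict_scalars ::
    "('b \<Rightarrow> 'a) \<Rightarrow> ('a, 'm) module \<Rightarrow> ('b, 'm) module" where
  "restrict_scalars f M =
     \<lparr>carrier = carrier M, mult = undefined, one = undefined, zero = \<zero>\<^bsub>M\<^esub>, add = add M,
      smult = (\<lambda>a x. f a \<odot>\<^bsub>M\<^esub> x)\<rparr>"

lemma restrict_scalars_simps [simp]:
  "carrier (restrict_scalars f M) = carrier M" "\<zero>\<^bsub>restrict_scalars f M\<^esub> = \<zero>\<^bsub>M\<^esub>"
  "add (restrict_scalars f M) = add M" "a \<odot>\<^bsub>restrict_scalars f M\<^esub> x = f a \<odot>\<^bsub>M\<^esub> x"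
  by (simp_all add: restrict_scalars_def)

lemma abelian_group_cong:
  assumes "abelian_group M" "carrier N = carrier M" "\<zero>\<^bsub>N\<^esub> = \<zero>\<^bsub>M\<^esub>" "add N = add M"
  shows "abelian_group N"
proof -
  interpret M: abelian_group M by fact
  show ?thesis
  proof (rule abelian_groupI)
    fix x assume "x \<in> carrier N"
    then show "\<exists>y\<in>carrier N. y \<oplus>\<^bsub>N\<^esub> x = \<zero>\<^bsub>N\<^esub>"
      unfolding assms(2-4) by (intro bexI[of _ "\<ominus>\<^bsub>M\<^esub> x"]) (auto simp: M.l_neg)
  qed (simp_all add: assms(2-4) M.a_ac)
qed

lemma finsum_cong_module:
  assumes "carrier N = carrier M" "\<zero>\<^bsub>N\<^esub> = \<zero>\<^bsub>M\<^esub>" "add N = add M"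
  shows "finsum N f A = finsum M f A"
  using assms by (simp add: finsum_def finprod_def)

lemma left_module_restrict_scalars:
  assumes "left_module R M" "ring S" "f \<in> ring_hom S R"
  shows "left_module S (restrict_scalars f M)"
proof -
  interpret left_module R M by fact
  have "abelian_group (restrict_scalars f M)"
    by (rule abelian_group_cong[OF M.abelian_group_axioms]) simp_all
  then show ?thesis
    using assms(2) ring_hom_closed[OF assms(3)] ring_hom_add[OF assms(3)] ring_hom_mult[OF assms(3)]
      ring_hom_one[OF assms(3)]
    by (simp add: left_module_def left_module_axioms_def smult_closed smult_l_distr smult_r_distr
        smult_assoc smult_one)
qed

text \<open>Moves a simple module onto elements of type \<open>nat \<Rightarrow> 'k\<close>, the
  type on which the list of simple modules is assumed to be complete.\<close>

definition transport_module :: "('m \<Rightarrow> 'l) \<Rightarrow> ('a, 'm) module \<Rightarrow> ('a, 'l) module" where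
  "transport_module J M = (let i = the_inv_into (carrier M) J in
     \<lparr>carrier = J ` carrier M, mult = undefined, one = undefined, zero = J \<zero>\<^bsub>M\<^esub>,
      add = (\<lambda>u v. J (i u \<oplus>\<^bsub>M\<^esub> i v)), smult = (\<lambda>a u. J (a \<odot>\<^bsub>M\<^esub> i u))\<rparr>)"

lemma transport_module:
  assumes "left_module R M" "inj_on J (carrier M)"
  shows "left_module R (transport_module J M)"
    and "left_module_hom R M (transport_module J M) J"
    and "bij_betw J (carrier M) (carrier (transport_module J M))"
proof -
  interpret left_module R M by fact
  let ?T = "transport_module J M"
  have i: "the_inv_into (carrier M) J (J x) = x" if "x \<in> carrier M" for x
    using that assms(2) by (simp add: the_inv_into_f_f)
  have T: "carrier ?T = J ` carrier M" "\<zero>\<^bsub>?T\<^esub> = J \<zero>\<^bsub>M\<^esub>"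
    by (simp_all add: transport_module_def Let_def)
  have add: "J x \<oplus>\<^bsub>?T\<^esub> J y = J (x \<oplus>\<^bsub>M\<^esub> y)" if "x \<in> carrier M" "y \<in> carrier M" for x y
    using that by (simp add: transport_module_def Let_def i)
  have sm: "a \<odot>\<^bsub>?T\<^esub> J x = J (a \<odot>\<^bsub>M\<^esub> x)" if "x \<in> carrier M" for a x
    using that by (simp add: transport_module_def Let_def i)
  have "abelian_group ?T"
  proof (rule abelian_groupI)
    fix u assume "u \<in> carrier ?T"
    then obtain x where x: "u = J x" "x \<in> carrier M" by (auto simp: T)
    then have "J (\<ominus>\<^bsub>M\<^esub> x) \<oplus>\<^bsub>?T\<^esub> u = \<zero>\<^bsub>?T\<^esub>" by (simp add: add T M.l_neg)
    then show "\<exists>v\<in>carrier ?T. v \<oplus>\<^bsub>?T\<^esub> u = \<zero>\<^bsub>?T\<^esub>" using x by (auto simp: T)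
  qed (auto simp: T add M.a_ac)
  then show "left_module R ?T"
    by (auto simp: left_module_def left_module_axioms_def R.ring_axioms T add sm smult_closed
        smult_l_distr smult_r_distr smult_assoc smult_one)
  show "left_module_hom R M ?T J"
    by (rule left_module_homI) (auto simp: T add sm)
  show "bij_betw J (carrier M) (carrier ?T)" using assms(2) by (simp add: bij_betw_def T)
qed

lemma simple_module_iso:
  assumes "simple_module R M" "left_module R N" "module_iso R M N"
  shows "simple_module R N"
proof -
  obtain f where f: "left_module_hom R M N f" "bij_betw f (carrier M) (carrier N)"
    using assms(3) by (auto simp: module_iso_altdef)
  interpret M: left_module R M using assms(1) by (simp add: simple_module_def)
  interpret N: left_module R N by fact
  let ?g = "the_inv_into (carrier M) f"
  note g = left_module_hom_inv[OF M.left_module_axioms f]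
  have g0: "?g \<zero>\<^bsub>N\<^esub> = \<zero>\<^bsub>M\<^esub>" using left_module_homD[OF g(1)]
    by (intro additive_zero[OF N.M.abelian_group_axioms M.M.abelian_group_axioms]) auto
  have fg: "f (?g y) = y" if "y \<in> carrier N" for y
    using that f(2) by (auto intro: f_the_inv_into_f simp: bij_betw_def)
  have f0: "f \<zero>\<^bsub>M\<^esub> = \<zero>\<^bsub>N\<^esub>" using fg[of "\<zero>\<^bsub>N\<^esub>"] g0 by simp
  have "K = {\<zero>\<^bsub>N\<^esub>} \<or> K = carrier N" if K: "submodule K R N" for K
  proof -
    have Kc: "K \<subseteq> carrier N" using N.submoduleD(1)[OF K] .
    have "submodule (?g ` K) R M" by (rule N.submodule_image[OF M.left_module_axioms g(1) K])
    then have "?g ` K = {\<zero>\<^bsub>M\<^esub>} \<or> ?g ` K = carrier M" using assms(1) by (simp add: simple_module_def)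
    moreover have "(\<lambda>x. f (?g x)) ` K = id ` K" using Kc fg by (intro image_cong) auto
    then have "f ` ?g ` K = K" by (simp add: image_image)
    ultimately show ?thesis using f(2) f0 by (auto simp: bij_betw_def)
  qed
  moreover have "carrier N \<noteq> {\<zero>\<^bsub>N\<^esub>}"
  proof
    assume *: "carrier N = {\<zero>\<^bsub>N\<^esub>}"
    have "x = \<zero>\<^bsub>M\<^esub>" if "x \<in> carrier M" for x
    proof -
      have "f x = f \<zero>\<^bsub>M\<^esub>" using that * left_module_homD(1)[OF f(1), of x] f0 by simp
      then show ?thesis using that f(2) by (auto simp: bij_betw_def dest: inj_onD)
    qed
    then have "carrier M = {\<zero>\<^bsub>M\<^esub>}" using M.M.zero_closed by blast
    then show False using assms(1) by (simp add: simple_module_def)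
  qed
  ultimately show ?thesis by (simp add: simple_module_def N.left_module_axioms)
qed

lemma finite_dim_iso:
  assumes "left_module R M" "left_module R N" "module_iso R M N"
    and eta: "\<And>c. \<eta> c \<in> carrier R" and "finite_dim \<eta> M"
  shows "finite_dim \<eta> N"
proof -
  interpret M: left_module R M by fact
  interpret N: left_module R N by fact
  obtain f where f: "left_module_hom R M N f" and bij: "bij_betw f (carrier M) (carrier N)"
    using assms(3) by (auto simp: module_iso_altdef)
  note D = left_module_homD[OF f]
  obtain B where B: "finite B" "B \<subseteq> carrier M"
    "\<forall>x\<in>carrier M. \<exists>c. x = (\<Oplus>\<^bsub>M\<^esub>b\<in>B. \<eta> (c b) \<odot>\<^bsub>M\<^esub> b)" using assms(5) by (auto simp: finite_dim_def)
  have inj: "inj_on f B" using bij B(2) by (auto simp: bij_betw_def intro: inj_on_subset)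
  have Bc: "b \<in> carrier M" if "b \<in> B" for b using B(2) that by auto
  have inv: "the_inv_into B f (f b) = b" if "b \<in> B" for b using inj that by (rule the_inv_into_f_f)
  have "\<exists>c. y = (\<Oplus>\<^bsub>N\<^esub>b\<in>f ` B. \<eta> (c b) \<odot>\<^bsub>N\<^esub> b)" if "y \<in> carrier N" for y
  proof -
    have "y \<in> f ` carrier M" using that bij_betw_imp_surj_on[OF bij] by simp
    then obtain x where x: "y = f x" "x \<in> carrier M" by (rule imageE)
    from B(3) x(2) have "\<exists>c. x = (\<Oplus>\<^bsub>M\<^esub>b\<in>B. \<eta> (c b) \<odot>\<^bsub>M\<^esub> b)" by (rule bspec)
    then obtain c where c: "x = (\<Oplus>\<^bsub>M\<^esub>b\<in>B. \<eta> (c b) \<odot>\<^bsub>M\<^esub> b)" ..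
    have "y = f (\<Oplus>\<^bsub>M\<^esub>b\<in>B. \<eta> (c b) \<odot>\<^bsub>M\<^esub> b)" unfolding x(1) by (rule arg_cong[OF c])
    also have "\<dots> = (\<Oplus>\<^bsub>N\<^esub>b\<in>B. f (\<eta> (c b) \<odot>\<^bsub>M\<^esub> b))"
      using D(1,2) by (intro additive_finsum[OF M.M.abelian_group_axioms N.M.abelian_group_axioms])
        (auto simp: eta M.smult_closed Bc)
    also have "\<dots> = (\<Oplus>\<^bsub>N\<^esub>b\<in>B. \<eta> (c (the_inv_into B f (f b))) \<odot>\<^bsub>N\<^esub> f b)"
      by (intro N.M.finsum_cong') (auto simp: eta inv D Bc N.smult_closed)
    also have "\<dots> = (\<Oplus>\<^bsub>N\<^esub>b\<in>f ` B. \<eta> (c (the_inv_into B f b)) \<odot>\<^bsub>N\<^esub> b)"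
      using inj by (intro N.M.finsum_reindex[symmetric]) (auto simp: eta D Bc N.smult_closed)
    finally show ?thesis by (intro exI[of _ "\<lambda>b. c (the_inv_into B f b)"])
  qed
  moreover have "f ` B \<subseteq> carrier N" using B(2) D(1) by auto
  ultimately show ?thesis unfolding finite_dim_def using B(1) by (intro exI[of _ "f ` B"]) auto
qed

text \<open>\<open>finite_dim\<close> speaks of a set of vectors, whereas a family may repeat a
  vector; the coefficients of all indices with the same vector have to be added up.\<close>

lemma finite_dimI:
  fixes \<eta> :: "'k::comm_ring_1 \<Rightarrow> 'a"
  assumes "left_module R M" and eta: "\<And>c. \<eta> c \<in> carrier R" "\<And>c d. \<eta> (c + d) = \<eta> c \<oplus>\<^bsub>R\<^esub> \<eta> d"
    and I: "finite I" "b \<in> I \<rightarrow> carrier M"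
    and span: "\<And>x. x \<in> carrier M \<Longrightarrow> \<exists>c. x = (\<Oplus>\<^bsub>M\<^esub>i\<in>I. \<eta> (c i) \<odot>\<^bsub>M\<^esub> b i)"
  shows "finite_dim \<eta> M"
proof -
  interpret left_module R M by fact
  let ?B = "b ` I"
  have B: "finite ?B" "?B \<subseteq> carrier M" using I by auto
  have eta0: "\<eta> 0 = \<zero>\<^bsub>R\<^esub>" using eta(2)[of 0 0] eta(1)[of 0] R.add.r_cancel_one'[of "\<eta> 0" "\<eta> 0"] by simp
  have cl: "\<eta> (c v) \<odot>\<^bsub>M\<^esub> v \<in> carrier M" if "v \<in> ?B" for c v using that B(2) eta(1) by (auto simp: smult_closed)
  have "\<exists>d. (\<Oplus>\<^bsub>M\<^esub>i\<in>J. \<eta> (c i) \<odot>\<^bsub>M\<^esub> b i) = (\<Oplus>\<^bsub>M\<^esub>v\<in>?B. \<eta> (d v) \<odot>\<^bsub>M\<^esub> v)" if "finite J" "J \<subseteq> I" for c J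
    using that
  proof (induct J)
    case empty
    have "(\<Oplus>\<^bsub>M\<^esub>v\<in>?B. \<eta> 0 \<odot>\<^bsub>M\<^esub> v) = \<zero>\<^bsub>M\<^esub>" using B(2) by (intro M.add.finprod_one_eqI) (auto simp: eta0 smult_l_zero)
    then show ?case by (intro exI[of _ "\<lambda>_. 0"]) simp
  next
    case (insert j J)
    then obtain d where d: "(\<Oplus>\<^bsub>M\<^esub>i\<in>J. \<eta> (c i) \<odot>\<^bsub>M\<^esub> b i) = (\<Oplus>\<^bsub>M\<^esub>v\<in>?B. \<eta> (d v) \<odot>\<^bsub>M\<^esub> v)" by auto
    have bj: "b j \<in> ?B" "b j \<in> carrier M" using insert I by auto
    let ?C = "?B - {b j}"
    have ins: "?B = insert (b j) ?C" using bj by auto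
    have C: "finite ?C" "b j \<notin> ?C" using B by auto
    have Cc: "(\<lambda>v. \<eta> (d v) \<odot>\<^bsub>M\<^esub> v) \<in> ?C \<rightarrow> carrier M" for d using cl by auto
    have bjc: "\<eta> (d (b j)) \<odot>\<^bsub>M\<^esub> b j \<in> carrier M" for d using bj(2) by (simp add: eta(1) smult_closed)
    have split: "(\<Oplus>\<^bsub>M\<^esub>v\<in>?B. \<eta> (d v) \<odot>\<^bsub>M\<^esub> v) = \<eta> (d (b j)) \<odot>\<^bsub>M\<^esub> b j \<oplus>\<^bsub>M\<^esub> (\<Oplus>\<^bsub>M\<^esub>v\<in>?C. \<eta> (d v) \<odot>\<^bsub>M\<^esub> v)" for d
    proof -
      have "(\<Oplus>\<^bsub>M\<^esub>v\<in>insert (b j) ?C. \<eta> (d v) \<odot>\<^bsub>M\<^esub> v) = \<eta> (d (b j)) \<odot>\<^bsub>M\<^esub> b j \<oplus>\<^bsub>M\<^esub> (\<Oplus>\<^bsub>M\<^esub>v\<in>?C. \<eta> (d v) \<odot>\<^bsub>M\<^esub> v)"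
        using bjc Cc by (intro M.finsum_insert C)
      then show ?thesis unfolding ins[symmetric] .
    qed
    let ?e = "d(b j := c j + d (b j))"
    have 1: "(\<Oplus>\<^bsub>M\<^esub>v\<in>?C. \<eta> (?e v) \<odot>\<^bsub>M\<^esub> v) = (\<Oplus>\<^bsub>M\<^esub>v\<in>?C. \<eta> (d v) \<odot>\<^bsub>M\<^esub> v)"
      by (intro M.finsum_cong' refl Cc) auto
    have "(\<Oplus>\<^bsub>M\<^esub>i\<in>insert j J. \<eta> (c i) \<odot>\<^bsub>M\<^esub> b i) = \<eta> (c j) \<odot>\<^bsub>M\<^esub> b j \<oplus>\<^bsub>M\<^esub> (\<Oplus>\<^bsub>M\<^esub>i\<in>J. \<eta> (c i) \<odot>\<^bsub>M\<^esub> b i)"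
      using insert I by (intro M.finsum_insert) (auto simp: eta(1) Pi_iff subset_iff intro!: smult_closed)
    also have "\<dots> = \<eta> (c j) \<odot>\<^bsub>M\<^esub> b j \<oplus>\<^bsub>M\<^esub> (\<eta> (d (b j)) \<odot>\<^bsub>M\<^esub> b j \<oplus>\<^bsub>M\<^esub> (\<Oplus>\<^bsub>M\<^esub>v\<in>?C. \<eta> (d v) \<odot>\<^bsub>M\<^esub> v))"
      unfolding d split[of d] ..
    also have "\<dots> = \<eta> (?e (b j)) \<odot>\<^bsub>M\<^esub> b j \<oplus>\<^bsub>M\<^esub> (\<Oplus>\<^bsub>M\<^esub>v\<in>?C. \<eta> (?e v) \<odot>\<^bsub>M\<^esub> v)"
      unfolding 1 using bj(2) M.finsum_closed[OF Cc] by (simp add: eta smult_closed smult_l_distr M.a_assoc)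
    also have "\<dots> = (\<Oplus>\<^bsub>M\<^esub>v\<in>?B. \<eta> (?e v) \<odot>\<^bsub>M\<^esub> v)" by (rule split[symmetric])
    finally show ?case by blast
  qed
  from this[OF I(1) order_refl] have "\<exists>d. x = (\<Oplus>\<^bsub>M\<^esub>v\<in>?B. \<eta> (d v) \<odot>\<^bsub>M\<^esub> v)" if "x \<in> carrier M" for x
    using span[OF that] by (elim exE) simp
  then show ?thesis using B unfolding finite_dim_def by (intro exI[of _ ?B]) auto
qed

text \<open>\<open>H_module\<close> lets a coset act through an arbitrarily chosen representative.
  As \<open>I\<close> annihilates \<open>M\<close>, all representatives act alike; the last
  assumption on \<open>N\<close> copies the form of that definition.\<close>

lemma left_module_quotient_ring:
  assumes "left_module F M" "ideal I F" and ann: "\<And>a x. \<lbrakk>a \<in> I; x \<in> carrier M\<rbrakk> \<Longrightarrow> a \<odot>\<^bsub>M\<^esub> x = \<zero>\<^bsub>M\<^esub>"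
    and N: "carrier N = carrier M" "\<zero>\<^bsub>N\<^esub> = \<zero>\<^bsub>M\<^esub>" "add N = add M"
      "\<And>C x. C \<odot>\<^bsub>N\<^esub> x = (SOME f. f \<in> C) \<odot>\<^bsub>M\<^esub> x"
  shows "left_module (F Quot I) N"
    and "\<lbrakk>f \<in> carrier F; x \<in> carrier M\<rbrakk> \<Longrightarrow> (I +>\<^bsub>F\<^esub> f) \<odot>\<^bsub>N\<^esub> x = f \<odot>\<^bsub>M\<^esub> x"
proof -
  interpret left_module F M by fact
  interpret I: ideal I F by fact
  have key: "(I +>\<^bsub>F\<^esub> f) \<odot>\<^bsub>N\<^esub> x = f \<odot>\<^bsub>M\<^esub> x" if "f \<in> carrier F" "x \<in> carrier M" for f x
  proof -
    have "f \<in> I +>\<^bsub>F\<^esub> f" using that(1) by (rule I.a_rcos_self)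
    then have "(SOME f'. f' \<in> I +>\<^bsub>F\<^esub> f) \<in> I +>\<^bsub>F\<^esub> f" by (rule someI)
    then obtain a where a: "a \<in> I" "(SOME f'. f' \<in> I +>\<^bsub>F\<^esub> f) = a \<oplus>\<^bsub>F\<^esub> f" by (auto simp: a_r_coset_def')
    then have "a \<in> carrier F" using I.a_subset by auto
    then show ?thesis using a that by (simp add: N smult_l_distr ann smult_closed)
  qed
  then show "\<lbrakk>f \<in> carrier F; x \<in> carrier M\<rbrakk> \<Longrightarrow> (I +>\<^bsub>F\<^esub> f) \<odot>\<^bsub>N\<^esub> x = f \<odot>\<^bsub>M\<^esub> x" .
  have ag: "abelian_group N" by (rule abelian_group_cong[OF M.abelian_group_axioms N(1-3)])
  have carr: "\<exists>f\<in>carrier F. C = I +>\<^bsub>F\<^esub> f" if "C \<in> carrier (F Quot I)" for C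
    using that by (auto simp: FactRing_def A_RCOSETS_def')
  note h = I.rcos_ring_hom
  show "left_module (F Quot I) N"
  proof (intro left_module.intro I.quotient_is_ring ag left_module_axioms.intro)
    fix A x assume "A \<in> carrier (F Quot I)" and x: "x \<in> carrier N"
    then obtain f where f: "f \<in> carrier F" "A = I +>\<^bsub>F\<^esub> f" using carr by blast
    show "A \<odot>\<^bsub>N\<^esub> x \<in> carrier N" using x f by (simp add: key N(1) smult_closed)
    { fix y assume y: "y \<in> carrier N"
      show "A \<odot>\<^bsub>N\<^esub> (x \<oplus>\<^bsub>N\<^esub> y) = A \<odot>\<^bsub>N\<^esub> x \<oplus>\<^bsub>N\<^esub> A \<odot>\<^bsub>N\<^esub> y" using x y f by (simp add: key N(1,3) smult_r_distr) }
    fix B assume "B \<in> carrier (F Quot I)"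
    then obtain f' where f': "f' \<in> carrier F" "B = I +>\<^bsub>F\<^esub> f'" using carr by blast
    show "(A \<oplus>\<^bsub>F Quot I\<^esub> B) \<odot>\<^bsub>N\<^esub> x = A \<odot>\<^bsub>N\<^esub> x \<oplus>\<^bsub>N\<^esub> B \<odot>\<^bsub>N\<^esub> x"
      using x f f' by (simp add: key N(1,3) smult_l_distr flip: ring_hom_add[OF h])
    show "(A \<otimes>\<^bsub>F Quot I\<^esub> B) \<odot>\<^bsub>N\<^esub> x = A \<odot>\<^bsub>N\<^esub> (B \<odot>\<^bsub>N\<^esub> x)"
      using x f f' by (simp add: key N(1,3) smult_assoc smult_closed flip: ring_hom_mult[OF h])
  next
    fix x assume x: "x \<in> carrier N"
    show "\<one>\<^bsub>F Quot I\<^esub> \<odot>\<^bsub>N\<^esub> x = x" using x by (simp add: key N(1) smult_one flip: ring_hom_one[OF h])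
  qed
qed

section \<open>Monoid algebras\<close>

lemma single_closed [simp]: "a \<in> carrier S \<Longrightarrow> single c a \<in> carrier (monoid_algebra S)"
  by (auto simp: monoid_algebra_def single_def intro: finite_subset[of _ "{a}"])

lemma monoid_algebra_add: "(f \<oplus>\<^bsub>monoid_algebra S\<^esub> f') z = f z + f' z"
  by (simp add: monoid_algebra_def)

lemma monoid_algebra_zero: "\<zero>\<^bsub>monoid_algebra S\<^esub> = (\<lambda>_. 0)"
  by (simp add: monoid_algebra_def)

lemma monoid_algebra_one: "\<one>\<^bsub>monoid_algebra S\<^esub> = single 1 \<one>\<^bsub>S\<^esub>"
  by (simp add: monoid_algebra_def)

lemma single_add: "single c a \<oplus>\<^bsub>monoid_algebra S\<^esub> single d a = single (c + d) a"
  by (auto simp: monoid_algebra_def single_def)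

lemma single_zero: "single 0 a = \<zero>\<^bsub>monoid_algebra S\<^esub>"
  by (auto simp: monoid_algebra_def single_def)

lemma single_mult:
  fixes c d :: "'k::comm_ring_1"
  shows "single c a \<otimes>\<^bsub>monoid_algebra S\<^esub> single d b = single (c * d) (a \<otimes>\<^bsub>S\<^esub> b)"
proof
  fix z
  have "(single c a \<otimes>\<^bsub>monoid_algebra S\<^esub> single d b) z
     = (\<Sum>x\<in>{a}. \<Sum>y\<in>{b}. if x \<otimes>\<^bsub>S\<^esub> y = z then single c a x * single d b y else 0)"
    by (rule monoid_algebra_mult_eq) (auto simp: single_def)
  then show "(single c a \<otimes>\<^bsub>monoid_algebra S\<^esub> single d b) z = single (c * d) (a \<otimes>\<^bsub>S\<^esub> b) z"
    by (auto simp: single_def)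
qed

text \<open>Linear statements about the group algebra, the free algebra and the free space on pairs
  are all reduced by this rule to multiples of one basis element.\<close>

lemma monoid_algebra_induct [consumes 1, case_names zero single add]:
  fixes f :: "'a \<Rightarrow> 'k::comm_ring_1"
  assumes "f \<in> carrier (monoid_algebra S)"
    and "P (\<zero>\<^bsub>monoid_algebra S\<^esub>)"
    and "\<And>c a. a \<in> carrier S \<Longrightarrow> P (single c a)"
    and "\<And>f f'. \<lbrakk>f \<in> carrier (monoid_algebra S); f' \<in> carrier (monoid_algebra S); P f; P f'\<rbrakk> \<Longrightarrow>
           P (f \<oplus>\<^bsub>monoid_algebra S\<^esub> f')"
  shows "P f"
proof -
  have "finite {a. f a \<noteq> 0}" "{a. f a \<noteq> 0} \<subseteq> carrier S" using assms(1) by (auto simp: monoid_algebra_def)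
  then show ?thesis
  proof (induct "{a. f a \<noteq> 0}" arbitrary: f rule: finite_induct)
    case empty
    then have "f = \<zero>\<^bsub>monoid_algebra S\<^esub>" by (auto simp: monoid_algebra_zero)
    then show ?case using assms(2) by simp
  next
    case (insert a A)
    let ?f = "f(a := 0)"
    have A: "A = {x. ?f x \<noteq> 0}" using insert(2,4) by auto
    have a: "a \<in> carrier S" using insert(4,5) by auto
    have Af: "A \<subseteq> carrier S" "finite A" using insert(1,4,5) by auto
    have c: "?f \<in> carrier (monoid_algebra S)" using Af unfolding A by (simp add: monoid_algebra_def)
    have "P ?f" using insert(3)[OF A] Af(1) unfolding A .
    then have "P (single (f a) a \<oplus>\<^bsub>monoid_algebra S\<^esub> ?f)" using assms(3,4) a c by simp
    moreover have "f = single (f a) a \<oplus>\<^bsub>monoid_algebra S\<^esub> ?f"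
      by (rule ext) (simp add: monoid_algebra_add single_def)
    ultimately show ?case by simp
  qed
qed

lemma left_module_hom_monoid_algebraI:
  fixes S :: "('a, 'e) monoid_scheme" and M :: "('a \<Rightarrow> 'k::comm_ring_1, 'm) module"
  assumes "left_module (monoid_algebra S) M" "left_module (monoid_algebra S) N"
    and "\<And>x. x \<in> carrier M \<Longrightarrow> f x \<in> carrier N"
    and "\<And>x y. \<lbrakk>x \<in> carrier M; y \<in> carrier M\<rbrakk> \<Longrightarrow> f (x \<oplus>\<^bsub>M\<^esub> y) = f x \<oplus>\<^bsub>N\<^esub> f y"
    and "\<And>c a x. \<lbrakk>a \<in> carrier S; x \<in> carrier M\<rbrakk> \<Longrightarrow> f (single c a \<odot>\<^bsub>M\<^esub> x) = single c a \<odot>\<^bsub>N\<^esub> f x"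
  shows "left_module_hom (monoid_algebra S) M N f"
proof (rule left_module_homI)
  interpret M: left_module "monoid_algebra S" M by fact
  interpret N: left_module "monoid_algebra S" N by fact
  have f0: "f \<zero>\<^bsub>M\<^esub> = \<zero>\<^bsub>N\<^esub>" using assms(3,4)
    by (intro additive_zero[OF M.M.abelian_group_axioms N.M.abelian_group_axioms]) auto
  fix r :: "'a \<Rightarrow> 'k" and x assume "r \<in> carrier (monoid_algebra S)" and x: "x \<in> carrier M"
  then show "f (r \<odot>\<^bsub>M\<^esub> x) = r \<odot>\<^bsub>N\<^esub> f x"
    by (induct r rule: monoid_algebra_induct)
      (simp_all add: M.smult_l_zero N.smult_l_zero f0 assms(3-5) M.smult_l_distr N.smult_l_distr M.smult_closed)
qed (use assms(3,4) in auto)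

lemma submodule_monoid_algebraI:
  fixes S :: "('a, 'e) monoid_scheme" and M :: "('a \<Rightarrow> 'k::comm_ring_1, 'm) module"
  assumes "left_module (monoid_algebra S) M"
    and "N \<subseteq> carrier M" "\<zero>\<^bsub>M\<^esub> \<in> N"
    and "\<And>x y. \<lbrakk>x \<in> N; y \<in> N\<rbrakk> \<Longrightarrow> x \<oplus>\<^bsub>M\<^esub> y \<in> N"
    and "\<And>c a x. \<lbrakk>a \<in> carrier S; x \<in> N\<rbrakk> \<Longrightarrow> single c a \<odot>\<^bsub>M\<^esub> x \<in> N"
  shows "submodule N (monoid_algebra S) M"
proof -
  interpret left_module "monoid_algebra S" M by fact
  show ?thesis
  proof (rule submoduleI)
    fix r :: "'a \<Rightarrow> 'k" and x assume "r \<in> carrier (monoid_algebra S)" and x: "x \<in> N"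
    then have "x \<in> carrier M" using assms(2) by auto
    with \<open>r \<in> carrier (monoid_algebra S)\<close> x show "r \<odot>\<^bsub>M\<^esub> x \<in> N"
      by (induct r rule: monoid_algebra_induct) (simp_all add: smult_l_zero smult_l_distr assms(3-5))
  qed (use assms(2-4) in auto)
qed

text \<open>Both sides of the multiplication law are biadditive, so two nested inductions leave only
  products of basis elements.\<close>

lemma ring_hom_monoid_algebraI:
  fixes f :: "('a \<Rightarrow> 'k::comm_ring_1) \<Rightarrow> 'b"
  assumes "Group.monoid S" "ring R"
    and cl: "\<And>a. a \<in> carrier (monoid_algebra S) \<Longrightarrow> f a \<in> carrier R"
    and add: "\<And>a b. \<lbrakk>a \<in> carrier (monoid_algebra S); b \<in> carrier (monoid_algebra S)\<rbrakk> \<Longrightarrow>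
           f (a \<oplus>\<^bsub>monoid_algebra S\<^esub> b) = f a \<oplus>\<^bsub>R\<^esub> f b"
    and mult: "\<And>c d x y. \<lbrakk>x \<in> carrier S; y \<in> carrier S\<rbrakk> \<Longrightarrow>
           f (single (c * d) (x \<otimes>\<^bsub>S\<^esub> y)) = f (single c x) \<otimes>\<^bsub>R\<^esub> f (single d y)"
    and one: "f (single 1 \<one>\<^bsub>S\<^esub>) = \<one>\<^bsub>R\<^esub>"
  shows "f \<in> ring_hom (monoid_algebra S) R"
proof (rule ring_hom_memI)
  interpret K: ring "monoid_algebra S :: ('a \<Rightarrow> 'k) ring" by (rule ring_monoid_algebra[OF assms(1)])
  interpret R: ring R by fact
  have f0: "f \<zero>\<^bsub>monoid_algebra S\<^esub> = \<zero>\<^bsub>R\<^esub>"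
    by (rule additive_zero[OF K.is_abelian_group R.is_abelian_group]) (use cl add in auto)
  show "f \<one>\<^bsub>monoid_algebra S\<^esub> = \<one>\<^bsub>R\<^esub>" by (simp add: monoid_algebra_one one)
  fix a b :: "'a \<Rightarrow> 'k"
  assume "a \<in> carrier (monoid_algebra S)" and b: "b \<in> carrier (monoid_algebra S)"
  then show "f (a \<otimes>\<^bsub>monoid_algebra S\<^esub> b) = f a \<otimes>\<^bsub>R\<^esub> f b"
  proof (induct a rule: monoid_algebra_induct)
    case zero then show ?case using b by (simp add: f0 cl)
  next
    case (single c x)
    show ?case using b
    proof (induct b rule: monoid_algebra_induct)
      case zero then show ?case using single by (simp add: f0 cl)
    next
      case (single d y) then show ?case using \<open>x \<in> carrier S\<close> by (simp add: single_mult mult)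
    next
      case (add b b')
      then show ?case using single by (simp add: K.r_distr cl assms(4) R.r_distr)
    qed
  next
    case (add a a')
    then show ?case using b by (simp add: K.l_distr cl assms(4) R.l_distr)
  qed
qed (use cl add in auto)

lemma submodule_finsum:
  assumes "left_module R M" "submodule N R M" "\<And>i. i \<in> A \<Longrightarrow> u i \<in> N"
  shows "(\<Oplus>\<^bsub>M\<^esub>i\<in>A. u i) \<in> N"
proof -
  interpret left_module R M by fact
  note N = submoduleD[OF assms(2)]
  show ?thesis
    using assms(3)
  proof (induct A rule: infinite_finite_induct)
    case (infinite A) then show ?case using N(2) by (simp add: finsum_def finprod_def)
  next
    case empty then show ?case using N(2) by simp
  next
    case (insert a A)
    then show ?case using N(1,3) by (subst M.finsum_insert) auto
  qed
qed

lemma (in left_module) smult_minus: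
  assumes "a \<in> carrier R" "b \<in> carrier R" "x \<in> carrier M"
  shows "(a \<ominus>\<^bsub>R\<^esub> b) \<odot>\<^bsub>M\<^esub> x = a \<odot>\<^bsub>M\<^esub> x \<ominus>\<^bsub>M\<^esub> b \<odot>\<^bsub>M\<^esub> x"
  by (rule additive_minus[OF R.is_abelian_group M.abelian_group_axioms, of "\<lambda>a. a \<odot>\<^bsub>M\<^esub> x"])
    (use assms in \<open>auto simp: smult_closed smult_l_distr\<close>)

section \<open>Modules over H as modules over the group algebra with an operator\<close>

context nonnilpotent_group_datum
begin

abbreviation kG :: "('g \<Rightarrow> 'k) ring" where "kG \<equiv> monoid_algebra G"
abbreviation FH :: "('g generator list \<Rightarrow> 'k) ring" where "FH \<equiv> H_free G"
abbreviation HI :: "('g generator list \<Rightarrow> 'k) set" where "HI \<equiv> H_ideal G \<chi> g n"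
abbreviation H :: "('g generator list \<Rightarrow> 'k) set ring" where "H \<equiv> H_algebra G \<chi> g n"
abbreviation Lt :: "'g generator set" where "Lt \<equiv> insert Y_gen (G_gen ` carrier G)"

definition proj :: "('g generator list \<Rightarrow> 'k) \<Rightarrow> ('g generator list \<Rightarrow> 'k) set" where
  "proj f = HI +>\<^bsub>FH\<^esub> f"

lemma ring_kG: "ring kG"
  by (rule ring_monoid_algebra) (rule is_monoid)

lemma ring_FH: "ring FH"
  unfolding H_free_def by (rule ring_monoid_algebra) (rule monoid_free_monoid)

lemma FH_single_closed [simp]: "w \<in> lists Lt \<Longrightarrow> single c w \<in> carrier FH"
  unfolding H_free_def by (rule single_closed) (simp add: free_monoid_def)

lemma FH_single_mult: "single c u \<otimes>\<^bsub>FH\<^esub> single d v = single (c * d) (u @ v)"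
  unfolding H_free_def by (simp add: single_mult free_monoid_def)

lemma FH_one: "\<one>\<^bsub>FH\<^esub> = single 1 []"
  by (simp add: H_free_def monoid_algebra_one free_monoid_def)

lemma FH_Y_pow: "letter Y_gen [^]\<^bsub>FH\<^esub> m = single 1 (replicate m Y_gen)"
proof -
  interpret F: ring FH by (rule ring_FH)
  show ?thesis
    by (induct m) (simp_all add: FH_one letter_def FH_single_mult replicate_append_same)
qed

lemma relations_closed: "H_relations G \<chi> g n \<subseteq> carrier FH"
proof -
  interpret F: ring FH by (rule ring_FH)
  show ?thesis unfolding H_relations_def Let_def
    by (auto simp: letter_def FH_Y_pow FH_single_mult FH_one g_closed in_lists_conv_set
        intro!: F.minus_closed FH_single_closed)
qed

lemma ideal_HI: "ideal HI FH"
  unfolding H_ideal_def by (rule ring.genideal_ideal[OF ring_FH relations_closed])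

lemma relation_in_HI: "r \<in> H_relations G \<chi> g n \<Longrightarrow> r \<in> HI"
  unfolding H_ideal_def using ring.genideal_self[OF ring_FH relations_closed] by blast

lemma proj_hom: "proj \<in> ring_hom FH H"
  unfolding proj_def H_algebra_def by (rule ideal.rcos_ring_hom[OF ideal_HI])

lemma ring_H: "ring H"
  unfolding H_algebra_def by (rule ideal.quotient_is_ring[OF ideal_HI])

lemma H_carrierE:
  assumes "C \<in> carrier H" obtains f where "f \<in> carrier FH" "C = proj f"
  using assms by (auto simp: H_algebra_def FactRing_def A_RCOSETS_def' proj_def)

lemma proj_eqI:
  assumes "a \<ominus>\<^bsub>FH\<^esub> b \<in> H_relations G \<chi> g n" "a \<in> carrier FH" "b \<in> carrier FH"
  shows "proj a = proj b"
  using ring.quotient_eq_iff_same_a_r_cos[OF ring_FH ideal_HI assms(2,3)] relation_in_HI[OF assms(1)]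
  by (simp add: proj_def)

lemma proj_G_mult:
  assumes "a \<in> carrier G" "b \<in> carrier G"
  shows "proj (single 1 [G_gen a, G_gen b]) = proj (single 1 [G_gen (a \<otimes> b)])"
proof (rule proj_eqI)
  show "single 1 [G_gen a, G_gen b] \<ominus>\<^bsub>FH\<^esub> single 1 [G_gen (a \<otimes> b)] \<in> H_relations G \<chi> g n"
    unfolding H_relations_def Let_def using assms
    by (intro UnI1 CollectI exI[of _ a] exI[of _ b]) (simp add: letter_def FH_single_mult)
qed (use assms in auto)

lemma proj_G_one: "proj (single 1 [G_gen \<one>]) = proj (single 1 [])"
proof (rule proj_eqI)
  show "single 1 [G_gen \<one>] \<ominus>\<^bsub>FH\<^esub> single 1 [] \<in> H_relations G \<chi> g n"
    unfolding H_relations_def Let_def by (simp add: letter_def FH_one)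
qed auto

lemma proj_Y_pow:
  "proj (single 1 (replicate n Y_gen)) = proj (single 1 [G_gen (g [^] n)] \<ominus>\<^bsub>FH\<^esub> single 1 [])"
proof (rule proj_eqI)
  interpret F: ring FH by (rule ring_FH)
  show "single 1 (replicate n Y_gen) \<ominus>\<^bsub>FH\<^esub> (single 1 [G_gen (g [^] n)] \<ominus>\<^bsub>FH\<^esub> single 1 [])
      \<in> H_relations G \<chi> g n"
    unfolding H_relations_def Let_def by (simp add: letter_def FH_one FH_Y_pow[unfolded letter_def])
  show "single 1 [G_gen (g [^] n)] \<ominus>\<^bsub>FH\<^esub> single 1 [] \<in> carrier FH"
    by (intro F.minus_closed FH_single_closed) (auto simp: g_closed)
qed (auto simp: in_lists_conv_set)

lemma proj_Y_G:
  assumes "h \<in> carrier G"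
  shows "proj (single 1 [Y_gen, G_gen h]) = proj (single (\<chi> h) [G_gen h, Y_gen])"
proof (rule proj_eqI)
  show "single 1 [Y_gen, G_gen h] \<ominus>\<^bsub>FH\<^esub> single (\<chi> h) [G_gen h, Y_gen] \<in> H_relations G \<chi> g n"
    unfolding H_relations_def Let_def using assms
    by (intro UnI2 CollectI exI[of _ h]) (simp add: letter_def FH_single_mult)
qed (use assms in auto)

lemma proj_single_mult:
  assumes "u \<in> lists Lt" "v \<in> lists Lt"
  shows "proj (single c u) \<otimes>\<^bsub>H\<^esub> proj (single d v) = proj (single (c * d) (u @ v))"
  using ring_hom_mult[OF proj_hom, of "single c u" "single d v"] assms by (simp add: FH_single_mult)

text \<open>The linear map that sends \<open>h\<close> to its one-letter word. It is not
  multiplicative, since a product of letters is a longer word; it becomes a ring homomorphism after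
  \<open>proj\<close>, by the relations for products and for the unit of the group.\<close>

definition embed :: "('g \<Rightarrow> 'k) \<Rightarrow> ('g generator list \<Rightarrow> 'k)" where
  "embed a = (\<lambda>w. case w of [G_gen h] \<Rightarrow> a h | _ \<Rightarrow> 0)"

lemma embed_single: "embed (single c h) = single c [G_gen h]"
  by (auto simp: embed_def single_def split: list.splits generator.splits)

lemma embed_nonzero: "embed a w \<noteq> 0 \<longleftrightarrow> (\<exists>h. w = [G_gen h] \<and> a h \<noteq> 0)"
proof (cases w)
  case (Cons l v)
  then show ?thesis by (cases l; cases v) (auto simp: embed_def)
qed (simp add: embed_def)

lemma embed_closed: "a \<in> carrier kG \<Longrightarrow> embed a \<in> carrier FH"
proof -
  assume "a \<in> carrier kG"
  then have a: "finite {h. a h \<noteq> 0}" "{h. a h \<noteq> 0} \<subseteq> carrier G" by (auto simp: monoid_algebra_def)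
  have "{w. embed a w \<noteq> 0} = (\<lambda>h. [G_gen h]) ` {h. a h \<noteq> 0}"
    by (auto simp: embed_nonzero)
  then show ?thesis using a by (auto simp: H_free_def monoid_algebra_def free_monoid_def)
qed

lemma embed_add: "embed (a \<oplus>\<^bsub>kG\<^esub> b) = embed a \<oplus>\<^bsub>FH\<^esub> embed b"
  by (rule ext) (simp add: embed_def H_free_def monoid_algebra_add split: list.splits generator.splits)

lemma proj_single_G_mult:
  assumes "a \<in> carrier G" "b \<in> carrier G"
  shows "proj (single c [G_gen a, G_gen b]) = proj (single c [G_gen (a \<otimes> b)])"
  using assms proj_G_mult[OF assms] proj_single_mult[of "[]" "[G_gen a, G_gen b]" c 1]
    proj_single_mult[of "[]" "[G_gen (a \<otimes> b)]" c 1] by simp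

lemma proj_embed_hom: "(\<lambda>a. proj (embed a)) \<in> ring_hom kG H"
proof (rule ring_hom_monoid_algebraI[OF is_monoid ring_H])
  show "proj (embed (single 1 \<one>)) = \<one>\<^bsub>H\<^esub>"
    using ring_hom_one[OF proj_hom] by (simp add: embed_single proj_G_one FH_one)
qed (simp_all add: embed_single embed_closed embed_add proj_single_mult proj_single_G_mult
      ring_hom_add[OF proj_hom] ring_hom_closed[OF proj_hom])

end

section \<open>Modules over the group algebra, and the action of the free algebra that an operator y
  induces\<close>

locale group_module = group G + T: left_module "monoid_algebra G" T
  for G :: "'g monoid" (structure) and T :: "('g \<Rightarrow> 'k::field, 'm) module" +
  assumes finite_carrier: "finite (carrier G)"
begin

lemma single_smult_single:
  assumes "a \<in> carrier G" "b \<in> carrier G" "x \<in> carrier T"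
  shows "single c a \<odot>\<^bsub>T\<^esub> (single d b \<odot>\<^bsub>T\<^esub> x) = single (c * d) (a \<otimes> b) \<odot>\<^bsub>T\<^esub> x"
  using T.smult_assoc[of "single c a" "single d b" x] assms by (simp add: single_mult)

lemma single_smult_closed [simp]: "\<lbrakk>a \<in> carrier G; x \<in> carrier T\<rbrakk> \<Longrightarrow> single c a \<odot>\<^bsub>T\<^esub> x \<in> carrier T"
  by (simp add: T.smult_closed)

lemma single_0_smult: "\<lbrakk>a \<in> carrier G; x \<in> carrier T\<rbrakk> \<Longrightarrow> single 0 a \<odot>\<^bsub>T\<^esub> x = \<zero>\<^bsub>T\<^esub>"
  by (simp add: single_zero[where S = G] T.smult_l_zero)

lemma single_1_smult [simp]: "x \<in> carrier T \<Longrightarrow> single 1 \<one> \<odot>\<^bsub>T\<^esub> x = x"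
  using T.smult_one by (simp add: monoid_algebra_one)

end

text \<open>An \<open>H\<close>-module taken apart into its restriction \<open>T\<close> to the
  group algebra and the operator \<open>\<phi>\<close> of y. As \<open>y_comm\<close> covers only
  the coefficient 1, linearity over the field is the separate axiom \<open>y_scalar\<close>;
  together they give \<open>y_single\<close>.\<close>

locale y_module = nonnilpotent_group_datum G \<chi> g n + group_module G T
  for G :: "'g monoid" (structure) and \<chi> :: "'g \<Rightarrow> 'k::{alg_closed_field, field_char_0}" and g n
    and T :: "('g \<Rightarrow> 'k, 'm) module" +
  fixes \<phi> :: "'m \<Rightarrow> 'm"
  assumes y_closed: "x \<in> carrier T \<Longrightarrow> \<phi> x \<in> carrier T"
    and y_add: "\<lbrakk>x \<in> carrier T; x' \<in> carrier T\<rbrakk> \<Longrightarrow> \<phi> (x \<oplus>\<^bsub>T\<^esub> x') = \<phi> x \<oplus>\<^bsub>T\<^esub> \<phi> x'"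
    and y_scalar: "x \<in> carrier T \<Longrightarrow> \<phi> (single c \<one> \<odot>\<^bsub>T\<^esub> x) = single c \<one> \<odot>\<^bsub>T\<^esub> \<phi> x"
    and y_comm: "\<lbrakk>h \<in> carrier G; x \<in> carrier T\<rbrakk> \<Longrightarrow>
          \<phi> (single 1 h \<odot>\<^bsub>T\<^esub> x) = single (\<chi> h) h \<odot>\<^bsub>T\<^esub> \<phi> x"
    and y_pow_n: "x \<in> carrier T \<Longrightarrow> (\<phi> ^^ n) x = single 1 (g [^] n) \<odot>\<^bsub>T\<^esub> x \<ominus>\<^bsub>T\<^esub> x"
begin

abbreviation act_word :: "'g generator list \<Rightarrow> 'm \<Rightarrow> 'm" where
  "act_word w m \<equiv> foldr (letter_action T \<phi>) w m"

definition act :: "('g generator list \<Rightarrow> 'k) \<Rightarrow> 'm \<Rightarrow> 'm" where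
  "act f m = (\<Oplus>\<^bsub>T\<^esub>w\<in>{w. f w \<noteq> 0}. single (f w) \<one> \<odot>\<^bsub>T\<^esub> act_word w m)"

definition free_module :: "('g generator list \<Rightarrow> 'k, 'm) module" where
  "free_module = \<lparr>carrier = carrier T, mult = undefined, one = undefined, zero = \<zero>\<^bsub>T\<^esub>, add = add T,
     smult = act\<rparr>"

lemma free_module_simps [simp]:
  "carrier free_module = carrier T" "\<zero>\<^bsub>free_module\<^esub> = \<zero>\<^bsub>T\<^esub>" "add free_module = add T"
  "f \<odot>\<^bsub>free_module\<^esub> m = act f m"
  by (simp_all add: free_module_def)

lemma act_word_closed: "\<lbrakk>w \<in> lists Lt; m \<in> carrier T\<rbrakk> \<Longrightarrow> act_word w m \<in> carrier T"
proof (induct w)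
  case (Cons l w) then show ?case by (cases l) (auto simp: y_closed)
qed simp

lemma act_word_add:
  "\<lbrakk>w \<in> lists Lt; m \<in> carrier T; m' \<in> carrier T\<rbrakk> \<Longrightarrow>
     act_word w (m \<oplus>\<^bsub>T\<^esub> m') = act_word w m \<oplus>\<^bsub>T\<^esub> act_word w m'"
proof (induct w)
  case (Cons l w)
  then show ?case using act_word_closed[of w m] act_word_closed[of w m']
    by (cases l) (auto simp: y_add T.smult_r_distr)
qed simp

lemma act_word_scalar:
  "\<lbrakk>w \<in> lists Lt; m \<in> carrier T\<rbrakk> \<Longrightarrow> act_word w (single c \<one> \<odot>\<^bsub>T\<^esub> m) = single c \<one> \<odot>\<^bsub>T\<^esub> act_word w m"
proof (induct w)
  case (Cons l w)
  then show ?case using act_word_closed[of w m]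
    by (cases l) (auto simp: y_scalar single_smult_single)
qed simp

lemma FH_carrier: "f \<in> carrier FH \<longleftrightarrow> finite {w. f w \<noteq> 0} \<and> {w. f w \<noteq> 0} \<subseteq> lists Lt"
  by (simp add: H_free_def monoid_algebra_def free_monoid_def)

lemma term_closed: "\<lbrakk>w \<in> lists Lt; m \<in> carrier T\<rbrakk> \<Longrightarrow> single c \<one> \<odot>\<^bsub>T\<^esub> act_word w m \<in> carrier T"
  by (simp add: act_word_closed)

text \<open>The index set in \<open>act\<close> depends on \<open>f\<close>. Summing over a common
  finite superset of the supports is what makes the action of a sum comparable with the sum of the
  actions.\<close>

lemma act_superset:
  assumes "finite A" "{w. f w \<noteq> 0} \<subseteq> A" "A \<subseteq> lists Lt" "m \<in> carrier T"
  shows "act f m = (\<Oplus>\<^bsub>T\<^esub>w\<in>A. single (f w) \<one> \<odot>\<^bsub>T\<^esub> act_word w m)"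
  unfolding act_def
  by (rule T.M.add.finprod_mono_neutral_cong_left)
    (use assms in \<open>auto simp: single_0_smult act_word_closed subset_iff intro!: term_closed\<close>)

lemma act_closed: "\<lbrakk>f \<in> carrier FH; m \<in> carrier T\<rbrakk> \<Longrightarrow> act f m \<in> carrier T"
  unfolding act_def by (intro T.M.finsum_closed) (auto simp: FH_carrier subset_iff intro!: term_closed)

lemma act_add_left:
  assumes "f \<in> carrier FH" "f' \<in> carrier FH" "m \<in> carrier T"
  shows "act (f \<oplus>\<^bsub>FH\<^esub> f') m = act f m \<oplus>\<^bsub>T\<^esub> act f' m"
proof -
  let ?A = "{w. f w \<noteq> 0} \<union> {w. f' w \<noteq> 0}"
  have A: "finite ?A" "?A \<subseteq> lists Lt" using assms(1,2) by (auto simp: FH_carrier)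
  have v: "(f \<oplus>\<^bsub>FH\<^esub> f') w = f w + f' w" for w by (simp add: H_free_def monoid_algebra_add)
  have "act (f \<oplus>\<^bsub>FH\<^esub> f') m = (\<Oplus>\<^bsub>T\<^esub>w\<in>?A. single (f w + f' w) \<one> \<odot>\<^bsub>T\<^esub> act_word w m)"
    using A assms(3) by (subst act_superset[of ?A]) (auto simp: v)
  also have "\<dots> = (\<Oplus>\<^bsub>T\<^esub>w\<in>?A. single (f w) \<one> \<odot>\<^bsub>T\<^esub> act_word w m \<oplus>\<^bsub>T\<^esub> single (f' w) \<one> \<odot>\<^bsub>T\<^esub> act_word w m)"
  proof (rule T.M.finsum_cong'[OF refl])
    fix w assume "w \<in> ?A"
    then have "act_word w m \<in> carrier T" using A assms(3) by (intro act_word_closed) auto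
    then show "single (f w + f' w) \<one> \<odot>\<^bsub>T\<^esub> act_word w m
        = single (f w) \<one> \<odot>\<^bsub>T\<^esub> act_word w m \<oplus>\<^bsub>T\<^esub> single (f' w) \<one> \<odot>\<^bsub>T\<^esub> act_word w m"
      using T.smult_l_distr[of "single (f w) \<one>" "single (f' w) \<one>" "act_word w m"] by (simp add: single_add)
  qed (use A assms(3) in \<open>auto simp: subset_iff intro!: term_closed T.M.a_closed\<close>)
  also have "\<dots> = (\<Oplus>\<^bsub>T\<^esub>w\<in>?A. single (f w) \<one> \<odot>\<^bsub>T\<^esub> act_word w m) \<oplus>\<^bsub>T\<^esub> (\<Oplus>\<^bsub>T\<^esub>w\<in>?A. single (f' w) \<one> \<odot>\<^bsub>T\<^esub> act_word w m)"
    using A assms(3) by (intro T.M.finsum_addf) (auto simp: subset_iff intro!: term_closed)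
  also have "\<dots> = act f m \<oplus>\<^bsub>T\<^esub> act f' m"
    using A assms(3) by (subst (1 2) act_superset[of ?A]) auto
  finally show ?thesis .
qed

lemma act_add_right:
  assumes "f \<in> carrier FH" "m \<in> carrier T" "m' \<in> carrier T"
  shows "act f (m \<oplus>\<^bsub>T\<^esub> m') = act f m \<oplus>\<^bsub>T\<^esub> act f m'"
proof -
  have A: "{w. f w \<noteq> 0} \<subseteq> lists Lt" using assms(1) by (auto simp: FH_carrier)
  have "act f (m \<oplus>\<^bsub>T\<^esub> m') = (\<Oplus>\<^bsub>T\<^esub>w\<in>{w. f w \<noteq> 0}. single (f w) \<one> \<odot>\<^bsub>T\<^esub> act_word w m \<oplus>\<^bsub>T\<^esub> single (f w) \<one> \<odot>\<^bsub>T\<^esub> act_word w m')"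
    unfolding act_def
  proof (rule T.M.finsum_cong'[OF refl])
    fix w assume "w \<in> {w. f w \<noteq> 0}"
    then have "w \<in> lists Lt" using A by auto
    then show "single (f w) \<one> \<odot>\<^bsub>T\<^esub> act_word w (m \<oplus>\<^bsub>T\<^esub> m')
        = single (f w) \<one> \<odot>\<^bsub>T\<^esub> act_word w m \<oplus>\<^bsub>T\<^esub> single (f w) \<one> \<odot>\<^bsub>T\<^esub> act_word w m'"
      using assms by (simp add: act_word_add act_word_closed T.smult_r_distr)
  qed (use A assms in \<open>auto simp: subset_iff intro!: term_closed T.M.a_closed\<close>)
  also have "\<dots> = act f m \<oplus>\<^bsub>T\<^esub> act f m'" unfolding act_def
    using A assms by (intro T.M.finsum_addf) (auto simp: subset_iff intro!: term_closed)
  finally show ?thesis .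
qed

lemma act_zero_left: "act \<zero>\<^bsub>FH\<^esub> m = \<zero>\<^bsub>T\<^esub>"
  by (simp add: act_def H_free_def monoid_algebra_zero)

lemma act_single:
  assumes "w \<in> lists Lt" "m \<in> carrier T"
  shows "act (single c w) m = single c \<one> \<odot>\<^bsub>T\<^esub> act_word w m"
proof -
  have "act (single c w) m = (\<Oplus>\<^bsub>T\<^esub>v\<in>{w}. single (single c w v) \<one> \<odot>\<^bsub>T\<^esub> act_word v m)"
    using assms by (intro act_superset) (auto simp: single_def)
  also have "\<dots> = single (single c w w) \<one> \<odot>\<^bsub>T\<^esub> act_word w m"
    using assms T.M.finsum_insert[of "{}" w "\<lambda>v. single (single c w v) \<one> \<odot>\<^bsub>T\<^esub> act_word v m"]
    by (simp add: term_closed)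
  finally show ?thesis by (simp add: single_def)
qed

lemma act_zero_right: "f \<in> carrier FH \<Longrightarrow> act f \<zero>\<^bsub>T\<^esub> = \<zero>\<^bsub>T\<^esub>"
  by (rule additive_zero[OF T.M.abelian_group_axioms T.M.abelian_group_axioms])
    (auto simp: act_closed act_add_right)

text \<open>Two nested inductions leave two words \<open>u\<close> and \<open>v\<close>. Folding
  over \<open>u @ v\<close> is composition, and the coefficient of \<open>v\<close> passes through
  the action of \<open>u\<close> by \<open>act_word_scalar\<close>.\<close>

lemma act_mult:
  assumes "f \<in> carrier FH" "f' \<in> carrier FH" "m \<in> carrier T"
  shows "act (f \<otimes>\<^bsub>FH\<^esub> f') m = act f (act f' m)"
proof -
  interpret F: ring FH by (rule ring_FH)
  let ?S = "free_monoid Lt"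
  have S: "carrier ?S = lists Lt" by (simp add: free_monoid_def)
  have F: "FH = monoid_algebra ?S" by (simp add: H_free_def)
  have "f \<in> carrier (monoid_algebra ?S)" using assms(1) unfolding F .
  then show ?thesis
  proof (induct f rule: monoid_algebra_induct)
    case zero
    then show ?case unfolding F[symmetric] using assms by (simp add: act_zero_left)
  next
    case (single c u)
    have u: "u \<in> lists Lt" using single S by simp
    have "f' \<in> carrier (monoid_algebra ?S)" using assms(2) unfolding F .
    then show ?case
    proof (induct f' rule: monoid_algebra_induct)
      case zero
      then show ?case unfolding F[symmetric] using u by (simp add: act_zero_left act_zero_right)
    next
      case (single d v)
      then have v: "v \<in> lists Lt" using S by simp
      have uv: "u @ v \<in> lists Lt" using u v by simp
      show ?case unfolding FH_single_mult act_single[OF uv assms(3)] act_single[OF v assms(3)]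
          act_single[OF u term_closed[OF v assms(3)]]
        using u v assms(3) by (simp add: act_word_scalar act_word_closed single_smult_single)
    next
      case (add f1 f2)
      then show ?case unfolding F[symmetric] using u assms(3)
        by (simp add: F.r_distr act_add_left act_add_right act_closed)
    qed
  next
    case (add f1 f2)
    then show ?case unfolding F[symmetric] using assms(2,3) by (simp add: F.l_distr act_add_left act_closed)
  qed
qed

lemma left_module_free_module: "left_module FH free_module"
proof (intro left_module.intro ring_FH left_module_axioms.intro)
  show "abelian_group free_module" by (rule abelian_group_cong[OF T.M.abelian_group_axioms]) simp_all
  show "\<one>\<^bsub>FH\<^esub> \<odot>\<^bsub>free_module\<^esub> x = x" if "x \<in> carrier free_module" for x
    using that act_single[of "[]" x 1] by (simp add: FH_one)
qed (simp_all add: act_closed act_add_left act_add_right act_mult)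

lemma act_minus_left:
  assumes "f \<in> carrier FH" "f' \<in> carrier FH" "m \<in> carrier T"
  shows "act (f \<ominus>\<^bsub>FH\<^esub> f') m = act f m \<ominus>\<^bsub>T\<^esub> act f' m"
  using additive_minus[OF ring.is_abelian_group[OF ring_FH] T.M.abelian_group_axioms, of "\<lambda>f. act f m" f f']
    assms act_closed act_add_left by simp

lemma letter_action_Y: "letter_action T \<phi> Y_gen = \<phi>"
  by (rule ext) simp

text \<open>The four families of relations match, in order, the module laws for products and for the
  unit of the group, \<open>y_pow_n\<close>, and \<open>y_comm\<close>.\<close>

lemma act_relation:
  assumes "r \<in> H_relations G \<chi> g n" "m \<in> carrier T"
  shows "act r m = \<zero>\<^bsub>T\<^esub>"
proof -
  interpret F: ring FH by (rule ring_FH)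
  note r0 = T.M.minus_self
  have eqI: "act (a \<ominus>\<^bsub>FH\<^esub> b) m = \<zero>\<^bsub>T\<^esub>" if "act a m = act b m" "a \<in> carrier FH" "b \<in> carrier FH" for a b
    using that assms(2) by (simp add: act_minus_left act_closed r0)
  have Yn: "replicate n Y_gen \<in> lists Lt" by (auto simp: in_lists_conv_set)
  from assms(1)[unfolded H_relations_def Let_def] show ?thesis
  proof (elim UnE)
    assume "r \<in> {letter (G_gen a) \<otimes>\<^bsub>FH\<^esub> letter (G_gen b) \<ominus>\<^bsub>FH\<^esub> letter (G_gen (a \<otimes> b)) | a b.
        a \<in> carrier G \<and> b \<in> carrier G}"
    then obtain a b where "a \<in> carrier G" "b \<in> carrier G"
      "r = letter (G_gen a) \<otimes>\<^bsub>FH\<^esub> letter (G_gen b) \<ominus>\<^bsub>FH\<^esub> letter (G_gen (a \<otimes> b))" by blast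
    then show ?thesis using assms(2)
      by (auto simp: letter_def FH_single_mult act_single single_smult_single intro!: eqI)
  next
    assume "r \<in> {letter (G_gen \<one>) \<ominus>\<^bsub>FH\<^esub> \<one>\<^bsub>FH\<^esub>}"
    then show ?thesis using assms(2) by (auto simp: letter_def FH_one act_single intro!: eqI)
  next
    assume "r \<in> {letter Y_gen [^]\<^bsub>FH\<^esub> n \<ominus>\<^bsub>FH\<^esub> (letter (G_gen (g [^] n)) \<ominus>\<^bsub>FH\<^esub> \<one>\<^bsub>FH\<^esub>)}"
    then show ?thesis using assms(2) Yn
      by (auto simp: letter_def FH_one FH_Y_pow[unfolded letter_def] act_single act_minus_left g_closed letter_action_Y y_pow_n r0)
  next
    assume "r \<in> {letter Y_gen \<otimes>\<^bsub>FH\<^esub> letter (G_gen h)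
        \<ominus>\<^bsub>FH\<^esub> single (\<chi> h) [] \<otimes>\<^bsub>FH\<^esub> letter (G_gen h) \<otimes>\<^bsub>FH\<^esub> letter Y_gen | h. h \<in> carrier G}"
    then obtain h where "h \<in> carrier G" "r = letter Y_gen \<otimes>\<^bsub>FH\<^esub> letter (G_gen h)
        \<ominus>\<^bsub>FH\<^esub> single (\<chi> h) [] \<otimes>\<^bsub>FH\<^esub> letter (G_gen h) \<otimes>\<^bsub>FH\<^esub> letter Y_gen" by blast
    then show ?thesis using assms(2)
      by (auto simp: letter_def FH_single_mult act_single single_smult_single y_comm y_closed intro!: eqI)
  qed
qed

text \<open>The annihilator of the module is a two-sided ideal that contains the relations, hence
  the whole ideal generated by them.\<close>

lemma act_HI:
  assumes "f \<in> HI" "m \<in> carrier T" shows "act f m = \<zero>\<^bsub>T\<^esub>"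
proof -
  interpret F: ring FH by (rule ring_FH)
  let ?K = "{f \<in> carrier FH. \<forall>m\<in>carrier T. act f m = \<zero>\<^bsub>T\<^esub>}"
  have "ideal ?K FH"
  proof (rule idealI[OF ring_FH])
    show "subgroup ?K (add_monoid FH)"
    proof (rule F.add.subgroupI)
      show "?K \<noteq> {}" using act_zero_left F.zero_closed by blast
      fix a assume "a \<in> ?K"
      then show "\<ominus>\<^bsub>FH\<^esub> a \<in> ?K"
        using act_minus_left[OF F.zero_closed, of a] by (auto simp: a_minus_def act_zero_left)
    qed (auto simp: act_add_left)
  qed (auto simp: act_mult act_closed act_zero_right)
  moreover have "H_relations G \<chi> g n \<subseteq> ?K" using act_relation relations_closed by auto
  ultimately have "HI \<subseteq> ?K" unfolding H_ideal_def by (rule F.genideal_minimal)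
  then show ?thesis using assms by blast
qed

abbreviation "HT \<equiv> H_module G T \<phi>"

lemma H_module_simps [simp]:
  "carrier HT = carrier T" "\<zero>\<^bsub>HT\<^esub> = \<zero>\<^bsub>T\<^esub>" "add HT = add T"
  by (simp_all add: H_module_def)

lemma left_module_H_module: "left_module H HT"
  and H_module_proj: "\<lbrakk>f \<in> carrier FH; m \<in> carrier T\<rbrakk> \<Longrightarrow> proj f \<odot>\<^bsub>HT\<^esub> m = act f m"
proof -
  have s: "C \<odot>\<^bsub>HT\<^esub> x = (SOME f. f \<in> C) \<odot>\<^bsub>free_module\<^esub> x" for C x
    by (simp add: H_module_def act_def group_algebra_scalar_def Let_def)
  note * = left_module_quotient_ring[OF left_module_free_module ideal_HI _ _ _ _ s]
  show "left_module H HT" unfolding H_algebra_def by (rule *(1)) (simp_all add: act_HI)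
  show "\<lbrakk>f \<in> carrier FH; m \<in> carrier T\<rbrakk> \<Longrightarrow> proj f \<odot>\<^bsub>HT\<^esub> m = act f m"
    unfolding proj_def using *(2)[of f m] by (simp add: act_HI)
qed

lemma H_module_G: "\<lbrakk>h \<in> carrier G; m \<in> carrier T\<rbrakk> \<Longrightarrow> proj (single c [G_gen h]) \<odot>\<^bsub>HT\<^esub> m = single c h \<odot>\<^bsub>T\<^esub> m"
  by (simp add: H_module_proj act_single single_smult_single)

lemma H_module_Y: "m \<in> carrier T \<Longrightarrow> proj (letter Y_gen) \<odot>\<^bsub>HT\<^esub> m = \<phi> m"
  by (simp add: H_module_proj act_single letter_def y_closed)

lemma H_module_scalar: "m \<in> carrier T \<Longrightarrow> H_scalar G \<chi> g n c \<odot>\<^bsub>HT\<^esub> m = single c \<one> \<odot>\<^bsub>T\<^esub> m"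
  using H_module_proj[of "single c []" m] by (simp add: act_single H_scalar_def proj_def)

lemma proj_G_closed: "h \<in> carrier G \<Longrightarrow> proj (single c [G_gen h]) \<in> carrier H"
  and proj_Y_closed: "proj (letter Y_gen) \<in> carrier H"
  by (auto intro!: ring_hom_closed[OF proj_hom] simp: letter_def)

lemma H_submoduleD:
  assumes "submodule N H HT"
  shows "submodule N kG T" and "x \<in> N \<Longrightarrow> \<phi> x \<in> N"
proof -
  interpret HM: left_module H HT by (rule left_module_H_module)
  note D = HM.submoduleD[OF assms, simplified]
  show "submodule N kG T"
  proof (rule submodule_monoid_algebraI[OF T.left_module_axioms D(1-3)])
    fix c a x assume "a \<in> carrier G" "x \<in> N"
    then show "single c a \<odot>\<^bsub>T\<^esub> x \<in> N" using D(4)[of "proj (single c [G_gen a])" x] D(1)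
      by (auto simp: H_module_G proj_G_closed subset_iff)
  qed
  show "x \<in> N \<Longrightarrow> \<phi> x \<in> N" using D(4)[of "proj (letter Y_gen)" x] D(1)
    by (auto simp: H_module_Y proj_Y_closed subset_iff)
qed

end

section \<open>Passage between \<open>H\<close>-modules and pairs of a group module and an
  operator\<close>

context nonnilpotent_group_datum
begin

text \<open>Words in the letters span the free algebra, so compatibility with the group and with y
  propagates to all words; elements of \<open>H\<close> are then handled through
  representatives.\<close>

lemma H_module_homI:
  assumes "y_module G \<chi> g n T \<phi>" "y_module G \<chi> g n T' \<phi>'"
    and f: "left_module_hom kG T T' f" and fy: "\<And>x. x \<in> carrier T \<Longrightarrow> f (\<phi> x) = \<phi>' (f x)"
  shows "left_module_hom H (H_module G T \<phi>) (H_module G T' \<phi>') f"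
proof -
  interpret A: y_module G \<chi> g n T \<phi> by fact
  interpret B: y_module G \<chi> g n T' \<phi>' by fact
  note D = left_module_homD[OF f]
  have fw: "f (A.act_word w m) = B.act_word w (f m)" if "w \<in> lists Lt" "m \<in> carrier T" for w m
    using that
  proof (induct w)
    case (Cons l w)
    then show ?case using A.act_word_closed[of w m] by (cases l) (auto simp: fy D(3))
  qed simp
  have F: "FH = monoid_algebra (free_monoid Lt)" by (simp add: H_free_def)
  have "left_module_hom (monoid_algebra (free_monoid Lt)) A.free_module B.free_module f"
    by (rule left_module_hom_monoid_algebraI)
      (use A.left_module_free_module B.left_module_free_module in
        \<open>simp_all add: F D free_monoid_def A.act_single B.act_single A.act_word_closed fw\<close>)
  note E = left_module_homD(3)[OF this, folded F, simplified]
  show ?thesis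
  proof (rule left_module_homI)
    fix C x assume "C \<in> carrier H" "x \<in> carrier (H_module G T \<phi>)"
    moreover obtain a where "a \<in> carrier FH" "C = proj a" using \<open>C \<in> carrier H\<close> by (rule H_carrierE)
    ultimately show "f (C \<odot>\<^bsub>H_module G T \<phi>\<^esub> x) = C \<odot>\<^bsub>H_module G T' \<phi>'\<^esub> f x"
      by (simp add: A.H_module_proj B.H_module_proj D(1) E)
  qed (simp_all add: D)
qed

lemma H_module_homD:
  assumes "y_module G \<chi> g n T \<phi>" "y_module G \<chi> g n T' \<phi>'"
    and f: "left_module_hom H (H_module G T \<phi>) (H_module G T' \<phi>') f"
  shows "left_module_hom kG T T' f" and "x \<in> carrier T \<Longrightarrow> f (\<phi> x) = \<phi>' (f x)"
proof -
  interpret A: y_module G \<chi> g n T \<phi> by fact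
  interpret B: y_module G \<chi> g n T' \<phi>' by fact
  note D = left_module_homD[OF f, simplified]
  show "left_module_hom kG T T' f"
  proof (rule left_module_hom_monoid_algebraI[OF A.T.left_module_axioms B.T.left_module_axioms D(1,2)])
    fix c a x assume "a \<in> carrier G" "x \<in> carrier T"
    then show "f (single c a \<odot>\<^bsub>T\<^esub> x) = single c a \<odot>\<^bsub>T'\<^esub> f x"
      using D(3)[of "proj (single c [G_gen a])" x] D(1)
      by (simp add: A.H_module_G B.H_module_G A.proj_G_closed)
  qed
  show "f (\<phi> x) = \<phi>' (f x)" if "x \<in> carrier T"
    using that D(3)[of "proj (letter Y_gen)" x] D(1) by (simp add: A.H_module_Y B.H_module_Y A.proj_Y_closed)
qed

text \<open>The isomorphism is the identity map. An equation of records would be too much to ask,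
  because they may differ in the dummy fields and in the values of the action outside the
  carrier.\<close>

lemma H_module_of_module:
  assumes "left_module H X"
  defines "T \<equiv> restrict_scalars (\<lambda>a. proj (embed a)) X" and "\<phi> \<equiv> \<lambda>x. proj (letter Y_gen) \<odot>\<^bsub>X\<^esub> x"
  shows "y_module G \<chi> g n T \<phi>" and "module_iso H X (H_module G T \<phi>)"
proof -
  interpret X: left_module H X by fact
  interpret F: ring FH by (rule ring_FH)
  have T: "left_module kG T" unfolding T_def by (rule left_module_restrict_scalars[OF assms(1) ring_kG proj_embed_hom])
  have cT: "carrier T = carrier X" "add T = add X" "\<zero>\<^bsub>T\<^esub> = \<zero>\<^bsub>X\<^esub>" by (simp_all add: T_def)
  have sT: "single c h \<odot>\<^bsub>T\<^esub> x = proj (single c [G_gen h]) \<odot>\<^bsub>X\<^esub> x" for c h x by (simp add: T_def embed_single)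
  have pc: "proj (single c w) \<in> carrier H" if "w \<in> lists Lt" for c w
    using that by (intro ring_hom_closed[OF proj_hom]) simp
  have ps: "proj (single c u) \<odot>\<^bsub>X\<^esub> (proj (single d v) \<odot>\<^bsub>X\<^esub> x) = proj (single (c * d) (u @ v)) \<odot>\<^bsub>X\<^esub> x"
    if "u \<in> lists Lt" "v \<in> lists Lt" "x \<in> carrier X" for c d u v x
    using that X.smult_assoc[of "proj (single c u)" "proj (single d v)" x] by (simp add: proj_single_mult pc)
  have p1: "proj (single 1 []) \<odot>\<^bsub>X\<^esub> x = x" if "x \<in> carrier X" for x
    using X.smult_one[OF that] ring_hom_one[OF proj_hom] by (simp add: FH_one)
  have pG1: "proj (single c [G_gen \<one>]) = proj (single c [])" for c
    using proj_single_mult[of "[]" "[G_gen \<one>]" c 1] proj_single_mult[of "[]" "[]" c 1] proj_G_one by simp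
  have phi: "\<phi> x = proj (single 1 [Y_gen]) \<odot>\<^bsub>X\<^esub> x" for x by (simp add: \<phi>_def letter_def)
  have pow: "(\<phi> ^^ k) x = proj (single 1 (replicate k Y_gen)) \<odot>\<^bsub>X\<^esub> x" if "x \<in> carrier X" for k x
  proof (induct k)
    case 0 then show ?case using that by (simp add: p1)
  next
    case (Suc k)
    have "replicate k Y_gen \<in> lists Lt" by (auto simp: in_lists_conv_set)
    then show ?case using that Suc by (simp add: phi ps)
  qed
  show Y: "y_module G \<chi> g n T \<phi>"
  proof (intro y_module.intro group_module.intro group_module_axioms.intro T y_module_axioms.intro
      nonnilpotent_group_datum_axioms group_axioms finite_G)
    fix x assume "x \<in> carrier T"
    then have x: "x \<in> carrier X" by (simp add: cT)
    show "\<phi> x \<in> carrier T" using x by (simp add: phi cT X.smult_closed pc)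
    show "\<phi> (x \<oplus>\<^bsub>T\<^esub> x') = \<phi> x \<oplus>\<^bsub>T\<^esub> \<phi> x'" if "x' \<in> carrier T" for x'
      using x that by (simp add: phi cT X.smult_r_distr pc)
    show "\<phi> (single c \<one> \<odot>\<^bsub>T\<^esub> x) = single c \<one> \<odot>\<^bsub>T\<^esub> \<phi> x" for c
      using x by (simp add: phi sT pG1 ps)
    show "\<phi> (single 1 h \<odot>\<^bsub>T\<^esub> x) = single (\<chi> h) h \<odot>\<^bsub>T\<^esub> \<phi> x" if "h \<in> carrier G" for h
      using x that by (simp add: phi sT ps proj_Y_G)
    have gn: "single 1 [G_gen (g [^] n)] \<in> carrier FH" by (simp add: g_closed)
    have "(\<phi> ^^ n) x = proj (single 1 [G_gen (g [^] n)] \<ominus>\<^bsub>FH\<^esub> single 1 []) \<odot>\<^bsub>X\<^esub> x"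
      by (simp add: pow[OF x] proj_Y_pow)
    also have "proj (single 1 [G_gen (g [^] n)] \<ominus>\<^bsub>FH\<^esub> single 1 [])
        = proj (single 1 [G_gen (g [^] n)]) \<ominus>\<^bsub>H\<^esub> proj (single 1 [])"
      using gn ring_hom_closed[OF proj_hom] ring_hom_add[OF proj_hom]
      by (intro additive_minus[OF F.is_abelian_group X.R.is_abelian_group]) auto
    also have "\<dots> \<odot>\<^bsub>X\<^esub> x = single 1 (g [^] n) \<odot>\<^bsub>T\<^esub> x \<ominus>\<^bsub>X\<^esub> x"
      using x by (simp add: X.smult_minus pc g_closed p1 sT)
    also have "\<dots> = single 1 (g [^] n) \<odot>\<^bsub>T\<^esub> x \<ominus>\<^bsub>T\<^esub> x"
      by (simp add: a_minus_def a_inv_def m_inv_def cT)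
    finally show "(\<phi> ^^ n) x = single 1 (g [^] n) \<odot>\<^bsub>T\<^esub> x \<ominus>\<^bsub>T\<^esub> x" .
  qed
  interpret Y: y_module G \<chi> g n T \<phi> by (rule Y)
  let ?FX = "restrict_scalars proj X"
  have FX: "left_module FH ?FX" by (rule left_module_restrict_scalars[OF assms(1) ring_FH proj_hom])
  have word: "Y.act_word w x = proj (single 1 w) \<odot>\<^bsub>X\<^esub> x" if "w \<in> lists Lt" "x \<in> carrier X" for w x
    using that
  proof (induct w)
    case Nil then show ?case by (simp add: p1)
  next
    case (Cons l w)
    then show ?case by (cases l) (auto simp: phi sT ps)
  qed
  have F: "FH = monoid_algebra (free_monoid Lt)" by (simp add: H_free_def)
  have "left_module_hom (monoid_algebra (free_monoid Lt)) ?FX Y.free_module (\<lambda>x. x)"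
    by (rule left_module_hom_monoid_algebraI)
      (use FX Y.left_module_free_module in
        \<open>simp_all add: F cT free_monoid_def Y.act_single sT pG1 word ps\<close>)
  note E = left_module_homD(3)[OF this, folded F, simplified]
  have "left_module_hom H X (H_module G T \<phi>) (\<lambda>x. x)"
  proof (rule left_module_homI)
    fix C x assume "C \<in> carrier H" "x \<in> carrier X"
    moreover obtain a where "a \<in> carrier FH" "C = proj a" using \<open>C \<in> carrier H\<close> by (rule H_carrierE)
    ultimately show "C \<odot>\<^bsub>X\<^esub> x = C \<odot>\<^bsub>H_module G T \<phi>\<^esub> x" using E[of a x] by (simp add: Y.H_module_proj cT)
  qed (simp_all add: cT)
  then show "module_iso H X (H_module G T \<phi>)"
    by (rule module_isoI) (simp add: cT bij_betw_def)
qed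

end

section \<open>Complements and semisimplicity\<close>

text \<open>By Zorn's lemma, take \<open>D\<close> maximal among the submodules that contain
  \<open>B\<close> and meet \<open>A\<close> trivially. If \<open>x\<close> were outside
  \<open>A + D\<close>, then \<open>D + R x\<close> would still meet \<open>A\<close> trivially:
  from \<open>d + r x\<close> in \<open>A\<close> with \<open>r\<close> nonzero, division by
  \<open>r\<close> would put \<open>x\<close> into \<open>A + D\<close>. This contradicts
  maximality.\<close>

lemma (in left_module) submodule_complement_division_ring:
  assumes div: "\<And>a. \<lbrakk>a \<in> carrier R; a \<noteq> \<zero>\<^bsub>R\<^esub>\<rbrakk> \<Longrightarrow> \<exists>b\<in>carrier R. b \<otimes>\<^bsub>R\<^esub> a = \<one>\<^bsub>R\<^esub>"
    and A: "submodule A R M" and B: "submodule B R M" and AB: "A \<inter> B = {\<zero>\<^bsub>M\<^esub>}"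
  shows "\<exists>D. submodule D R M \<and> B \<subseteq> D \<and> A \<inter> D = {\<zero>\<^bsub>M\<^esub>} \<and> (\<forall>x\<in>carrier M. \<exists>a\<in>A. \<exists>d\<in>D. x = a \<oplus>\<^bsub>M\<^esub> d)"
proof -
  let ?Z = "{D. submodule D R M \<and> B \<subseteq> D \<and> A \<inter> D = {\<zero>\<^bsub>M\<^esub>}}"
  have "\<exists>D\<in>?Z. \<forall>X\<in>?Z. D \<subseteq> X \<longrightarrow> X = D"
  proof (rule subset_Zorn_nonempty)
    show "?Z \<noteq> {}" using B AB by auto
    fix C assume C: "C \<noteq> {}" "subset.chain ?Z C"
    then have CZ: "\<And>N. N \<in> C \<Longrightarrow> N \<in> ?Z" and ch: "\<And>N N'. \<lbrakk>N \<in> C; N' \<in> C\<rbrakk> \<Longrightarrow> N \<subseteq> N' \<or> N' \<subseteq> N"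
      by (auto simp: subset_chain_def)
    have "submodule (\<Union>C) R M" by (rule submodule_Union_chain[OF C(1)]) (use CZ ch in auto)
    then show "\<Union>C \<in> ?Z" using CZ C(1) by auto
  qed
  then obtain D where D: "submodule D R M" "B \<subseteq> D" "A \<inter> D = {\<zero>\<^bsub>M\<^esub>}"
    and max: "\<And>X. \<lbrakk>submodule X R M; B \<subseteq> X; A \<inter> X = {\<zero>\<^bsub>M\<^esub>}; D \<subseteq> X\<rbrakk> \<Longrightarrow> X = D" by auto
  note sA = submoduleD[OF A] and sD = submoduleD[OF D(1)]
  have "\<exists>a\<in>A. \<exists>d\<in>D. x = a \<oplus>\<^bsub>M\<^esub> d" if x: "x \<in> carrier M" for x
  proof (rule ccontr)
    assume no: "\<not> ?thesis"
    let ?L = "(\<lambda>r. r \<odot>\<^bsub>M\<^esub> x) ` carrier R"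
    have L: "submodule ?L R M"
    proof (rule submoduleI)
      show "?L \<subseteq> carrier M" using x by (auto simp: smult_closed)
      show "\<zero>\<^bsub>M\<^esub> \<in> ?L" using x smult_l_zero[OF x] by (intro image_eqI[of _ _ "\<zero>\<^bsub>R\<^esub>"]) auto
      show "u \<oplus>\<^bsub>M\<^esub> v \<in> ?L" if "u \<in> ?L" "v \<in> ?L" for u v
        using that x by (auto simp: smult_l_distr[symmetric])
      show "r \<odot>\<^bsub>M\<^esub> u \<in> ?L" if "r \<in> carrier R" "u \<in> ?L" for r u
        using that x by (auto simp: smult_assoc[symmetric])
    qed
    let ?X = "{d \<oplus>\<^bsub>M\<^esub> l | d l. d \<in> D \<and> l \<in> ?L}"
    have X: "submodule ?X R M" by (rule submodule_sum[OF D(1) L])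
    have DX: "D \<subseteq> ?X"
    proof
      fix d assume "d \<in> D"
      moreover have "d = d \<oplus>\<^bsub>M\<^esub> \<zero>\<^bsub>M\<^esub>" using \<open>d \<in> D\<close> sD(1) by auto
      ultimately show "d \<in> ?X" using submoduleD(2)[OF L] by blast
    qed
    have "y = \<zero>\<^bsub>M\<^esub>" if "y \<in> A" "y \<in> ?X" for y
    proof -
      obtain d r where dr: "d \<in> D" "r \<in> carrier R" "y = d \<oplus>\<^bsub>M\<^esub> r \<odot>\<^bsub>M\<^esub> x" using \<open>y \<in> ?X\<close> by blast
      have dc: "d \<in> carrier M" using dr(1) sD(1) by auto
      show ?thesis
      proof (cases "r = \<zero>\<^bsub>R\<^esub>")
        case True
        then have "y = d" using dr dc x by (simp add: smult_l_zero)
        then show ?thesis using dr(1) \<open>y \<in> A\<close> D(3) by blast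
      next
        case False
        then obtain s where s: "s \<in> carrier R" "s \<otimes>\<^bsub>R\<^esub> r = \<one>\<^bsub>R\<^esub>" using div dr(2) by blast
        have "s \<odot>\<^bsub>M\<^esub> y = s \<odot>\<^bsub>M\<^esub> d \<oplus>\<^bsub>M\<^esub> (s \<otimes>\<^bsub>R\<^esub> r) \<odot>\<^bsub>M\<^esub> x"
          using s(1) dr(2,3) dc x by (simp add: smult_r_distr smult_assoc smult_closed)
        then have "s \<odot>\<^bsub>M\<^esub> y = s \<odot>\<^bsub>M\<^esub> d \<oplus>\<^bsub>M\<^esub> x" using s x by (simp add: smult_one)
        moreover have sd: "s \<odot>\<^bsub>M\<^esub> d \<in> D" and sy: "s \<odot>\<^bsub>M\<^esub> y \<in> A" using sD(4) sA(4) s(1) dr(1) \<open>y \<in> A\<close> by auto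
        moreover have "s \<odot>\<^bsub>M\<^esub> d \<in> carrier M" using sd sD(1) by auto
        ultimately have "x = s \<odot>\<^bsub>M\<^esub> y \<oplus>\<^bsub>M\<^esub> (\<zero>\<^bsub>M\<^esub> \<ominus>\<^bsub>M\<^esub> s \<odot>\<^bsub>M\<^esub> d)"
          using x by (simp add: a_minus_def M.a_ac M.r_neg)
        moreover have "\<zero>\<^bsub>M\<^esub> \<ominus>\<^bsub>M\<^esub> s \<odot>\<^bsub>M\<^esub> d \<in> D" by (rule sD(5)[OF sD(2) sd])
        ultimately show ?thesis using no sy by blast
      qed
    qed
    moreover have "\<zero>\<^bsub>M\<^esub> \<in> A" "\<zero>\<^bsub>M\<^esub> \<in> ?X" using sA(2) submoduleD(2)[OF X] by auto
    ultimately have "A \<inter> ?X = {\<zero>\<^bsub>M\<^esub>}" by blast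
    then have "?X = D" using D(2) DX by (intro max X) auto
    moreover have "x = \<zero>\<^bsub>M\<^esub> \<oplus>\<^bsub>M\<^esub> \<one>\<^bsub>R\<^esub> \<odot>\<^bsub>M\<^esub> x" using x by (simp add: smult_one)
    then have "x \<in> ?X" using sD(2) by blast
    ultimately have "x \<in> D" by simp
    moreover have "x = \<zero>\<^bsub>M\<^esub> \<oplus>\<^bsub>M\<^esub> x" using x by simp
    ultimately show False using no sA(2) by blast
  qed
  then show ?thesis using D by blast
qed

lemma (in left_module) complement_projection:
  assumes A: "submodule A R M" and D: "submodule D R M" and AD: "A \<inter> D = {\<zero>\<^bsub>M\<^esub>}"
    and sum: "\<forall>x\<in>carrier M. \<exists>a\<in>A. \<exists>d\<in>D. x = a \<oplus>\<^bsub>M\<^esub> d"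
  shows "\<exists>p. left_module_hom R M M p \<and> (\<forall>x\<in>carrier M. p x \<in> A) \<and> (\<forall>a\<in>A. p a = a) \<and> (\<forall>d\<in>D. p d = \<zero>\<^bsub>M\<^esub>)"
proof -
  note sA = submoduleD[OF A] and sD = submoduleD[OF D]
  have Ac: "a \<in> carrier M" if "a \<in> A" for a using that sA(1) by auto
  have Dc: "d \<in> carrier M" if "d \<in> D" for d using that sD(1) by auto
  define p where "p x = (THE a. a \<in> A \<and> (\<exists>d\<in>D. x = a \<oplus>\<^bsub>M\<^esub> d))" for x
  have p: "p (a \<oplus>\<^bsub>M\<^esub> d) = a" if "a \<in> A" "d \<in> D" for a d
  proof -
    have "a' = a" if *: "a' \<in> A" "d' \<in> D" "a \<oplus>\<^bsub>M\<^esub> d = a' \<oplus>\<^bsub>M\<^esub> d'" for a' d'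
    proof -
      have c: "a \<in> carrier M" "d \<in> carrier M" "a' \<in> carrier M" "d' \<in> carrier M"
        using * \<open>a \<in> A\<close> \<open>d \<in> D\<close> Ac Dc by auto
      have "a \<ominus>\<^bsub>M\<^esub> a' = (a \<oplus>\<^bsub>M\<^esub> d) \<ominus>\<^bsub>M\<^esub> d \<ominus>\<^bsub>M\<^esub> a'" using c by (simp add: a_minus_def M.a_assoc M.r_neg)
      also have "\<dots> = (a' \<oplus>\<^bsub>M\<^esub> d') \<ominus>\<^bsub>M\<^esub> d \<ominus>\<^bsub>M\<^esub> a'" using * by simp
      also have "\<dots> = (d' \<ominus>\<^bsub>M\<^esub> d) \<oplus>\<^bsub>M\<^esub> (a' \<oplus>\<^bsub>M\<^esub> \<ominus>\<^bsub>M\<^esub> a')" using c by (simp add: a_minus_def M.a_ac)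
      also have "\<dots> = d' \<ominus>\<^bsub>M\<^esub> d" using c by (simp add: M.r_neg)
      finally have "a \<ominus>\<^bsub>M\<^esub> a' = d' \<ominus>\<^bsub>M\<^esub> d" .
      moreover have "a \<ominus>\<^bsub>M\<^esub> a' \<in> A" "d' \<ominus>\<^bsub>M\<^esub> d \<in> D" using sA(5) sD(5) * \<open>a \<in> A\<close> \<open>d \<in> D\<close> by auto
      ultimately have "a \<ominus>\<^bsub>M\<^esub> a' = \<zero>\<^bsub>M\<^esub>" using AD by auto
      then show ?thesis using M.minus_eq_zeroD[of a a'] c by simp
    qed
    then show ?thesis unfolding p_def using that by (intro the_equality) blast+
  qed
  have "left_module_hom R M M p"
  proof (rule left_module_homI)
    fix x assume "x \<in> carrier M"
    then obtain a d where x: "a \<in> A" "d \<in> D" "x = a \<oplus>\<^bsub>M\<^esub> d" using sum by blast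
    then show "p x \<in> carrier M" using p Ac by simp
    show "p (r \<odot>\<^bsub>M\<^esub> x) = r \<odot>\<^bsub>M\<^esub> p x" if "r \<in> carrier R" for r
      using that x by (simp add: smult_r_distr Ac Dc p sA(4) sD(4))
    fix y assume "y \<in> carrier M"
    then obtain a' d' where y: "a' \<in> A" "d' \<in> D" "y = a' \<oplus>\<^bsub>M\<^esub> d'" using sum by blast
    have "x \<oplus>\<^bsub>M\<^esub> y = (a \<oplus>\<^bsub>M\<^esub> a') \<oplus>\<^bsub>M\<^esub> (d \<oplus>\<^bsub>M\<^esub> d')" using x y by (simp add: Ac Dc M.a_ac)
    then show "p (x \<oplus>\<^bsub>M\<^esub> y) = p x \<oplus>\<^bsub>M\<^esub> p y" using x y by (simp add: p sA(3) sD(3))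
  qed
  moreover have "p x \<in> A" if "x \<in> carrier M" for x using that sum p by force
  moreover have "p a = a" if "a \<in> A" for a using p[OF that sD(2)] that by (simp add: Ac)
  moreover have "p d = \<zero>\<^bsub>M\<^esub>" if "d \<in> D" for d using p[OF sA(2) that] that by (simp add: Dc)
  ultimately show ?thesis by blast
qed

text \<open>The field as a ring record, so that the complement argument can be run for vector
  spaces.\<close>

definition scalar_ring :: "'k::comm_ring_1 ring" where
  "scalar_ring = \<lparr>carrier = UNIV, mult = (*), one = 1, zero = 0, add = (+)\<rparr>"

lemma ring_scalar_ring: "ring (scalar_ring :: 'k::comm_ring_1 ring)"
proof -
  have "\<exists>y. y + x = 0" for x :: 'k by (rule exI[of _ "- x"]) simp
  then show ?thesis
    by (intro ringI abelian_groupI monoidI) (simp_all add: scalar_ring_def algebra_simps)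
qed

section \<open>Maschke's theorem and the existence of simple submodules\<close>

context group_module
begin

abbreviation sc :: "'k \<Rightarrow> 'm \<Rightarrow> 'm" where "sc c x \<equiv> single c \<one> \<odot>\<^bsub>T\<^esub> x"

lemma sum_scalars:
  "\<lbrakk>finite A; x \<in> carrier T\<rbrakk> \<Longrightarrow> (\<Oplus>\<^bsub>T\<^esub>i\<in>A. sc (c i) x) = sc (\<Sum>i\<in>A. c i) x"
proof (induct A rule: finite_induct)
  case empty then show ?case by (simp add: single_0_smult)
next
  case (insert a A)
  then show ?case
    by (subst T.M.finsum_insert) (simp_all add: T.smult_l_distr[symmetric] single_add)
qed

lemma sum_const: "\<lbrakk>finite A; x \<in> carrier T\<rbrakk> \<Longrightarrow> (\<Oplus>\<^bsub>T\<^esub>i\<in>A. x) = sc (of_nat (card A)) x"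
  using sum_scalars[of A x "\<lambda>_. 1"] by simp

lemma sc_sc: "x \<in> carrier T \<Longrightarrow> sc c (sc d x) = sc (c * d) x"
  by (simp add: single_smult_single)

lemma sc_add: "x \<in> carrier T \<Longrightarrow> sc c x \<oplus>\<^bsub>T\<^esub> sc d x = sc (c + d) x"
  by (simp add: T.smult_l_distr[symmetric] single_add)

lemma sc_eq_zeroD: "\<lbrakk>sc c x = \<zero>\<^bsub>T\<^esub>; c \<noteq> 0; x \<in> carrier T\<rbrakk> \<Longrightarrow> x = \<zero>\<^bsub>T\<^esub>"
  using sc_sc[of x "inverse c" c] by (simp add: T.smult_r_zero)

lemma sc_cancel:
  assumes "sc c x = sc d x" "x \<in> carrier T" "x \<noteq> \<zero>\<^bsub>T\<^esub>" shows "c = d"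
proof (rule ccontr)
  assume "c \<noteq> d"
  have "sc (c - d) x = sc c x \<oplus>\<^bsub>T\<^esub> sc (- d) x" using assms(2) by (simp add: sc_add)
  also have "\<dots> = sc d x \<oplus>\<^bsub>T\<^esub> sc (- d) x" by (simp only: assms(1))
  also have "\<dots> = \<zero>\<^bsub>T\<^esub>" using assms(2) by (simp add: sc_add single_0_smult)
  finally show False using sc_eq_zeroD[of "c - d" x] \<open>c \<noteq> d\<close> assms(2,3) by simp
qed

lemma single_eq_sc: "\<lbrakk>h \<in> carrier G; x \<in> carrier T\<rbrakk> \<Longrightarrow> single c h \<odot>\<^bsub>T\<^esub> x = sc c (single 1 h \<odot>\<^bsub>T\<^esub> x)"
  by (simp add: single_smult_single)

text \<open>The complement found here is only a subspace, although \<open>A\<close> and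
  \<open>B\<close> are submodules; equivariance is restored by averaging in
  \<open>maschke\<close>.\<close>

lemma linear_complement_projection:
  assumes A: "submodule A (monoid_algebra G) T" and B: "submodule B (monoid_algebra G) T"
    and AB: "A \<inter> B = {\<zero>\<^bsub>T\<^esub>}"
  shows "\<exists>p. (\<forall>x\<in>carrier T. p x \<in> A) \<and> (\<forall>x\<in>carrier T. \<forall>y\<in>carrier T. p (x \<oplus>\<^bsub>T\<^esub> y) = p x \<oplus>\<^bsub>T\<^esub> p y) \<and>
    (\<forall>c. \<forall>x\<in>carrier T. p (sc c x) = sc c (p x)) \<and> (\<forall>a\<in>A. p a = a) \<and> (\<forall>b\<in>B. p b = \<zero>\<^bsub>T\<^esub>)"
proof -
  let ?S = "restrict_scalars (\<lambda>c. single c \<one>) T"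
  have "(\<lambda>c. single c \<one>) \<in> ring_hom scalar_ring (monoid_algebra G :: ('g \<Rightarrow> 'k) ring)"
    by (rule ring_hom_memI) (simp_all add: scalar_ring_def single_mult single_add monoid_algebra_one)
  then interpret S: left_module scalar_ring ?S
    by (rule left_module_restrict_scalars[OF T.left_module_axioms ring_scalar_ring])
  have sub: "submodule N scalar_ring ?S" if "submodule N (monoid_algebra G) T" for N
    by (rule S.submoduleI) (use T.submoduleD[OF that] in auto)
  have "\<exists>b\<in>carrier scalar_ring. b \<otimes>\<^bsub>scalar_ring\<^esub> a = \<one>\<^bsub>scalar_ring\<^esub>"
    if "a \<noteq> \<zero>\<^bsub>scalar_ring\<^esub>" for a :: 'k
    using that by (intro bexI[of _ "inverse a"]) (auto simp: scalar_ring_def)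
  then obtain D where D: "submodule D scalar_ring ?S" "B \<subseteq> D" "A \<inter> D = {\<zero>\<^bsub>T\<^esub>}"
    "\<forall>x\<in>carrier T. \<exists>a\<in>A. \<exists>d\<in>D. x = a \<oplus>\<^bsub>T\<^esub> d"
    using S.submodule_complement_division_ring[OF _ sub[OF A] sub[OF B]] AB by auto
  obtain p where p: "left_module_hom scalar_ring ?S ?S p" "\<forall>x\<in>carrier T. p x \<in> A" "\<forall>a\<in>A. p a = a"
    "\<forall>d\<in>D. p d = \<zero>\<^bsub>T\<^esub>" using S.complement_projection[OF sub[OF A] D(1)] D(3,4) by auto
  then show ?thesis using left_module_homD(2,3)[OF p(1)] D(2)
    by (intro exI[of _ p]) (auto simp: scalar_ring_def)
qed

text \<open>Averaging a linear projection over the group makes it equivariant.\<close>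

theorem maschke:
  assumes A: "submodule A (monoid_algebra G) T" and B: "submodule B (monoid_algebra G) T"
    and AB: "A \<inter> B = {\<zero>\<^bsub>T\<^esub>}" and char: "of_nat (card (carrier G)) \<noteq> (0::'k)"
  shows "\<exists>P. left_module_hom (monoid_algebra G) T T P \<and> (\<forall>x\<in>carrier T. P x \<in> A) \<and> (\<forall>a\<in>A. P a = a) \<and>
    (\<forall>b\<in>B. P b = \<zero>\<^bsub>T\<^esub>)"
proof -
  obtain p where p: "\<forall>x\<in>carrier T. p x \<in> A" "\<And>x y. \<lbrakk>x \<in> carrier T; y \<in> carrier T\<rbrakk> \<Longrightarrow> p (x \<oplus>\<^bsub>T\<^esub> y) = p x \<oplus>\<^bsub>T\<^esub> p y"
    "\<And>c x. x \<in> carrier T \<Longrightarrow> p (sc c x) = sc c (p x)" "\<forall>a\<in>A. p a = a" "\<forall>b\<in>B. p b = \<zero>\<^bsub>T\<^esub>"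
    using linear_complement_projection[OF A B AB] by auto
  note sA = T.submoduleD[OF A] and sB = T.submoduleD[OF B]
  have pc: "p x \<in> carrier T" if "x \<in> carrier T" for x using that p(1) sA(1) by auto
  define N where "N = (of_nat (card (carrier G)) :: 'k)"
  define t where "t x h = single 1 h \<odot>\<^bsub>T\<^esub> p (single 1 (inv h) \<odot>\<^bsub>T\<^esub> x)" for x h
  define P where "P x = sc (inverse N) (\<Oplus>\<^bsub>T\<^esub>h\<in>carrier G. t x h)" for x
  have tA: "t x h \<in> A" if "x \<in> carrier T" "h \<in> carrier G" for x h
    unfolding t_def using that p(1) by (intro sA(4)) auto
  have tc: "t x h \<in> carrier T" if "x \<in> carrier T" "h \<in> carrier G" for x h
    using tA[OF that] sA(1) by auto
  have Sc: "(\<Oplus>\<^bsub>T\<^esub>h\<in>carrier G. t x h) \<in> carrier T" if "x \<in> carrier T" for x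
    using that tc by (intro T.M.finsum_closed) auto
  have SA: "(\<Oplus>\<^bsub>T\<^esub>h\<in>H. t x h) \<in> A" if "x \<in> carrier T" "H \<subseteq> carrier G" for x H
    using finite_subset[OF that(2) finite_carrier] that(2)
  proof (induct H rule: finite_induct)
    case empty then show ?case using sA(2) by simp
  next
    case (insert a H)
    then show ?case using that(1) tA tc sA(3) by (subst T.M.finsum_insert) auto
  qed
  have PA: "P x \<in> A" if "x \<in> carrier T" for x unfolding P_def using that SA by (intro sA(4)) auto
  have "P a = a" if a: "a \<in> A" for a
  proof -
    have ac: "a \<in> carrier T" using a sA(1) by auto
    have "t a h = a" if h: "h \<in> carrier G" for h
    proof -
      have "single 1 (inv h) \<odot>\<^bsub>T\<^esub> a \<in> A" using h a by (intro sA(4)) auto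
      then show ?thesis using h ac p(4) by (simp add: t_def single_smult_single)
    qed
    then have "(\<Oplus>\<^bsub>T\<^esub>h\<in>carrier G. t a h) = (\<Oplus>\<^bsub>T\<^esub>h\<in>carrier G. a)" using ac by (intro T.M.finsum_cong') auto
    then show ?thesis unfolding P_def using ac char
      by (simp add: sum_const finite_carrier sc_sc N_def)
  qed
  \<comment> \<open>\<open>B\<close> is stable under the group, so every conjugate of the linear
    projection kills it as well.\<close>
  moreover have "P b = \<zero>\<^bsub>T\<^esub>" if b: "b \<in> B" for b
  proof -
    have "t b h = \<zero>\<^bsub>T\<^esub>" if h: "h \<in> carrier G" for h
    proof -
      have "single 1 (inv h) \<odot>\<^bsub>T\<^esub> b \<in> B" using h b by (intro sB(4)) auto
      then show ?thesis using h p(5) by (simp add: t_def T.smult_r_zero)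
    qed
    then have "(\<Oplus>\<^bsub>T\<^esub>h\<in>carrier G. t b h) = \<zero>\<^bsub>T\<^esub>" by (intro T.M.add.finprod_one_eqI) auto
    then show ?thesis unfolding P_def by (simp add: T.smult_r_zero)
  qed
  moreover have "left_module_hom (monoid_algebra G) T T P"
  proof (rule left_module_hom_monoid_algebraI[OF T.left_module_axioms T.left_module_axioms])
    fix x assume x: "x \<in> carrier T"
    show "P x \<in> carrier T" using PA[OF x] sA(1) by auto
    {
      fix y assume y: "y \<in> carrier T"
      have "(\<Oplus>\<^bsub>T\<^esub>h\<in>carrier G. t (x \<oplus>\<^bsub>T\<^esub> y) h) = (\<Oplus>\<^bsub>T\<^esub>h\<in>carrier G. t x h \<oplus>\<^bsub>T\<^esub> t y h)"
        using x y tc by (intro T.M.finsum_cong') (auto simp: t_def T.smult_r_distr p(2) pc)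
      also have "\<dots> = (\<Oplus>\<^bsub>T\<^esub>h\<in>carrier G. t x h) \<oplus>\<^bsub>T\<^esub> (\<Oplus>\<^bsub>T\<^esub>h\<in>carrier G. t y h)"
        using x y tc by (intro T.M.finsum_addf) auto
      finally show "P (x \<oplus>\<^bsub>T\<^esub> y) = P x \<oplus>\<^bsub>T\<^esub> P y" using x y Sc by (simp add: P_def T.smult_r_distr)
    }
    fix c a assume a: "a \<in> carrier G"
    \<comment> \<open>Substituting \<open>h = a k\<close> in the average moves \<open>a\<close> out
      of the sum.\<close>
    have "(\<Oplus>\<^bsub>T\<^esub>h\<in>carrier G. t (single c a \<odot>\<^bsub>T\<^esub> x) h)
        = (\<Oplus>\<^bsub>T\<^esub>h\<in>(\<lambda>k. a \<otimes> k) ` carrier G. t (single c a \<odot>\<^bsub>T\<^esub> x) h)"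
      using a by (simp add: surj_const_mult)
    also have "\<dots> = (\<Oplus>\<^bsub>T\<^esub>k\<in>carrier G. t (single c a \<odot>\<^bsub>T\<^esub> x) (a \<otimes> k))"
      using a x tc by (intro T.M.finsum_reindex inj_on_cmult) auto
    also have "\<dots> = (\<Oplus>\<^bsub>T\<^esub>k\<in>carrier G. single c a \<odot>\<^bsub>T\<^esub> t x k)"
    proof (intro T.M.finsum_cong' refl)
      fix k assume k: "k \<in> carrier G"
      have "single 1 (inv (a \<otimes> k)) \<odot>\<^bsub>T\<^esub> (single c a \<odot>\<^bsub>T\<^esub> x) = sc c (single 1 (inv k) \<odot>\<^bsub>T\<^esub> x)"
        using a k x by (simp add: single_smult_single inv_mult_group m_assoc)
      moreover have y: "single 1 (inv k) \<odot>\<^bsub>T\<^esub> x \<in> carrier T" using k x by simp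
      ultimately show "t (single c a \<odot>\<^bsub>T\<^esub> x) (a \<otimes> k) = single c a \<odot>\<^bsub>T\<^esub> t x k"
        unfolding t_def using a k pc[OF y] by (simp only: p(3)[OF y]) (simp add: single_smult_single)
    qed (use a x tc in auto)
    also have "\<dots> = single c a \<odot>\<^bsub>T\<^esub> (\<Oplus>\<^bsub>T\<^esub>k\<in>carrier G. t x k)"
      using a x tc by (intro T.smult_finsum[symmetric]) auto
    finally show "P (single c a \<odot>\<^bsub>T\<^esub> x) = single c a \<odot>\<^bsub>T\<^esub> P x"
      using a x Sc by (simp add: P_def single_smult_single mult.commute)
  qed
  ultimately show ?thesis using PA by blast
qed

text \<open>A submodule maximal among those containing \<open>K\<close> but not \<open>x\<close> has a simple complement, so no
  dimension count is needed.\<close>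

lemma exists_simple_submodule:
  assumes char: "of_nat (card (carrier G)) \<noteq> (0::'k)"
    and K: "submodule K (monoid_algebra G) T" and x: "x \<in> carrier T" "x \<notin> K"
  shows "\<exists>D. submodule D (monoid_algebra G) T \<and> D \<inter> K = {\<zero>\<^bsub>T\<^esub>} \<and>
     simple_module (monoid_algebra G) (T\<lparr>carrier := D\<rparr>)"
proof -
  let ?R = "monoid_algebra G :: ('g \<Rightarrow> 'k) ring"
  let ?Z = "{C. submodule C ?R T \<and> K \<subseteq> C \<and> x \<notin> C}"
  have "\<exists>C\<in>?Z. \<forall>X\<in>?Z. C \<subseteq> X \<longrightarrow> X = C"
  proof (rule subset_Zorn_nonempty)
    show "?Z \<noteq> {}" using K x by auto
    fix Ch assume C: "Ch \<noteq> {}" "subset.chain ?Z Ch"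
    then have CZ: "\<And>N. N \<in> Ch \<Longrightarrow> N \<in> ?Z" and ch: "\<And>N N'. \<lbrakk>N \<in> Ch; N' \<in> Ch\<rbrakk> \<Longrightarrow> N \<subseteq> N' \<or> N' \<subseteq> N"
      by (auto simp: subset_chain_def)
    have "submodule (\<Union>Ch) ?R T" by (rule T.submodule_Union_chain[OF C(1)]) (use CZ ch in auto)
    then show "\<Union>Ch \<in> ?Z" using CZ C(1) by auto
  qed
  then obtain C where C: "submodule C ?R T" "K \<subseteq> C" "x \<notin> C"
    and max: "\<And>X. \<lbrakk>submodule X ?R T; C \<subseteq> X; x \<notin> X\<rbrakk> \<Longrightarrow> X = C" by auto
  note sC = T.submoduleD[OF C(1)]
  \<comment> \<open>By maximality of \<open>C\<close>, adding to it any nonzero submodule that meets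
    it trivially captures \<open>x\<close>.\<close>
  have sum_max: "\<exists>c\<in>C. \<exists>n\<in>N. x = c \<oplus>\<^bsub>T\<^esub> n" if N: "submodule N ?R T" "N \<inter> C = {\<zero>\<^bsub>T\<^esub>}" "N \<noteq> {\<zero>\<^bsub>T\<^esub>}" for N
  proof (rule ccontr)
    assume "\<not> ?thesis"
    then have nx: "x \<notin> {c \<oplus>\<^bsub>T\<^esub> n | c n. c \<in> C \<and> n \<in> N}" by blast
    note sN = T.submoduleD[OF N(1)]
    have CN: "C \<subseteq> {c \<oplus>\<^bsub>T\<^esub> n | c n. c \<in> C \<and> n \<in> N}"
    proof
      fix c assume "c \<in> C"
      moreover have "c = c \<oplus>\<^bsub>T\<^esub> \<zero>\<^bsub>T\<^esub>" using \<open>c \<in> C\<close> sC(1) by auto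
      ultimately show "c \<in> {c \<oplus>\<^bsub>T\<^esub> n | c n. c \<in> C \<and> n \<in> N}" using sN(2) by blast
    qed
    have eq: "{c \<oplus>\<^bsub>T\<^esub> n | c n. c \<in> C \<and> n \<in> N} = C" by (rule max[OF T.submodule_sum[OF C(1) N(1)] CN nx])
    have "m \<in> C" if "m \<in> N" for m
    proof -
      have "m = \<zero>\<^bsub>T\<^esub> \<oplus>\<^bsub>T\<^esub> m" using that sN(1) by auto
      then show ?thesis using that sC(2) eq by blast
    qed
    then have "N \<inter> C = N" by blast
    then show False using N(2,3) by simp
  qed
  have "C \<inter> {\<zero>\<^bsub>T\<^esub>} = {\<zero>\<^bsub>T\<^esub>}" using sC(2) by auto
  moreover have "submodule {\<zero>\<^bsub>T\<^esub>} ?R T" by (rule T.submoduleI) (auto simp: T.smult_r_zero)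
  ultimately obtain P where P: "left_module_hom ?R T T P" "\<forall>x\<in>carrier T. P x \<in> C" "\<forall>a\<in>C. P a = a"
    using maschke[OF C(1) _ _ char] by blast
  note hP = left_module_homD[OF P(1)]
  define D where "D = {y \<in> carrier T. P y = \<zero>\<^bsub>T\<^esub>}"
  have D: "submodule D ?R T" unfolding D_def by (rule T.submodule_kernel[OF T.left_module_axioms P(1)])
  note sD = T.submoduleD[OF D]
  have DC: "D \<inter> C = {\<zero>\<^bsub>T\<^esub>}" using P(3) sD(2) sC(2) by (auto simp: D_def)
  have hm: "Q (d \<ominus>\<^bsub>T\<^esub> Q d) = \<zero>\<^bsub>T\<^esub>" if Q: "left_module_hom ?R T T Q" "Q (Q d) = Q d" and d: "d \<in> carrier T" for Q d
  proof -
    have Qd: "Q d \<in> carrier T" using left_module_homD(1)[OF Q(1) d] .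
    have "Q (d \<ominus>\<^bsub>T\<^esub> Q d) = Q d \<ominus>\<^bsub>T\<^esub> Q (Q d)"
      using left_module_homD[OF Q(1)] d Qd
      by (intro additive_minus[OF T.M.abelian_group_axioms T.M.abelian_group_axioms]) auto
    then show ?thesis using Q(2) Qd by (simp add: T.M.minus_self)
  qed
  have D0: "D \<noteq> {\<zero>\<^bsub>T\<^esub>}"
  proof
    assume D0: "D = {\<zero>\<^bsub>T\<^esub>}"
    have "x \<ominus>\<^bsub>T\<^esub> P x \<in> D" using x(1) P(2,3) hP(1) hm[OF P(1) _ x(1)] by (auto simp: D_def)
    then have "x = P x" using D0 x(1) hP(1) T.M.minus_eq_zeroD[of x "P x"] by auto
    then show False using P(2) x C(3) by auto
  qed
  \<comment> \<open>Project \<open>D\<close> onto \<open>N\<close> along \<open>C\<close> and let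
    \<open>E\<close> be the part of \<open>D\<close> that is killed. If \<open>E\<close> were
    nonzero, \<open>x\<close> would lie both in \<open>C + E\<close> and in \<open>C + N\<close>.
    The projection kills the first sum and reads off the \<open>N\<close>-part of the second, so
    this part is zero and \<open>x\<close> lies in \<open>C\<close>, a contradiction.\<close>
  have min: "N = D" if N: "submodule N ?R T" "N \<subseteq> D" "N \<noteq> {\<zero>\<^bsub>T\<^esub>}" for N
  proof -
    note sN = T.submoduleD[OF N(1)]
    have NC: "N \<inter> C = {\<zero>\<^bsub>T\<^esub>}" using N(2) DC sN(2) sC(2) by auto
    obtain Q where Q: "left_module_hom ?R T T Q" "\<forall>x\<in>carrier T. Q x \<in> N" "\<forall>a\<in>N. Q a = a" "\<forall>c\<in>C. Q c = \<zero>\<^bsub>T\<^esub>"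
      using maschke[OF N(1) C(1) NC char] by blast
    note hQ = left_module_homD[OF Q(1)]
    define E where "E = D \<inter> {y \<in> carrier T. Q y = \<zero>\<^bsub>T\<^esub>}"
    have E: "submodule E ?R T" unfolding E_def
      by (intro T.submodule_Int D T.submodule_kernel[OF T.left_module_axioms Q(1)])
    have EC: "E \<inter> C = {\<zero>\<^bsub>T\<^esub>}" using DC T.submoduleD(2)[OF E] sC(2) by (auto simp: E_def)
    have E0: "E = {\<zero>\<^bsub>T\<^esub>}"
    proof (rule ccontr)
      assume "E \<noteq> {\<zero>\<^bsub>T\<^esub>}"
      then obtain c e where ce: "c \<in> C" "e \<in> E" "x = c \<oplus>\<^bsub>T\<^esub> e" using sum_max[OF E EC] by blast
      obtain c' m where cm: "c' \<in> C" "m \<in> N" "x = c' \<oplus>\<^bsub>T\<^esub> m" using sum_max[OF N(1) NC N(3)] by blast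
      have cc: "c \<in> carrier T" "e \<in> carrier T" "c' \<in> carrier T" "m \<in> carrier T"
        using ce cm sC(1) sN(1) by (auto simp: E_def)
      have "Q x = \<zero>\<^bsub>T\<^esub>" using ce cc hQ(2)[of c e] Q(4) by (simp add: E_def)
      moreover have "Q x = m" using cm cc hQ(2)[of c' m] Q(3,4) by simp
      ultimately have "m = \<zero>\<^bsub>T\<^esub>" by simp
      then have "x = c'" using cm(3) cc(3) by simp
      then show False using cm(1) C(3) by simp
    qed
    have "D \<subseteq> N"
    proof
      fix d assume d: "d \<in> D"
      then have dc: "d \<in> carrier T" using sD(1) by auto
      have "d \<ominus>\<^bsub>T\<^esub> Q d \<in> D" using sD(5)[OF d] Q(2) N(2) dc by auto
      then have "d \<ominus>\<^bsub>T\<^esub> Q d \<in> E" using hm[OF Q(1) _ dc] Q(2,3) dc sD(1) by (auto simp: E_def)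
      then have "d = Q d" using E0 T.M.minus_eq_zeroD[of d "Q d"] dc hQ(1) by auto
      then show "d \<in> N" using Q(2) dc by auto
    qed
    then show ?thesis using N(2) by blast
  qed
  have "simple_module ?R (T\<lparr>carrier := D\<rparr>)"
    unfolding simple_module_def
  proof (intro conjI allI impI)
    show "left_module ?R (T\<lparr>carrier := D\<rparr>)" by (rule T.submodule_left_module[OF D])
    show "carrier (T\<lparr>carrier := D\<rparr>) \<noteq> {\<zero>\<^bsub>T\<lparr>carrier := D\<rparr>\<^esub>}" using D0 by simp
    fix N assume N: "submodule N ?R (T\<lparr>carrier := D\<rparr>)"
    note sN = left_module.submoduleD[OF T.submodule_left_module[OF D] N, simplified]
    have "submodule N ?R T" by (rule T.submoduleI) (use sN sD(1) in auto)
    then show "N = {\<zero>\<^bsub>T\<lparr>carrier := D\<rparr>\<^esub>} \<or> N = carrier (T\<lparr>carrier := D\<rparr>)" using min sN(1) by auto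
  qed
  moreover have "D \<inter> K = {\<zero>\<^bsub>T\<^esub>}" using DC C(2) sD(2) T.submoduleD(2)[OF K] by auto
  ultimately show ?thesis using D by blast
qed

end

section \<open>Central group elements\<close>

lemma (in abelian_monoid) finsum_shift:
  fixes u :: "nat \<Rightarrow> 'a"
  assumes "\<And>m. u m \<in> carrier G"
  shows "u 0 \<oplus> (\<Oplus>m\<in>{..<M}. u (Suc m)) = (\<Oplus>m\<in>{..<M}. u m) \<oplus> u M"
proof (induct M)
  case (Suc M)
  have cl: "(\<Oplus>m\<in>{..<M}. u m) \<in> carrier G" "(\<Oplus>m\<in>{..<M}. u (Suc m)) \<in> carrier G"
    using assms by (auto intro!: finsum_closed)
  have "u 0 \<oplus> (\<Oplus>m\<in>{..<Suc M}. u (Suc m)) = (u 0 \<oplus> (\<Oplus>m\<in>{..<M}. u (Suc m))) \<oplus> u (Suc M)"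
    unfolding lessThan_Suc using assms cl by (subst finsum_insert) (auto simp: a_ac)
  also have "\<dots> = (\<Oplus>m\<in>{..<Suc M}. u m) \<oplus> u (Suc M)"
    unfolding Suc lessThan_Suc using assms cl by (subst finsum_insert) (auto simp: a_ac)
  finally show ?case .
qed (simp add: assms)

text \<open>Rotation of a sum that closes up. It serves for the powers of a group element, with
  period the group order, and for the layers of a tower, where y returns the last layer to the
  first.\<close>

lemma (in abelian_group) finsum_cyclic_shift:
  fixes u :: "nat \<Rightarrow> 'a"
  assumes u: "\<And>m. u m \<in> carrier G" and "u M = u 0"
  shows "(\<Oplus>m\<in>{..<M}. u (Suc m)) = (\<Oplus>m\<in>{..<M}. u m)"
proof -
  have cl: "(\<Oplus>m\<in>{..<M}. u m) \<in> carrier G" "(\<Oplus>m\<in>{..<M}. u (Suc m)) \<in> carrier G"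
    using u by (auto intro!: finsum_closed)
  then have "u 0 \<oplus> (\<Oplus>m\<in>{..<M}. u (Suc m)) = u 0 \<oplus> (\<Oplus>m\<in>{..<M}. u m)"
    using finsum_shift[of u M] assms by (simp add: a_comm)
  then show ?thesis using cl u by simp
qed

section \<open>Eigenvectors and eigenprojections of group elements\<close>

context group_module
begin

text \<open>The vector \<open>p(z) v\<close>, evaluated by Horner's scheme.\<close>

definition poly_act :: "'g \<Rightarrow> 'm \<Rightarrow> 'k poly \<Rightarrow> 'm" where
  "poly_act z v p = fold_coeffs (\<lambda>c w. sc c v \<oplus>\<^bsub>T\<^esub> single 1 z \<odot>\<^bsub>T\<^esub> w) p \<zero>\<^bsub>T\<^esub>"

context
  fixes z v assumes z: "z \<in> carrier G" and v: "v \<in> carrier T"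
begin

lemma poly_act_0: "poly_act z v 0 = \<zero>\<^bsub>T\<^esub>" by (simp add: poly_act_def)

lemma poly_act_pCons: "poly_act z v (pCons c p) = sc c v \<oplus>\<^bsub>T\<^esub> single 1 z \<odot>\<^bsub>T\<^esub> poly_act z v p"
proof (cases "c = 0 \<and> p = 0")
  case True then show ?thesis using z v by (simp add: poly_act_def single_0_smult T.smult_r_zero)
next
  case False then show ?thesis by (cases "p = 0") (auto simp: poly_act_def)
qed

lemma poly_act_closed: "poly_act z v p \<in> carrier T"
  using z v by (induct p) (simp_all add: poly_act_0 poly_act_pCons)

lemma poly_act_add: "poly_act z v (p + q) = poly_act z v p \<oplus>\<^bsub>T\<^esub> poly_act z v q"
proof (induct p q rule: poly_induct2)
  case 0 show ?case by (simp add: poly_act_0)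
next
  case (pCons a p b q)
  have "sc (a + b) v = sc a v \<oplus>\<^bsub>T\<^esub> sc b v" using v by (simp add: sc_add)
  then show ?case using z v pCons poly_act_closed
    by (simp add: poly_act_pCons T.smult_r_distr T.M.a_ac)
qed

lemma poly_act_smult: "poly_act z v (Polynomial.smult c p) = sc c (poly_act z v p)"
proof (induct p)
  case 0 then show ?case by (simp add: poly_act_0 T.smult_r_zero)
next
  case (pCons a p)
  then show ?case using z v poly_act_closed
    by (simp add: poly_act_pCons T.smult_r_distr single_smult_single)
qed

lemma poly_act_linear_factor:
  "poly_act z v ([:- r, 1:] * p) = sc (- r) (poly_act z v p) \<oplus>\<^bsub>T\<^esub> single 1 z \<odot>\<^bsub>T\<^esub> poly_act z v p"
proof -
  have "[:- r, 1:] * p = Polynomial.smult (- r) p + pCons 0 p" by simp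
  then show ?thesis using z v poly_act_closed
    by (simp only: poly_act_add poly_act_smult) (simp add: poly_act_pCons single_0_smult)
qed

lemma poly_act_monom: "poly_act z v (Polynomial.monom 1 N) = single 1 (z [^] N) \<odot>\<^bsub>T\<^esub> v"
proof (induct N)
  case 0 then show ?case using z v by (simp add: monom_0 poly_act_pCons poly_act_0 T.smult_r_zero)
next
  case (Suc N)
  have "z \<otimes> z [^] N = z [^] Suc N" using z by (simp add: pow_mult_distrib nat_pow_comm[of z 1 N, simplified] )
  then show ?case using Suc z v by (simp add: monom_Suc poly_act_pCons single_0_smult single_smult_single)
qed

end

end

text \<open>The polynomial \<open>X^|G| - 1\<close> annihilates \<open>v\<close>, since
  \<open>z\<close> has finite order. Take an annihilating polynomial of least degree and split off a
  linear factor: the cofactor does not annihilate \<open>v\<close>, and it sends \<open>v\<close> to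
  an eigenvector.\<close>

lemma exists_eigenvector:
  fixes T :: "('g \<Rightarrow> 'k::alg_closed_field, 'm) module"
  assumes "group_module G T" and z: "z \<in> carrier G" and v: "v \<in> carrier T" "v \<noteq> \<zero>\<^bsub>T\<^esub>"
  shows "\<exists>w r. w \<in> carrier T \<and> w \<noteq> \<zero>\<^bsub>T\<^esub> \<and> single 1 z \<odot>\<^bsub>T\<^esub> w = single r \<one>\<^bsub>G\<^esub> \<odot>\<^bsub>T\<^esub> w"
proof -
  interpret group_module G T by fact
  let ?N = "order G"
  have N: "?N > 0" using finite_carrier order_gt_0_iff_finite by auto
  let ?P = "\<lambda>p. p \<noteq> 0 \<and> poly_act z v p = \<zero>\<^bsub>T\<^esub>"
  let ?q = "Polynomial.monom 1 ?N + Polynomial.smult (- 1) (1 :: 'k poly)"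
  have "poly_act z v ?q = v \<oplus>\<^bsub>T\<^esub> sc (- 1) v"
    using z v(1) by (simp only: poly_act_add[OF z v(1)] poly_act_smult[OF z v(1)] poly_act_monom[OF z v(1)]
      pow_order_eq_1[OF z]) (simp add: one_pCons poly_act_pCons poly_act_0 T.smult_r_zero)
  also have "\<dots> = \<zero>\<^bsub>T\<^esub>"
    using sc_add[OF v(1), of 1 "- 1"] v(1) by (simp add: single_0_smult)
  finally have "poly_act z v ?q = \<zero>\<^bsub>T\<^esub>" .
  moreover have "poly.coeff ?q ?N = 1" using N by (cases "order G") simp_all
  then have "?q \<noteq> 0" by (metis coeff_0 one_neq_zero)
  ultimately have "\<exists>p. ?P p" by blast
  then obtain p where p: "?P p" and least: "\<And>q. ?P q \<Longrightarrow> degree p \<le> degree q"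
    using exists_least_lemma[of "\<lambda>d. \<exists>p. ?P p \<and> degree p = d"] ex_has_least_nat[of ?P _ degree] by metis
  have "degree p > 0"
  proof (rule ccontr)
    assume "\<not> ?thesis"
    then obtain c where "p = [:c:]" by (metis degree_eq_zeroE neq0_conv)
    then show False using p sc_eq_zeroD[of c v] z v by (simp add: poly_act_pCons poly_act_0 T.smult_r_zero)
  qed
  then obtain r where "poly p r = 0" using alg_closed_imp_poly_has_root by blast
  then obtain q where q: "p = [:- r, 1:] * q" by (metis dvdE poly_eq_0_iff_dvd)
  have q0: "q \<noteq> 0" using p q by auto
  let ?w = "poly_act z v q"
  have wc: "?w \<in> carrier T" by (rule poly_act_closed[OF z v(1)])
  have "degree p = Suc (degree q)" unfolding q using q0 by (subst degree_mult_eq) auto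
  then have "?w \<noteq> \<zero>\<^bsub>T\<^esub>" using least[of q] q0 by auto
  moreover have "sc (- r) ?w \<oplus>\<^bsub>T\<^esub> single 1 z \<odot>\<^bsub>T\<^esub> ?w = \<zero>\<^bsub>T\<^esub>"
    using p q poly_act_linear_factor[OF z v(1)] by simp
  then have "sc r ?w \<oplus>\<^bsub>T\<^esub> (sc (- r) ?w \<oplus>\<^bsub>T\<^esub> single 1 z \<odot>\<^bsub>T\<^esub> ?w) = sc r ?w" using wc by simp
  then have "(sc r ?w \<oplus>\<^bsub>T\<^esub> sc (- r) ?w) \<oplus>\<^bsub>T\<^esub> single 1 z \<odot>\<^bsub>T\<^esub> ?w = sc r ?w"
    using wc z by (simp add: T.M.a_assoc)
  moreover have "sc r ?w \<oplus>\<^bsub>T\<^esub> sc (- r) ?w = \<zero>\<^bsub>T\<^esub>"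
    using wc by (simp add: sc_add single_0_smult)
  ultimately show ?thesis using wc z by (intro exI[of _ ?w] exI[of _ r]) simp
qed

lemma (in group_module) submodule_eigenspace:
  assumes z: "z \<in> carrier G" and central: "\<And>h. h \<in> carrier G \<Longrightarrow> z \<otimes> h = h \<otimes> z"
  shows "submodule {x \<in> carrier T. single 1 z \<odot>\<^bsub>T\<^esub> x = sc r x} (monoid_algebra G) T"
proof (rule submodule_monoid_algebraI[OF T.left_module_axioms])
  fix c a x assume a: "a \<in> carrier G" and "x \<in> {x \<in> carrier T. single 1 z \<odot>\<^bsub>T\<^esub> x = sc r x}"
  then have x: "x \<in> carrier T" "single 1 z \<odot>\<^bsub>T\<^esub> x = sc r x" by auto
  have "single 1 z \<odot>\<^bsub>T\<^esub> (single c a \<odot>\<^bsub>T\<^esub> x) = single c a \<odot>\<^bsub>T\<^esub> (single 1 z \<odot>\<^bsub>T\<^esub> x)"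
    using a z x(1) by (simp add: single_smult_single central)
  also have "\<dots> = sc r (single c a \<odot>\<^bsub>T\<^esub> x)" using a x by (simp add: single_smult_single mult.commute)
  finally show "single c a \<odot>\<^bsub>T\<^esub> x \<in> {x \<in> carrier T. single 1 z \<odot>\<^bsub>T\<^esub> x = sc r x}" using a x by simp
qed (use z in \<open>auto simp: T.smult_r_zero T.smult_r_distr\<close>)

lemma (in group_module) eigen_pow:
  fixes m :: nat
  assumes "z \<in> carrier G" "x \<in> carrier T" "single 1 z \<odot>\<^bsub>T\<^esub> x = sc r x"
  shows "single 1 (z [^] m) \<odot>\<^bsub>T\<^esub> x = sc (r ^ m) x"
proof (induct m)
  case 0 show ?case using assms by simp
next
  case (Suc m)
  have "single 1 (z [^] Suc m) \<odot>\<^bsub>T\<^esub> x = single 1 (z [^] m) \<odot>\<^bsub>T\<^esub> (single 1 z \<odot>\<^bsub>T\<^esub> x)"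
    using assms(1,2) by (simp add: single_smult_single)
  also have "\<dots> = single 1 (z [^] m) \<odot>\<^bsub>T\<^esub> sc r x" by (simp only: assms(3))
  also have "\<dots> = sc r (single 1 (z [^] m) \<odot>\<^bsub>T\<^esub> x)" using assms(1,2) by (simp add: single_smult_single)
  finally show ?case using Suc assms by (simp add: sc_sc)
qed

text \<open>\<open>exists_eigenvector\<close> makes some eigenspace nonzero, centrality of
  \<open>z\<close> makes it a submodule, and simplicity makes it everything.\<close>

theorem schur_central:
  fixes T :: "('g \<Rightarrow> 'k::alg_closed_field, 'm) module"
  assumes "group_module G T" "simple_module (monoid_algebra G) T"
    and z: "z \<in> carrier G" and central: "\<And>h. h \<in> carrier G \<Longrightarrow> z \<otimes>\<^bsub>G\<^esub> h = h \<otimes>\<^bsub>G\<^esub> z"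
  shows "\<exists>r. \<forall>x\<in>carrier T. single 1 z \<odot>\<^bsub>T\<^esub> x = single r \<one>\<^bsub>G\<^esub> \<odot>\<^bsub>T\<^esub> x"
proof -
  interpret group_module G T by fact
  obtain v where "v \<in> carrier T" "v \<noteq> \<zero>\<^bsub>T\<^esub>" using assms(2) T.M.zero_closed by (auto simp: simple_module_def)
  then obtain w r where w: "w \<in> carrier T" "w \<noteq> \<zero>\<^bsub>T\<^esub>" "single 1 z \<odot>\<^bsub>T\<^esub> w = sc r w"
    using exists_eigenvector[OF assms(1) z] by blast
  let ?N = "{x \<in> carrier T. single 1 z \<odot>\<^bsub>T\<^esub> x = sc r x}"
  have "?N = {\<zero>\<^bsub>T\<^esub>} \<or> ?N = carrier T"
    using assms(2) submodule_eigenspace[OF z central] by (simp add: simple_module_def)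
  moreover have "w \<in> ?N" using w by simp
  ultimately have "?N = carrier T" using w(2) by blast
  then show ?thesis by blast
qed

context group_module
begin

text \<open>The projection onto the \<open>r\<close>-eigenspace of \<open>z\<close>, provided that \<open>r\<close> is a root of unity of order
  dividing \<open>|G|\<close>.\<close>

definition eigenproj :: "'g \<Rightarrow> 'k \<Rightarrow> 'm \<Rightarrow> 'm" where
  "eigenproj z r x = sc (inverse (of_nat (order G))) (\<Oplus>\<^bsub>T\<^esub>m\<in>{..<order G}. single (inverse r ^ m) (z [^] m) \<odot>\<^bsub>T\<^esub> x)"

context
  fixes z :: 'g and r :: 'k
  assumes char: "of_nat (order G) \<noteq> (0::'k)" and z: "z \<in> carrier G"
    and central: "\<And>h. h \<in> carrier G \<Longrightarrow> z \<otimes> h = h \<otimes> z" and r: "r ^ order G = 1"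
begin

lemma eigen_root_nonzero: "r \<noteq> 0"
  using r char by (metis gr0I of_nat_0 power_eq_0_iff zero_neq_one zero_power)

lemma eigen_terms_closed:
  "x \<in> carrier T \<Longrightarrow> (\<lambda>m. single (inverse r ^ m) (z [^] (m::nat)) \<odot>\<^bsub>T\<^esub> x) \<in> A \<rightarrow> carrier T"
  using z by auto

lemma eigenproj_hom: "left_module_hom (monoid_algebra G) T T (eigenproj z r)"
proof (rule left_module_hom_monoid_algebraI[OF T.left_module_axioms T.left_module_axioms])
  note cl = eigen_terms_closed[THEN T.M.finsum_closed]
  fix x assume x: "x \<in> carrier T"
  show "eigenproj z r x \<in> carrier T" using x by (simp add: eigenproj_def cl)
  show "eigenproj z r (x \<oplus>\<^bsub>T\<^esub> y) = eigenproj z r x \<oplus>\<^bsub>T\<^esub> eigenproj z r y" if y: "y \<in> carrier T" for y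
    unfolding eigenproj_def using x y z cl[OF x] cl[OF y]
    by (simp add: T.smult_r_distr T.M.finsum_addf eigen_terms_closed)
  fix c a assume a: "a \<in> carrier G"
  have pc: "z [^] (m::nat) \<otimes> a = a \<otimes> z [^] m" for m
    by (induct m) (use a z central in \<open>simp_all add: m_assoc, simp add: m_assoc[symmetric]\<close>)
  have "single c a \<odot>\<^bsub>T\<^esub> (\<Oplus>\<^bsub>T\<^esub>m\<in>{..<order G}. single (inverse r ^ m) (z [^] m) \<odot>\<^bsub>T\<^esub> x)
      = (\<Oplus>\<^bsub>T\<^esub>m\<in>{..<order G}. single c a \<odot>\<^bsub>T\<^esub> (single (inverse r ^ m) (z [^] m) \<odot>\<^bsub>T\<^esub> x))"
    using a x z by (intro T.smult_finsum) auto
  also have "\<dots> = (\<Oplus>\<^bsub>T\<^esub>m\<in>{..<order G}. single (inverse r ^ m) (z [^] m) \<odot>\<^bsub>T\<^esub> (single c a \<odot>\<^bsub>T\<^esub> x))"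
    using a x z by (intro T.M.finsum_cong') (auto simp: single_smult_single pc mult.commute)
  finally have E: "single c a \<odot>\<^bsub>T\<^esub> (\<Oplus>\<^bsub>T\<^esub>m\<in>{..<order G}. single (inverse r ^ m) (z [^] m) \<odot>\<^bsub>T\<^esub> x) = \<dots>" .
  show "eigenproj z r (single c a \<odot>\<^bsub>T\<^esub> x) = single c a \<odot>\<^bsub>T\<^esub> eigenproj z r x"
    unfolding eigenproj_def E[symmetric] using a cl[OF x] by (simp add: single_smult_single mult.commute)
qed

lemma eigenproj_closed: "x \<in> carrier T \<Longrightarrow> eigenproj z r x \<in> carrier T"
  using left_module_homD(1)[OF eigenproj_hom] .

text \<open>Multiplication by \<open>z\<close> shifts the powers in the sum at the cost of a factor
  \<open>r\<close>. The sum closes up because both \<open>z\<close> and \<open>r\<close> become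
  trivial in the power \<open>|G|\<close>.\<close>

lemma eigenproj_eigen:
  assumes x: "x \<in> carrier T"
  shows "single 1 z \<odot>\<^bsub>T\<^esub> eigenproj z r x = sc r (eigenproj z r x)"
proof -
  let ?u = "\<lambda>m. single (inverse r ^ m) (z [^] (m::nat)) \<odot>\<^bsub>T\<^esub> x"
  have uc: "?u m \<in> carrier T" for m using x z by simp
  let ?N = "order G"
  let ?S = "\<Oplus>\<^bsub>T\<^esub>m\<in>{..<?N}. ?u m"
  have S: "?S \<in> carrier T" "(\<Oplus>\<^bsub>T\<^esub>m\<in>{..<?N}. ?u (Suc m)) \<in> carrier T"
    by (rule T.M.finsum_closed, rule Pi_I, rule uc)+
  have "?u ?N = ?u 0" using x z r by (simp add: pow_order_eq_1 power_inverse)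
  then have eq: "(\<Oplus>\<^bsub>T\<^esub>m\<in>{..<?N}. ?u (Suc m)) = ?S" by (intro T.M.finsum_cyclic_shift uc)
  have zs: "z \<otimes> z [^] (m::nat) = z [^] Suc m" for m using z by (metis nat_pow_Suc2)
  have "single 1 z \<odot>\<^bsub>T\<^esub> ?S = (\<Oplus>\<^bsub>T\<^esub>m\<in>{..<?N}. single 1 z \<odot>\<^bsub>T\<^esub> ?u m)"
    using x z by (intro T.smult_finsum) auto
  also have "\<dots> = (\<Oplus>\<^bsub>T\<^esub>m\<in>{..<?N}. sc r (?u (Suc m)))"
    using x z eigen_root_nonzero
    by (intro T.M.finsum_cong')
      (auto simp: single_smult_single zs mult.assoc[symmetric] simp del: nat_pow_Suc)
  also have "\<dots> = sc r (\<Oplus>\<^bsub>T\<^esub>m\<in>{..<?N}. ?u (Suc m))"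
    by (rule T.smult_finsum[symmetric], simp, rule Pi_I, rule uc)
  finally have "single 1 z \<odot>\<^bsub>T\<^esub> ?S = sc r ?S" unfolding eq .
  then have "sc (inverse (of_nat ?N)) (single 1 z \<odot>\<^bsub>T\<^esub> ?S) = sc (inverse (of_nat ?N)) (sc r ?S)" by simp
  then show ?thesis using S z by (simp add: eigenproj_def single_smult_single mult.commute)
qed

lemma eigenproj_fix:
  assumes x: "x \<in> carrier T" "single 1 z \<odot>\<^bsub>T\<^esub> x = sc r x"
  shows "eigenproj z r x = x"
proof -
  have "single (inverse r ^ m) (z [^] m) \<odot>\<^bsub>T\<^esub> x = x" for m :: nat
    using x z eigen_root_nonzero single_eq_sc[of "z [^] m" x "inverse r ^ m"] eigen_pow[OF z x, of m]
    by (simp add: sc_sc power_mult_distrib[symmetric])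
  then have "(\<Oplus>\<^bsub>T\<^esub>m\<in>{..<order G}. single (inverse r ^ m) (z [^] m) \<odot>\<^bsub>T\<^esub> x) = sc (of_nat (order G)) x"
    using x(1) by (simp add: sum_const)
  then show ?thesis using x(1) char by (simp add: eigenproj_def sc_sc)
qed

text \<open>The projected vector is an \<open>r\<close>-eigenvector by construction and an
  \<open>s\<close>-eigenvector because the projection is equivariant; hence it is zero.\<close>

lemma eigenproj_other:
  assumes x: "x \<in> carrier T" "single 1 z \<odot>\<^bsub>T\<^esub> x = sc s x" "s \<noteq> r"
  shows "eigenproj z r x = \<zero>\<^bsub>T\<^esub>"
proof -
  let ?e = "eigenproj z r x"
  have e: "?e \<in> carrier T" by (rule eigenproj_closed[OF x(1)])
  note h = left_module_homD(3)[OF eigenproj_hom]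
  have "sc r ?e = single 1 z \<odot>\<^bsub>T\<^esub> ?e" using eigenproj_eigen[OF x(1)] by simp
  also have "\<dots> = eigenproj z r (single 1 z \<odot>\<^bsub>T\<^esub> x)" using h z x(1) by simp
  also have "\<dots> = sc s ?e" using h x by simp
  finally show ?thesis using sc_cancel[OF _ e] x(3) by blast
qed

end

end

section \<open>Twists and towers\<close>

lemma (in group_module) eigenvalue_root:
  assumes "z \<in> carrier G" "x \<in> carrier T" "x \<noteq> \<zero>\<^bsub>T\<^esub>" "single 1 z \<odot>\<^bsub>T\<^esub> x = sc r x"
  shows "r ^ order G = 1"
  using eigen_pow[OF assms(1,2,4), of "order G"] assms sc_cancel[of "r ^ order G" x 1]
  by (simp add: pow_order_eq_1)

lemma (in group_module) eigenproj_mem: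
  assumes "submodule N (monoid_algebra G) T" "x \<in> N" "z \<in> carrier G"
  shows "eigenproj z r x \<in> N"
  unfolding eigenproj_def using assms(2,3)
  by (intro T.submoduleD(4)[OF assms(1)] submodule_finsum[OF T.left_module_axioms assms(1)]) auto

text \<open>The projection is the action of one fixed element of the group algebra, so all
  homomorphisms respect it. This allows it to be computed layer by layer in a tower.\<close>

lemma eigenproj_natural:
  fixes T :: "('g \<Rightarrow> 'k::field, 'm) module" and T' :: "('g \<Rightarrow> 'k, 'l) module"
  assumes "group_module G T" "group_module G T'" "left_module_hom (monoid_algebra G) T T' f"
    and "x \<in> carrier T" "z \<in> carrier G"
  shows "f (group_module.eigenproj G T z r x) = group_module.eigenproj G T' z r (f x)"
proof -
  interpret A: group_module G T by fact
  interpret B: group_module G T' by fact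
  note f = left_module_homD[OF assms(3)]
  let ?t = "\<lambda>m. single (inverse r ^ m) (z [^]\<^bsub>G\<^esub> (m::nat)) \<odot>\<^bsub>T\<^esub> x"
  have "?t \<in> A \<rightarrow> carrier T" for A using assms(4,5) by auto
  moreover from this have "(\<Oplus>\<^bsub>T\<^esub>m\<in>{..<order G}. ?t m) \<in> carrier T" by (rule A.T.M.finsum_closed)
  ultimately show ?thesis unfolding A.eigenproj_def B.eigenproj_def
    using f assms(4,5)
      additive_finsum[OF A.T.M.abelian_group_axioms B.T.M.abelian_group_axioms, of f ?t "{..<order G}"]
    by simp
qed

section \<open>Powers of the character and the twists they define\<close>

context nonnilpotent_group_datum
begin

lemma order_nonzero: "of_nat (order G) \<noteq> (0::'k)"
  using order_gt_0_iff_finite finite_G by simp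

lemma chi_nonzero: "h \<in> carrier G \<Longrightarrow> \<chi> h \<noteq> 0"
  using character by (auto simp: unit_group_def hom_def)

lemma chi_mult: "\<lbrakk>a \<in> carrier G; b \<in> carrier G\<rbrakk> \<Longrightarrow> \<chi> (a \<otimes> b) = \<chi> a * \<chi> b"
  using hom_mult[OF character] by (simp add: unit_group_def)

lemma chi_one: "\<chi> \<one> = 1"
  using chi_mult[of \<one> \<one>] chi_nonzero[of \<one>] by simp

lemma chi_pow: "h \<in> carrier G \<Longrightarrow> \<chi> (h [^] m) = \<chi> h ^ m" for m :: nat
  by (induct m) (simp_all add: chi_one chi_mult)

text \<open>Only the difference of the exponents has to be below n. Exponents up to
  \<open>2 * (k - 1)\<close> occur when the layers of a tower are separated in
  \<open>tower_summand\<close>, so bounding both by n would be too restrictive.\<close>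

lemma chi_g_pow_eqD:
  assumes "\<chi> g ^ a = \<chi> g ^ b" "a \<le> b" "b < a + n" shows "a = b"
proof -
  interpret U: group "unit_group :: 'k monoid"
    by (rule groupI) (auto simp: unit_group_def intro!: bexI[of _ "inverse _"])
  have p: "x [^]\<^bsub>unit_group\<^esub> m = x ^ m" for x :: 'k and m :: nat
    by (induct m) (simp_all add: unit_group_def nat_pow_def)
  have "\<chi> g ^ a * \<chi> g ^ (b - a) = \<chi> g ^ (a + (b - a))" by (rule power_add[symmetric])
  also have "\<dots> = \<chi> g ^ a * 1" using assms(1,2) by simp
  finally have "\<chi> g ^ a * \<chi> g ^ (b - a) = \<chi> g ^ a * 1" .
  then have "\<chi> g ^ (b - a) = 1" using chi_nonzero[OF g_closed] by simp
  then have "n dvd b - a"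
    using U.pow_eq_id[of "\<chi> g" "b - a"] chi_nonzero[OF g_closed] p n_eq_ord by (simp add: unit_group_def)
  then show ?thesis using assms(2,3) by (auto dest: dvd_imp_le)
qed

lemma inverse_chi_g_pow_eqD:
  assumes "inverse (\<chi> g) ^ a = inverse (\<chi> g) ^ b" "a < n" "b < n" shows "a = b"
  using assms chi_g_pow_eqD[of a b] chi_g_pow_eqD[of b a]
  by (cases "a \<le> b") (auto simp: power_inverse)

lemma g_pow_central: "h \<in> carrier G \<Longrightarrow> g [^] m \<otimes> h = h \<otimes> g [^] m" for m :: nat
  by (induct m) (use g_closed g_central in \<open>simp_all add: m_assoc, simp add: m_assoc[symmetric]\<close>)

text \<open>The tensor product of V with \<open>\<chi>^(-s)\<close>, realised on the carrier of V.
  It is the module structure of the layer \<open>x^s V\<close>.\<close>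

definition twist :: "nat \<Rightarrow> ('g \<Rightarrow> 'k, 'v) module \<Rightarrow> ('g \<Rightarrow> 'k, 'v) module" where
  "twist s V = restrict_scalars (\<lambda>a h. a h * inverse (\<chi> h) ^ s) V"

lemma twist_simps [simp]:
  "carrier (twist s V) = carrier V" "\<zero>\<^bsub>twist s V\<^esub> = \<zero>\<^bsub>V\<^esub>" "add (twist s V) = add V"
  by (simp_all add: twist_def)

lemma twist_single: "(\<lambda>h'. single c h h' * inverse (\<chi> h') ^ s) = single (c * inverse (\<chi> h) ^ s) h"
  by (auto simp: single_def)

lemma twist_smult_single [simp]:
  "single c h \<odot>\<^bsub>twist s V\<^esub> v = single (c * inverse (\<chi> h) ^ s) h \<odot>\<^bsub>V\<^esub> v"
  by (simp add: twist_def twist_single)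

lemma twist_smult: "a \<odot>\<^bsub>twist s V\<^esub> v = (\<lambda>h. a h * inverse (\<chi> h) ^ s) \<odot>\<^bsub>V\<^esub> v"
  by (simp add: twist_def)

lemma twist_hom: "(\<lambda>a h. a h * inverse (\<chi> h) ^ s) \<in> ring_hom kG kG"
proof (rule ring_hom_monoid_algebraI[OF is_monoid ring_kG])
  fix a :: "'g \<Rightarrow> 'k" assume "a \<in> carrier kG"
  then have a: "finite {h. a h \<noteq> 0}" "{h. a h \<noteq> 0} \<subseteq> carrier G" by (auto simp: monoid_algebra_def)
  have "{h. a h * inverse (\<chi> h) ^ s \<noteq> 0} \<subseteq> {h. a h \<noteq> 0}" by auto
  then show "(\<lambda>h. a h * inverse (\<chi> h) ^ s) \<in> carrier kG"
    using a finite_subset by (auto simp: monoid_algebra_def)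
next
  fix c d :: 'k and x y assume "x \<in> carrier G" "y \<in> carrier G"
  then show "(\<lambda>h. single (c * d) (x \<otimes> y) h * inverse (\<chi> h) ^ s)
      = (\<lambda>h. single c x h * inverse (\<chi> h) ^ s) \<otimes>\<^bsub>kG\<^esub> (\<lambda>h. single d y h * inverse (\<chi> h) ^ s)"
    by (simp only: twist_single single_mult) (simp add: chi_mult power_mult_distrib mult_ac)
next
  show "(\<lambda>h. single 1 \<one> h * inverse (\<chi> h) ^ s) = \<one>\<^bsub>kG\<^esub>"
    by (simp only: twist_single) (simp add: monoid_algebra_one chi_one)
qed (simp add: monoid_algebra_add algebra_simps fun_eq_iff)

lemma left_module_twist: "left_module kG V \<Longrightarrow> left_module kG (twist s V)"
  unfolding twist_def by (rule left_module_restrict_scalars[OF _ ring_kG twist_hom])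

lemma submodule_twistD:
  assumes "left_module kG V" "submodule N kG (twist s V)"
  shows "submodule N kG V"
proof (rule submodule_monoid_algebraI[OF assms(1)])
  interpret left_module kG "twist s V" by (rule left_module_twist[OF assms(1)])
  note N = submoduleD[OF assms(2), simplified]
  show "N \<subseteq> carrier V" "\<zero>\<^bsub>V\<^esub> \<in> N" "\<And>x y. \<lbrakk>x \<in> N; y \<in> N\<rbrakk> \<Longrightarrow> x \<oplus>\<^bsub>V\<^esub> y \<in> N" by (fact N)+
  fix c h x assume "h \<in> carrier G" "x \<in> N"
  \<comment> \<open>The coefficient \<open>c * \<chi> h ^ s\<close> undoes the twist.\<close>
  then show "single c h \<odot>\<^bsub>V\<^esub> x \<in> N"
    using N(4)[of "single (c * \<chi> h ^ s) h" x] chi_nonzero[of h]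
    by (simp add: mult.assoc power_mult_distrib[symmetric])
qed

lemma simple_module_twist:
  assumes "simple_module kG V" shows "simple_module kG (twist s V)"
proof -
  have V: "left_module kG V" using assms by (simp add: simple_module_def)
  show ?thesis using assms left_module_twist[OF V, of s] submodule_twistD[OF V, of _ s]
    unfolding simple_module_def by simp
qed

lemma left_module_hom_twist:
  assumes "left_module_hom kG V W f" shows "left_module_hom kG (twist s V) (twist s W) f"
  using left_module_homD[OF assms] ring_hom_closed[OF twist_hom]
  by (intro left_module_homI) (simp_all add: twist_smult)

lemma group_moduleI: "left_module kG V \<Longrightarrow> group_module G V"
  by (simp add: group_module_def group_module_axioms_def group_axioms finite_G)

lemma simple_moduleD:
  assumes "simple_module kG V"
  shows "left_module kG V" "group_module G V" "\<exists>v\<in>carrier V. v \<noteq> \<zero>\<^bsub>V\<^esub>"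
proof -
  show V: "left_module kG V" using assms by (simp add: simple_module_def)
  show "group_module G V" by (rule group_moduleI[OF V])
  interpret left_module kG V by (rule V)
  show "\<exists>v\<in>carrier V. v \<noteq> \<zero>\<^bsub>V\<^esub>" using assms M.zero_closed by (auto simp: simple_module_def)
qed

lemma tower_simps [simp]:
  "carrier (tower G \<chi> k V) = (\<Pi>\<^sub>E s\<in>{..<k}. carrier V)"
  "\<zero>\<^bsub>tower G \<chi> k V\<^esub> = (\<lambda>s\<in>{..<k}. \<zero>\<^bsub>V\<^esub>)"
  "f \<oplus>\<^bsub>tower G \<chi> k V\<^esub> f' = (\<lambda>s\<in>{..<k}. f s \<oplus>\<^bsub>V\<^esub> f' s)"
  "a \<odot>\<^bsub>tower G \<chi> k V\<^esub> f = (\<lambda>s\<in>{..<k}. a \<odot>\<^bsub>twist s V\<^esub> f s)"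
  by (simp_all add: tower_def twist_smult)

lemma left_module_tower:
  assumes "left_module kG V" shows "left_module kG (tower G \<chi> k V)"
proof -
  interpret V: left_module kG V by fact
  have tw: "left_module kG (twist s V)" for s by (rule left_module_twist[OF assms])
  note D = left_module.smult_closed[OF tw, simplified] left_module.smult_l_distr[OF tw, simplified]
    left_module.smult_r_distr[OF tw, simplified] left_module.smult_assoc[OF tw, simplified]
    left_module.smult_one[OF tw, simplified]
  have "abelian_group (tower G \<chi> k V)"
  proof (rule abelian_groupI)
    fix f assume "f \<in> carrier (tower G \<chi> k V)"
    then have f: "f s \<in> carrier V" if "s < k" for s using that by (auto simp: PiE_iff)
    then show "\<exists>f'\<in>carrier (tower G \<chi> k V). f' \<oplus>\<^bsub>tower G \<chi> k V\<^esub> f = \<zero>\<^bsub>tower G \<chi> k V\<^esub>"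
      by (intro bexI[of _ "\<lambda>s\<in>{..<k}. \<ominus>\<^bsub>V\<^esub> f s"]) (auto simp: V.M.l_neg intro!: restrict_ext)
  qed (auto simp: PiE_iff V.M.a_ac intro!: extensionalityI[where A = "{..<k}"])
  then show ?thesis
    by (auto simp: left_module_def left_module_axioms_def ring_kG PiE_iff D intro!: restrict_ext
        extensionalityI[where A = "{..<k}"])
qed

text \<open>The element \<open>x^s v\<close> of a tower of height \<open>k\<close>.\<close>

definition monomial :: "('g \<Rightarrow> 'k, 'v) module \<Rightarrow> nat \<Rightarrow> nat \<Rightarrow> 'v \<Rightarrow> (nat \<Rightarrow> 'v)" where
  "monomial V k s v = (\<lambda>t\<in>{..<k}. if t = s then v else \<zero>\<^bsub>V\<^esub>)"

end

text \<open>One locale for both families: \<open>y^k\<close> acts as \<mu> and \<open>g^n\<close> as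
  \<open>lam\<close>. The first alternative of \<open>cond\<close> gives the modules
  \<open>P_module\<close>, the second the modules \<open>M_module\<close>; for \<open>k = n\<close>
  and \<open>lam = 1\<close> the two agree.\<close>

locale tower_module = nonnilpotent_group_datum G \<chi> g n
  for G :: "'g monoid" (structure) and \<chi> :: "'g \<Rightarrow> 'k::{alg_closed_field, field_char_0}" and g n +
  fixes V :: "('g \<Rightarrow> 'k, 'v) module" and k :: nat and \<mu> lam :: 'k
  assumes simple: "simple_module kG V"
    and k_pos: "k > 0" and k_le: "k \<le> n"
    and lam: "v \<in> carrier V \<Longrightarrow> single 1 (g [^] n) \<odot>\<^bsub>V\<^esub> v = single lam \<one> \<odot>\<^bsub>V\<^esub> v"
    and cond: "k = n \<and> \<mu> = lam - 1 \<or> \<mu> = 0 \<and> lam = 1"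
begin

sublocale V: group_module G V by (rule simple_moduleD(2)[OF simple])

abbreviation "TV \<equiv> tower G \<chi> k V"
abbreviation "shift \<equiv> tower_shift G k V \<mu>"

lemma group_module_TV: "group_module G TV"
  by (rule group_moduleI[OF left_module_tower[OF V.T.left_module_axioms]])

lemma TV_closed: "\<lbrakk>f \<in> carrier TV; s < k\<rbrakk> \<Longrightarrow> f s \<in> carrier V"
  by (auto simp: PiE_iff)

lemma TV_eqI: "\<lbrakk>f \<in> carrier TV; f' \<in> carrier TV; \<And>s. s < k \<Longrightarrow> f s = f' s\<rbrakk> \<Longrightarrow> f = f'"
  by (auto simp: PiE_iff intro!: extensionalityI[where A = "{..<k}"])

lemma shift_closed: "f \<in> carrier TV \<Longrightarrow> shift f \<in> carrier TV"
  using k_pos by (auto simp: tower_shift_def PiE_iff group_algebra_scalar_def)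

lemma shift_apply: "s < k \<Longrightarrow> shift f s = (if s = 0 then V.sc \<mu> (f (k - 1)) else f (s - 1))"
  by (simp add: tower_shift_def group_algebra_scalar_def)

lemma shift_pow_closed: "f \<in> carrier TV \<Longrightarrow> (shift ^^ m) f \<in> carrier TV"
  by (induct m) (auto simp: shift_closed simp del: tower_simps)

text \<open>Since \<open>m \<le> k\<close>, a component wraps around at most once and picks up at
  most one factor \<mu>.\<close>

lemma shift_pow:
  assumes f: "f \<in> carrier TV" and "m \<le> k" "s < k"
  shows "(shift ^^ m) f s = (if m \<le> s then f (s - m) else V.sc \<mu> (f (k + s - m)))"
  using assms(2,3)
proof (induct m arbitrary: s)
  case (Suc m)
  show ?case
  proof (cases "s = 0")
    case True
    have "m \<le> k - 1" "k - 1 < k" using Suc(2) k_pos by auto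
    then have "(shift ^^ m) f (k - 1) = f (k - 1 - m)" using Suc(1)[of "k - 1"] Suc(2) by simp
    then show ?thesis using True k_pos by (simp add: shift_apply)
  next
    case False
    have "Suc m \<le> s \<longleftrightarrow> m \<le> s - 1" "k + (s - 1) - m = k + s - Suc m" using False by auto
    moreover have "(shift ^^ Suc m) f s = (shift ^^ m) f (s - 1)"
      using False Suc(3) by (simp add: shift_apply)
    ultimately show ?thesis using Suc(1)[of "s - 1"] Suc(2,3) by simp
  qed
qed simp

lemma shift_pow_k:
  assumes f: "f \<in> carrier TV" shows "(shift ^^ k) f = single \<mu> \<one> \<odot>\<^bsub>TV\<^esub> f"
proof (rule TV_eqI)
  interpret T: group_module G TV by (rule group_module_TV)
  show "single \<mu> \<one> \<odot>\<^bsub>TV\<^esub> f \<in> carrier TV" by (rule T.single_smult_closed[OF one_closed f])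
  show "(shift ^^ k) f s = (single \<mu> \<one> \<odot>\<^bsub>TV\<^esub> f) s" if "s < k" for s
    using that shift_pow[OF f order_refl that] by (simp add: chi_one)
qed (rule shift_pow_closed[OF f])

lemma y_module_TV: "y_module G \<chi> g n TV shift"
proof (intro y_module.intro group_module_TV y_module_axioms.intro nonnilpotent_group_datum_axioms)
  interpret T: group_module G TV by (rule group_module_TV)
  fix f assume f: "f \<in> carrier TV"
  note fc = TV_closed[OF f]
  show "shift f \<in> carrier TV" by (rule shift_closed[OF f])
  show "shift (f \<oplus>\<^bsub>TV\<^esub> f') = shift f \<oplus>\<^bsub>TV\<^esub> shift f'" if f': "f' \<in> carrier TV" for f'
    using fc TV_closed[OF f'] k_pos
    by (auto simp: tower_shift_def group_algebra_scalar_def V.T.smult_r_distr intro!: restrict_ext)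
  show "shift (single c \<one> \<odot>\<^bsub>TV\<^esub> f) = single c \<one> \<odot>\<^bsub>TV\<^esub> shift f" for c
    using fc k_pos
    by (auto simp: tower_shift_def group_algebra_scalar_def chi_one V.single_smult_single mult.commute
        intro!: restrict_ext)
  show "shift (single 1 h \<odot>\<^bsub>TV\<^esub> f) = single (\<chi> h) h \<odot>\<^bsub>TV\<^esub> shift f" if h: "h \<in> carrier G" for h
  proof (rule TV_eqI)
    show "shift (single 1 h \<odot>\<^bsub>TV\<^esub> f) \<in> carrier TV" by (intro shift_closed T.single_smult_closed h f)
    show "single (\<chi> h) h \<odot>\<^bsub>TV\<^esub> shift f \<in> carrier TV" by (intro shift_closed T.single_smult_closed h f)
    fix s assume s: "s < k"
    show "shift (single 1 h \<odot>\<^bsub>TV\<^esub> f) s = (single (\<chi> h) h \<odot>\<^bsub>TV\<^esub> shift f) s"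
    proof (cases "s = 0")
      case True
      \<comment> \<open>At the wrap from layer \<open>k - 1\<close> to layer 0 the factor
        \<open>\<chi>^(-(k-1))\<close> must equal \<open>\<chi>\<close>. This is where a nonzero
        \<mu> forces \<open>k = n\<close>, together with \<open>\<chi>^n = 1\<close>.\<close>
      have e: "\<mu> * inverse (\<chi> h) ^ (k - 1) = \<chi> h * \<mu>"
      proof (cases "\<mu> = 0")
        case False
        then have "k = n" using cond by auto
        then have "inverse (\<chi> h) ^ (k - 1) * inverse (\<chi> h) = 1"
          using character_pow_n[OF h] k_pos power_Suc2[of "inverse (\<chi> h)" "k - 1"]
          by (simp add: power_inverse)
        then show ?thesis using chi_nonzero[OF h] by (simp add: field_simps)
      qed simp
      have "single (\<mu> * inverse (\<chi> h) ^ (k - 1)) h \<odot>\<^bsub>V\<^esub> f (k - 1) = single (\<chi> h * \<mu>) h \<odot>\<^bsub>V\<^esub> f (k - 1)"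
        by (simp only: e)
      then show ?thesis using True s fc[of "k - 1"] h k_pos
        by (simp add: shift_apply V.single_smult_single)
    next
      case False
      have "inverse (\<chi> h) ^ (s - 1) = \<chi> h * inverse (\<chi> h) ^ s"
        using False chi_nonzero[OF h] by (cases s) auto
      moreover have "s - 1 < k" using s by simp
      ultimately show ?thesis using False s by (simp add: shift_apply)
    qed
  qed
  \<comment> \<open>The twist of a layer is invisible to \<open>g^n\<close>, because
    \<open>\<chi>(g)^n = 1\<close>; so the same scalar acts on all layers.\<close>
  have gn: "(single 1 (g [^] n) \<odot>\<^bsub>TV\<^esub> f) s = V.sc lam (f s)" if "s < k" for s
    using that fc lam by (simp add: chi_pow[OF g_closed] character_pow_n[OF g_closed])
  have "single 1 (g [^] n) \<odot>\<^bsub>TV\<^esub> f \<ominus>\<^bsub>TV\<^esub> f = (shift ^^ n) f"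
  proof (rule T.T.M.minus_eqI[OF _ f shift_pow_closed[OF f]], rule TV_eqI)
    show "single 1 (g [^] n) \<odot>\<^bsub>TV\<^esub> f \<in> carrier TV"
      by (intro T.single_smult_closed f nat_pow_closed g_closed)
    show "(shift ^^ n) f \<oplus>\<^bsub>TV\<^esub> f \<in> carrier TV" by (intro T.T.M.a_closed shift_pow_closed f)
    fix s assume s: "s < k"
    from cond show "((shift ^^ n) f \<oplus>\<^bsub>TV\<^esub> f) s = (single 1 (g [^] n) \<odot>\<^bsub>TV\<^esub> f) s"
    proof
      assume c: "k = n \<and> \<mu> = lam - 1"
      then have "(shift ^^ n) f s = V.sc (lam - 1) (f s)" using shift_pow_k[OF f] s by (simp add: chi_one)
      then show ?thesis unfolding gn[OF s] using s fc[OF s] V.sc_add[of "f s" "lam - 1" 1] by simp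
    next
      assume c: "\<mu> = 0 \<and> lam = 1"
      have z: "shift \<zero>\<^bsub>TV\<^esub> = \<zero>\<^bsub>TV\<^esub>"
        by (auto simp: tower_shift_def group_algebra_scalar_def V.T.smult_r_zero intro!: restrict_ext)
      \<comment> \<open>As \<open>k \<le> n\<close>, the n-th power factors through the k-th, which
        vanishes here.\<close>
      have "(shift ^^ n) f = (shift ^^ (n - k)) ((shift ^^ k) f)"
        using k_le by (simp flip: funpow_add[unfolded comp_def, THEN fun_cong])
      also have "(shift ^^ k) f = \<zero>\<^bsub>TV\<^esub>" using shift_pow_k[OF f] c T.single_0_smult[OF one_closed f] by simp
      also have "(shift ^^ m) \<zero>\<^bsub>TV\<^esub> = \<zero>\<^bsub>TV\<^esub>" for m by (induct m) (simp_all add: z del: tower_simps)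
      finally show ?thesis unfolding gn[OF s] using c s fc[OF s] by simp
    qed
  qed
  then show "(shift ^^ n) f = single 1 (g [^] n) \<odot>\<^bsub>TV\<^esub> f \<ominus>\<^bsub>TV\<^esub> f" ..
qed

end

section \<open>Layers of a tower as eigenspaces of g, indecomposability and finite dimension\<close>

context tower_module
begin

sublocale L: y_module G \<chi> g n TV shift by (rule y_module_TV)

abbreviation "iq \<equiv> inverse (\<chi> g)"
abbreviation "xpow \<equiv> monomial V k"

definition nu :: 'k where
  "nu = (SOME r. \<forall>x\<in>carrier V. single 1 g \<odot>\<^bsub>V\<^esub> x = V.sc r x)"

lemma nu: "x \<in> carrier V \<Longrightarrow> single 1 g \<odot>\<^bsub>V\<^esub> x = V.sc nu x"
  using someI_ex[OF schur_central[OF V.group_module_axioms simple g_closed g_central]]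
  unfolding nu_def by blast

lemma twist_eigen: "x \<in> carrier V \<Longrightarrow> single 1 g \<odot>\<^bsub>twist s V\<^esub> x = single (nu * iq ^ s) \<one> \<odot>\<^bsub>twist s V\<^esub> x"
  using nu[of x] V.single_eq_sc[OF g_closed, of x "iq ^ s"]
  by (simp add: g_closed chi_one V.sc_sc mult.commute)

lemma group_module_twist: "group_module G (twist s V)"
  by (rule group_moduleI[OF left_module_twist[OF V.T.left_module_axioms]])

lemma nu_root: "(nu * iq ^ s) ^ order G = 1"
proof -
  interpret W: group_module G "twist s V" by (rule group_module_twist)
  obtain v where v: "v \<in> carrier V" "v \<noteq> \<zero>\<^bsub>V\<^esub>" using simple_moduleD(3)[OF simple] by blast
  show ?thesis by (rule W.eigenvalue_root[OF g_closed _ _ twist_eigen[OF v(1)]]) (use v in auto)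
qed

lemma nu_nonzero: "nu \<noteq> 0"
  using nu_root[of 0] order_nonzero by (auto simp: zero_power)

lemma iq_pow_eqD: "\<lbrakk>nu * iq ^ s = nu * iq ^ t; s < k; t < k\<rbrakk> \<Longrightarrow> s = t"
  using nu_nonzero inverse_chi_g_pow_eqD[of s t] k_le by auto

lemma component_hom: "s < k \<Longrightarrow> left_module_hom kG TV (twist s V) (\<lambda>f. f s)"
  by (rule left_module_homI) (auto simp: PiE_iff)

lemma monomial_closed: "v \<in> carrier V \<Longrightarrow> xpow s v \<in> carrier TV"
  by (auto simp: monomial_def)

lemma monomial_apply: "t < k \<Longrightarrow> xpow s v t = (if t = s then v else \<zero>\<^bsub>V\<^esub>)"
  by (simp add: monomial_def)

text \<open>Componentwise the projection is the identity on layer \<open>s\<close> and zero on the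
  others, as g acts there by different scalars. Being an action of the group algebra, it shows that
  a submodule contains the homogeneous components of its elements.\<close>

lemma eigenproj_component:
  assumes f: "f \<in> carrier TV" and s: "s < k"
  shows "L.eigenproj g (nu * iq ^ s) f = xpow s (f s)"
proof (rule TV_eqI)
  note e = order_nonzero g_closed g_central nu_root[of s]
  show "L.eigenproj g (nu * iq ^ s) f \<in> carrier TV" by (rule L.eigenproj_closed[OF e f])
  show "xpow s (f s) \<in> carrier TV" by (rule monomial_closed[OF TV_closed[OF f s]])
  fix t assume t: "t < k"
  interpret W: group_module G "twist t V" by (rule group_module_twist)
  have ft: "f t \<in> carrier V" by (rule TV_closed[OF f t])
  have "L.eigenproj g (nu * iq ^ s) f t = W.eigenproj g (nu * iq ^ s) (f t)"
    by (rule eigenproj_natural[OF group_module_TV W.group_module_axioms component_hom[OF t] f g_closed])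
  also have "\<dots> = xpow s (f s) t"
  proof (cases "t = s")
    case True
    then show ?thesis using W.eigenproj_fix[OF e, of "f t"] twist_eigen[OF ft] ft s
      by (simp add: monomial_apply)
  next
    case False
    then have "nu * iq ^ t \<noteq> nu * iq ^ s" using iq_pow_eqD s t by blast
    then show ?thesis using W.eigenproj_other[OF e, of "f t" "nu * iq ^ t"] twist_eigen[OF ft] ft False t
      by (simp add: monomial_apply)
  qed
  finally show "L.eigenproj g (nu * iq ^ s) f t = xpow s (f s) t" .
qed

lemma shift_pow_monomial:
  assumes v: "v \<in> carrier V" and "s + m < k"
  shows "(shift ^^ m) (xpow s v) = xpow (s + m) v"
proof (rule TV_eqI)
  fix t assume t: "t < k"
  have "\<not> m \<le> t \<Longrightarrow> k + t - m < k \<and> k + t - m \<noteq> s" using assms(2) by auto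
  moreover have "m \<le> t \<Longrightarrow> t - m = s \<longleftrightarrow> t = s + m" by auto
  ultimately show "(shift ^^ m) (xpow s v) t = xpow (s + m) v t"
    using shift_pow[OF monomial_closed[OF v, of s], of m t] assms(2) t
    by (auto simp: monomial_apply V.T.smult_r_zero)
qed (intro shift_pow_closed monomial_closed v)+

lemma monomial_eq_zeroD: "\<lbrakk>xpow s v = \<zero>\<^bsub>TV\<^esub>; s < k\<rbrakk> \<Longrightarrow> v = \<zero>\<^bsub>V\<^esub>"
  using monomial_apply[of s s v] by simp

lemma monomial_hom: "s < k \<Longrightarrow> left_module_hom kG (twist s V) TV (xpow s)"
proof (rule left_module_homI)
  fix a x assume s: "s < k" and a: "a \<in> carrier kG" and x: "x \<in> carrier (twist s V)"
  have z: "a \<odot>\<^bsub>twist t V\<^esub> \<zero>\<^bsub>V\<^esub> = \<zero>\<^bsub>V\<^esub>" for t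
    using left_module.smult_r_zero[OF left_module_twist[OF V.T.left_module_axioms] a, of t] by simp
  show "xpow s (a \<odot>\<^bsub>twist s V\<^esub> x) = a \<odot>\<^bsub>TV\<^esub> xpow s x"
    by (auto simp: monomial_def z intro!: restrict_ext)
qed (auto simp: monomial_def intro!: restrict_ext)

text \<open>Isolate a nonzero component of an element of \<open>N\<close> and push it to the top
  layer with a power of y. The vectors whose top copy lies in \<open>N\<close> then form a nonzero
  submodule of the simple module V.\<close>

lemma top_in_submodule:
  assumes N: "submodule N H L.HT" "N \<noteq> {\<zero>\<^bsub>TV\<^esub>}" and v: "v \<in> carrier V"
  shows "xpow (k - 1) v \<in> N"
proof -
  note sN = L.H_submoduleD[OF N(1)]
  note D = L.T.submoduleD[OF sN(1)]
  obtain f where f: "f \<in> N" "f \<noteq> \<zero>\<^bsub>TV\<^esub>" using N(2) D(2) by blast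
  have fc: "f \<in> carrier TV" using f(1) D(1) by blast
  obtain s where s: "s < k" "f s \<noteq> \<zero>\<^bsub>V\<^esub>"
    using TV_eqI[OF fc L.T.M.zero_closed] f(2) by auto
  have "xpow s (f s) \<in> N"
    using L.eigenproj_mem[OF sN(1) f(1) g_closed, of "nu * iq ^ s"] eigenproj_component[OF fc s(1)] by simp
  moreover have pow: "(shift ^^ m) x \<in> N" if "x \<in> N" for x m using that sN(2) by (induct m) auto
  moreover have "s + (k - 1 - s) = k - 1" using s(1) by simp
  ultimately have top: "xpow (k - 1) (f s) \<in> N"
    using shift_pow_monomial[OF TV_closed[OF fc s(1)], of s "k - 1 - s"] k_pos by (metis diff_less zero_less_one)
  let ?W = "{v \<in> carrier V. xpow (k - 1) v \<in> N}"
  note h = left_module_homD[OF monomial_hom[of "k - 1"], simplified twist_simps]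
  have kk: "k - 1 < k" using k_pos by simp
  interpret W: left_module kG "twist (k - 1) V" by (rule left_module_twist[OF V.T.left_module_axioms])
  have "submodule ?W kG (twist (k - 1) V)"
  proof (rule W.submoduleI)
    have "xpow (k - 1) \<zero>\<^bsub>V\<^esub> = \<zero>\<^bsub>TV\<^esub>" by (auto simp: monomial_def)
    then show "\<zero>\<^bsub>twist (k - 1) V\<^esub> \<in> ?W" using D(2) by simp
    fix a x assume "a \<in> carrier kG" "x \<in> ?W"
    then show "a \<odot>\<^bsub>twist (k - 1) V\<^esub> x \<in> ?W" using h(3)[OF kk, of a x] D(4)[of a "xpow (k - 1) x"] W.smult_closed[of a x]
      by (simp del: tower_simps)
  qed (use h(2)[OF kk] D(3) in \<open>auto simp del: tower_simps\<close>)
  then have "submodule ?W kG V" by (rule submodule_twistD[OF V.T.left_module_axioms])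
  then have "?W = {\<zero>\<^bsub>V\<^esub>} \<or> ?W = carrier V" using simple by (simp add: simple_module_def)
  moreover have "f s \<in> ?W" using top TV_closed[OF fc s(1)] by simp
  ultimately have "?W = carrier V" using s(2) by blast
  then show ?thesis using v by blast
qed

lemma zero_not_carrier: "carrier TV \<noteq> {\<zero>\<^bsub>TV\<^esub>}"
proof
  assume *: "carrier TV = {\<zero>\<^bsub>TV\<^esub>}"
  obtain v where v: "v \<in> carrier V" "v \<noteq> \<zero>\<^bsub>V\<^esub>" using simple_moduleD(3)[OF simple] by blast
  have "xpow 0 v = \<zero>\<^bsub>TV\<^esub>" using monomial_closed[OF v(1), of 0] by (simp only: * singleton_iff)
  then have "v = \<zero>\<^bsub>V\<^esub>" using k_pos by (rule monomial_eq_zeroD)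
  then show False using v(2) by simp
qed

theorem indecomposable_tower: "indecomposable_module H L.HT"
  unfolding indecomposable_module_def
proof (intro conjI allI impI)
  show "left_module H L.HT" by (rule L.left_module_H_module)
  show "carrier L.HT \<noteq> {\<zero>\<^bsub>L.HT\<^esub>}" using zero_not_carrier by (simp del: tower_simps)
  fix N N' assume *: "submodule N H L.HT \<and> submodule N' H L.HT \<and> N \<inter> N' = {\<zero>\<^bsub>L.HT\<^esub>} \<and> N <+>\<^bsub>L.HT\<^esub> N' = carrier L.HT"
  obtain v where v: "v \<in> carrier V" "v \<noteq> \<zero>\<^bsub>V\<^esub>" using simple_moduleD(3)[OF simple] by blast
  show "N = {\<zero>\<^bsub>L.HT\<^esub>} \<or> N' = {\<zero>\<^bsub>L.HT\<^esub>}"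
  proof (rule ccontr)
    assume "\<not> ?thesis"
    then have N0: "N \<noteq> {\<zero>\<^bsub>TV\<^esub>}" "N' \<noteq> {\<zero>\<^bsub>TV\<^esub>}" by simp_all
    have "xpow (k - 1) v \<in> N" "xpow (k - 1) v \<in> N'"
      using top_in_submodule[OF _ N0(1) v(1)] top_in_submodule[OF _ N0(2) v(1)] * by fast+
    moreover have "N \<inter> N' = {\<zero>\<^bsub>TV\<^esub>}" using * by simp
    ultimately have "xpow (k - 1) v = \<zero>\<^bsub>TV\<^esub>" by blast
    moreover have "k - 1 < k" using k_pos by simp
    ultimately have "v = \<zero>\<^bsub>V\<^esub>" by (rule monomial_eq_zeroD)
    then show False using v(2) by simp
  qed
qed

lemma H_scalar_closed: "H_scalar G \<chi> g n c \<in> carrier H"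
  using ring_hom_closed[OF proj_hom, of "single c []"] by (simp add: H_scalar_def proj_def)

lemma H_scalar_add: "H_scalar G \<chi> g n (c + d) = H_scalar G \<chi> g n c \<oplus>\<^bsub>H\<^esub> H_scalar G \<chi> g n d"
proof -
  have "single c [] \<oplus>\<^bsub>FH\<^esub> single d [] = single (c + d) []" by (simp add: H_free_def single_add)
  then show ?thesis using ring_hom_add[OF proj_hom, of "single c []" "single d []"]
    by (simp add: H_scalar_def proj_def)
qed

theorem finite_dim_tower:
  assumes "finite_dim (group_algebra_scalar G) V"
  shows "finite_dim (H_scalar G \<chi> g n) L.HT"
proof -
  obtain B where B: "finite B" "B \<subseteq> carrier V"
    "\<forall>x\<in>carrier V. \<exists>c. x = (\<Oplus>\<^bsub>V\<^esub>b\<in>B. V.sc (c b) b)"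
    using assms by (auto simp: finite_dim_def group_algebra_scalar_def)
  \<comment> \<open>A family indexed by pairs, not a set of vectors: if \<open>b\<close> is zero,
    the vectors \<open>x^s b\<close> coincide for all \<open>s\<close>.\<close>
  let ?I = "{..<k} \<times> B" and ?b = "\<lambda>(s, b). xpow s b"
  have Bc: "b \<in> carrier V" if "b \<in> B" for b using B(2) that by auto
  show ?thesis
  proof (rule finite_dimI[OF L.left_module_H_module H_scalar_closed H_scalar_add])
    show "finite ?I" using B(1) by simp
    show "?b \<in> ?I \<rightarrow> carrier L.HT" using Bc monomial_closed by (auto simp del: tower_simps)
    fix f assume "f \<in> carrier L.HT"
    then have f: "f \<in> carrier TV" by simp
    have "\<forall>s. \<exists>c. s < k \<longrightarrow> f s = (\<Oplus>\<^bsub>V\<^esub>b\<in>B. V.sc (c b) b)" using B(3) TV_closed[OF f] by blast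
    then obtain c where c: "\<And>s. s < k \<Longrightarrow> f s = (\<Oplus>\<^bsub>V\<^esub>b\<in>B. V.sc (c s b) b)" by metis
    let ?d = "\<lambda>(s, b). c s b"
    let ?u = "\<lambda>i. single (?d i) \<one> \<odot>\<^bsub>TV\<^esub> ?b i"
    have uc: "?u i \<in> carrier TV" if "i \<in> ?I" for i
      using that Bc monomial_closed by (auto intro!: L.single_smult_closed simp del: tower_simps)
    have "f = (\<Oplus>\<^bsub>TV\<^esub>i\<in>?I. ?u i)"
    proof (rule TV_eqI[OF f])
      show "(\<Oplus>\<^bsub>TV\<^esub>i\<in>?I. ?u i) \<in> carrier TV" using uc by (intro L.T.M.finsum_closed) auto
      fix t assume t: "t < k"
      have w: "?u (s, b) t = (if s = t then V.sc (c t b) b else \<zero>\<^bsub>V\<^esub>)" for s b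
        using t by (auto simp: monomial_apply chi_one V.T.smult_r_zero)
      have "(\<Oplus>\<^bsub>TV\<^esub>i\<in>?I. ?u i) t = (\<Oplus>\<^bsub>V\<^esub>i\<in>?I. ?u i t)"
        by (rule additive_finsum[OF L.T.M.abelian_group_axioms V.T.M.abelian_group_axioms])
          (use t uc in \<open>auto simp: PiE_iff simp del: tower_simps(4)\<close>)
      \<comment> \<open>Layer \<open>t\<close> sees only the vectors that sit in it.\<close>
      also have "\<dots> = (\<Oplus>\<^bsub>V\<^esub>i\<in>Pair t ` B. ?u i t)"
        by (rule V.T.M.add.finprod_mono_neutral_cong_right)
          (use B(1) t Bc w in \<open>auto simp del: tower_simps\<close>)
      also have "\<dots> = (\<Oplus>\<^bsub>V\<^esub>b\<in>B. ?u (t, b) t)"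
        by (rule V.T.M.finsum_reindex) (use Bc w in \<open>auto simp: inj_on_def simp del: tower_simps\<close>)
      also have "\<dots> = (\<Oplus>\<^bsub>V\<^esub>b\<in>B. V.sc (c t b) b)"
        by (rule V.T.M.finsum_cong'[OF refl]) (use Bc w in \<open>auto simp del: tower_simps\<close>)
      finally show "f t = (\<Oplus>\<^bsub>TV\<^esub>i\<in>?I. ?u i) t" using c[OF t] by simp
    qed
    also have "\<dots> = (\<Oplus>\<^bsub>L.HT\<^esub>i\<in>?I. ?u i)" by (rule finsum_cong_module[symmetric]) simp_all
    also have "\<dots> = (\<Oplus>\<^bsub>L.HT\<^esub>i\<in>?I. H_scalar G \<chi> g n (?d i) \<odot>\<^bsub>L.HT\<^esub> ?b i)"
    proof (rule abelian_monoid.finsum_cong'[OF _ refl])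
      show "abelian_monoid L.HT"
        using left_module_abelian_group[OF L.left_module_H_module] by (rule abelian_group.axioms)
      show "(\<lambda>i. H_scalar G \<chi> g n (?d i) \<odot>\<^bsub>L.HT\<^esub> ?b i) \<in> ?I \<rightarrow> carrier L.HT"
        using Bc monomial_closed uc by (auto simp: L.H_module_scalar simp del: tower_simps)
      show "?u i = H_scalar G \<chi> g n (?d i) \<odot>\<^bsub>L.HT\<^esub> ?b i" if "i \<in> ?I" for i
        using that Bc monomial_closed by (auto simp: L.H_module_scalar simp del: tower_simps)
    qed
    finally show "\<exists>c. f = (\<Oplus>\<^bsub>L.HT\<^esub>i\<in>?I. H_scalar G \<chi> g n (c i) \<odot>\<^bsub>L.HT\<^esub> ?b i)" by blast
  qed
qed

end

section \<open>Splitting off a tower\<close>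

context y_module
begin

lemma y_single: "\<lbrakk>h \<in> carrier G; x \<in> carrier T\<rbrakk> \<Longrightarrow> \<phi> (single c h \<odot>\<^bsub>T\<^esub> x) = single (c * \<chi> h) h \<odot>\<^bsub>T\<^esub> \<phi> x"
  using single_eq_sc[of h x c] y_scalar[of "single 1 h \<odot>\<^bsub>T\<^esub> x" c]
  by (simp add: y_comm y_closed single_smult_single)

lemma y_pow_closed: "x \<in> carrier T \<Longrightarrow> (\<phi> ^^ j) x \<in> carrier T"
  by (induct j) (simp_all add: y_closed)

lemma y_pow_add:
  "\<lbrakk>x \<in> carrier T; x' \<in> carrier T\<rbrakk> \<Longrightarrow> (\<phi> ^^ j) (x \<oplus>\<^bsub>T\<^esub> x') = (\<phi> ^^ j) x \<oplus>\<^bsub>T\<^esub> (\<phi> ^^ j) x'"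
  by (induct j) (simp_all add: y_add y_pow_closed)

lemma y_pow_single:
  "\<lbrakk>h \<in> carrier G; x \<in> carrier T\<rbrakk> \<Longrightarrow>
     (\<phi> ^^ j) (single c h \<odot>\<^bsub>T\<^esub> x) = single (c * \<chi> h ^ j) h \<odot>\<^bsub>T\<^esub> (\<phi> ^^ j) x"
  by (induct j) (simp_all add: y_single y_pow_closed mult_ac)

lemma y_zero: "\<phi> \<zero>\<^bsub>T\<^esub> = \<zero>\<^bsub>T\<^esub>"
  by (rule additive_zero[OF T.M.abelian_group_axioms T.M.abelian_group_axioms]) (auto simp: y_closed y_add)

lemma y_pow_zero: "(\<phi> ^^ j) \<zero>\<^bsub>T\<^esub> = \<zero>\<^bsub>T\<^esub>"
  by (induct j) (simp_all add: y_zero)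

text \<open>Moving \<open>h\<close> across \<open>y^j\<close> costs the factor
  \<open>\<chi>(h)^j\<close>, which the twist by \<open>\<chi>^(-j)\<close> cancels.\<close>

lemma left_module_hom_y_pow:
  assumes "left_module kG V" "left_module_hom kG V T \<theta>"
  shows "left_module_hom kG (twist j V) T (\<lambda>v. (\<phi> ^^ j) (\<theta> v))"
proof (rule left_module_hom_monoid_algebraI[OF left_module_twist[OF assms(1)] T.left_module_axioms])
  note D = left_module_homD[OF assms(2)]
  fix c h x assume h: "h \<in> carrier G" and "x \<in> carrier (twist j V)"
  then have x: "x \<in> carrier V" by simp
  have "inverse (\<chi> h) ^ j * \<chi> h ^ j = 1" using chi_nonzero[OF h] by (simp flip: power_mult_distrib)
  then show "(\<phi> ^^ j) (\<theta> (single c h \<odot>\<^bsub>twist j V\<^esub> x)) = single c h \<odot>\<^bsub>T\<^esub> (\<phi> ^^ j) (\<theta> x)"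
    using h x D by (simp add: y_pow_single mult.assoc)
qed (use left_module_homD[OF assms(2)] in \<open>simp_all add: y_pow_closed y_pow_add\<close>)

end

text \<open>\<open>J\<close> maps the tower into \<open>T\<close> by \<open>x^s v\<close> to
  \<open>y^s (\<theta> v)\<close>, and \<open>\<Psi>\<close> is its retraction, so the composite of
  \<open>J\<close> after \<open>\<Psi>\<close> is the projection of the overview. Both commute with
  y because the assumption \<open>phik\<close> makes the wrap in \<open>T\<close> agree with the
  wrap in the tower.\<close>

theorem (in tower_module) tower_summand:
  assumes Y: "y_module G \<chi> g n T \<phi>" and indec: "indecomposable_module H (H_module G T \<phi>)"
    and th: "left_module_hom kG V T \<theta>"
    and phik: "\<And>x. x \<in> carrier T \<Longrightarrow> (\<phi> ^^ k) x = single \<mu> \<one> \<odot>\<^bsub>T\<^esub> x"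
    and inj: "inj_on (\<lambda>v. (\<phi> ^^ (k - 1)) (\<theta> v)) (carrier V)"
  shows "module_iso H (H_module G T \<phi>) L.HT"
proof -
  interpret Y: y_module G \<chi> g n T \<phi> by fact
  note th' = left_module_homD[OF th]
  let ?j = "\<lambda>v. (\<phi> ^^ (k - 1)) (\<theta> v)"
  let ?K = "k - 1"
  let ?r = "nu * iq ^ ?K"
  note e = order_nonzero g_closed g_central nu_root[of ?K]
  have VV: "left_module kG V" by (rule V.T.left_module_axioms)
  have jh: "left_module_hom kG (twist ?K V) T ?j" by (rule Y.left_module_hom_y_pow[OF VV th])
  interpret W: left_module kG "twist ?K V" by (rule left_module_twist[OF VV])
  define A where "A = ?j ` carrier V"
  have A: "submodule A kG T"
    using W.submodule_image[OF Y.T.left_module_axioms jh W.submodule_carrier] by (simp add: A_def)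
  \<comment> \<open>\<open>B\<close> contains all \<open>\<phi>\<^sup>m (\<theta> V)\<close> with \<open>m \<noteq> k - 1\<close> modulo \<open>n\<close>.\<close>
  define B where "B = {x \<in> carrier T. Y.eigenproj g ?r x = \<zero>\<^bsub>T\<^esub>}"
  have B: "submodule B kG T"
    unfolding B_def by (rule Y.T.submodule_kernel[OF Y.T.left_module_axioms Y.eigenproj_hom[OF e]])
  have eig: "single 1 g \<odot>\<^bsub>T\<^esub> (\<phi> ^^ m) (\<theta> v) = Y.sc (nu * iq ^ m) ((\<phi> ^^ m) (\<theta> v))" if v: "v \<in> carrier V" for v m
    using left_module_homD(3)[OF Y.left_module_hom_y_pow[OF VV th, of m], of "single 1 g" v]
      left_module_homD(3)[OF Y.left_module_hom_y_pow[OF VV th, of m], of "single (nu * iq ^ m) \<one>" v]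
      twist_eigen[OF v, of m] v g_closed by simp
  have pc: "(\<phi> ^^ m) (\<theta> v) \<in> carrier T" if "v \<in> carrier V" for v m
    using that th'(1) by (intro Y.y_pow_closed)
  have AB: "A \<inter> B = {\<zero>\<^bsub>T\<^esub>}"
  proof
    show "A \<inter> B \<subseteq> {\<zero>\<^bsub>T\<^esub>}"
      using Y.eigenproj_fix[OF e pc eig] by (auto simp: A_def B_def)
    show "{\<zero>\<^bsub>T\<^esub>} \<subseteq> A \<inter> B" using Y.T.submoduleD(2)[OF A] Y.T.submoduleD(2)[OF B] by simp
  qed
  have char: "of_nat (card (carrier G)) \<noteq> (0::'k)" using order_nonzero by (simp add: order_def)
  obtain P where P: "left_module_hom kG T T P" "\<forall>x\<in>carrier T. P x \<in> A" "\<forall>a\<in>A. P a = a" "\<forall>b\<in>B. P b = \<zero>\<^bsub>T\<^esub>"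
    using Y.maschke[OF A B AB char] by blast
  let ?TA = "T\<lparr>carrier := A\<rparr>"
  have PA: "left_module_hom kG T ?TA P"
    using left_module_homD[OF P(1)] P(2) by (intro left_module_homI) auto
  have jA: "left_module_hom kG (twist ?K V) ?TA ?j" "bij_betw ?j (carrier (twist ?K V)) (carrier ?TA)"
    using left_module_homD[OF jh] inj by (auto simp: left_module_hom_def A_def bij_betw_def)
  let ?i = "the_inv_into (carrier (twist ?K V)) ?j"
  \<comment> \<open>Projection to the top layer followed by the inverse of
    \<open>y^(k-1) \<theta>\<close>; its values lie in V twisted by
    \<open>\<chi>^(-(k-1))\<close>.\<close>
  define \<rho> where "\<rho> x = ?i (P x)" for x
  have rho: "left_module_hom kG T (twist ?K V) \<rho>"
    unfolding \<rho>_def by (rule left_module_hom_comp[OF PA left_module_hom_inv(1)[OF W.left_module_axioms jA]])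
  note rho' = left_module_homD[OF rho, simplified twist_simps]
  have rho_j: "\<rho> (?j v) = v" if "v \<in> carrier V" for v
    using that P(3) the_inv_into_f_f[OF inj that] by (simp add: \<rho>_def A_def)
  have rho_zero: "\<rho> \<zero>\<^bsub>T\<^esub> = \<zero>\<^bsub>V\<^esub>"
    using additive_zero[OF Y.T.M.abelian_group_axioms W.M.abelian_group_axioms] rho' by auto
  have rho_B: "\<rho> b = \<zero>\<^bsub>V\<^esub>" if "b \<in> B" for b
  proof -
    have "\<rho> b = \<rho> \<zero>\<^bsub>T\<^esub>" using that P(4) Y.T.submoduleD(2)[OF B] by (simp add: \<rho>_def)
    then show ?thesis using rho_zero by simp
  qed
  have rho_other: "\<rho> ((\<phi> ^^ m) (\<theta> v)) = \<zero>\<^bsub>V\<^esub>" if v: "v \<in> carrier V" and m: "nu * iq ^ m \<noteq> ?r" for v m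
    using Y.eigenproj_other[OF e pc[OF v] eig[OF v] m] pc[OF v] by (intro rho_B) (simp add: B_def)
  \<comment> \<open>The power \<open>y^(k-1-s)\<close> lifts layer \<open>s\<close> to the top
    layer, the only one that \<open>\<rho>\<close> sees.\<close>
  define \<Psi> where "\<Psi> x = (\<lambda>s\<in>{..<k}. \<rho> ((\<phi> ^^ (?K - s)) x))" for x
  define J where "J f = (\<Oplus>\<^bsub>T\<^esub>s\<in>{..<k}. (\<phi> ^^ s) (\<theta> (f s)))" for f
  have Psi: "left_module_hom kG T TV \<Psi>"
  proof (rule left_module_hom_monoid_algebraI[OF Y.T.left_module_axioms L.T.left_module_axioms])
    fix x assume x: "x \<in> carrier T"
    show "\<Psi> x \<in> carrier TV" using x by (auto simp: \<Psi>_def rho'(1) Y.y_pow_closed)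
    show "\<Psi> (x \<oplus>\<^bsub>T\<^esub> y) = \<Psi> x \<oplus>\<^bsub>TV\<^esub> \<Psi> y" if "y \<in> carrier T" for y
      using x that by (auto simp: \<Psi>_def rho'(2) Y.y_pow_closed Y.y_pow_add intro!: restrict_ext)
    fix c h assume h: "h \<in> carrier G"
    show "\<Psi> (single c h \<odot>\<^bsub>T\<^esub> x) = single c h \<odot>\<^bsub>TV\<^esub> \<Psi> x"
    proof (rule TV_eqI)
      show "\<Psi> (single c h \<odot>\<^bsub>T\<^esub> x) \<in> carrier TV" using x h by (auto simp: \<Psi>_def rho'(1) Y.y_pow_closed)
      have "\<Psi> x \<in> carrier TV" using x by (auto simp: \<Psi>_def rho'(1) Y.y_pow_closed)
      then show "single c h \<odot>\<^bsub>TV\<^esub> \<Psi> x \<in> carrier TV" using h by (rule L.single_smult_closed[rotated])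
      fix s assume s: "s < k"
      \<comment> \<open>Moving \<open>h\<close> across \<open>y^(K-s)\<close> contributes
        \<open>\<chi>^(K-s)\<close> and \<open>\<rho>\<close> contributes
        \<open>\<chi>^(-K)\<close>. The product is exactly the twist of layer
        \<open>s\<close>.\<close>
      have "\<chi> h ^ (?K - s) * inverse (\<chi> h) ^ ?K = \<chi> h ^ (?K - s) * inverse (\<chi> h) ^ (?K - s + s)" using s by simp
      also have "\<dots> = (\<chi> h * inverse (\<chi> h)) ^ (?K - s) * inverse (\<chi> h) ^ s"
        by (simp only: power_add power_mult_distrib mult.assoc)
      finally have "\<chi> h ^ (?K - s) * inverse (\<chi> h) ^ ?K = inverse (\<chi> h) ^ s" using chi_nonzero[OF h] by simp
      then show "\<Psi> (single c h \<odot>\<^bsub>T\<^esub> x) s = (single c h \<odot>\<^bsub>TV\<^esub> \<Psi> x) s"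
        using s h x rho'(3)[of "single (c * \<chi> h ^ (?K - s)) h" "(\<phi> ^^ (?K - s)) x"]
        by (simp add: \<Psi>_def Y.y_pow_single Y.y_pow_closed mult.assoc)
    qed
  qed
  have Psi_y: "\<Psi> (\<phi> x) = shift (\<Psi> x)" if x: "x \<in> carrier T" for x
  proof (rule TV_eqI)
    show "\<Psi> (\<phi> x) \<in> carrier TV" using x Y.y_closed left_module_homD(1)[OF Psi] by blast
    show "shift (\<Psi> x) \<in> carrier TV" using x left_module_homD(1)[OF Psi] shift_closed by blast
    fix s assume s: "s < k"
    have 1: "\<Psi> (\<phi> x) s = \<rho> ((\<phi> ^^ Suc (?K - s)) x)" using s by (simp add: \<Psi>_def funpow_swap1)
    show "\<Psi> (\<phi> x) s = shift (\<Psi> x) s"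
    proof (cases "s = 0")
      case True
      \<comment> \<open>In the bottom component one more y completes the power \<open>y^k\<close>,
        which is the scalar \<mu>.\<close>
      then have "Suc (?K - s) = k" using k_pos by simp
      then have "\<Psi> (\<phi> x) s = \<rho> (Y.sc \<mu> x)" using 1 phik[OF x] by simp
      also have "\<dots> = V.sc \<mu> (\<rho> x)" using rho'(3)[of "single \<mu> \<one>" x] x by (simp add: chi_one)
      finally show ?thesis using True s by (simp add: shift_apply \<Psi>_def)
    next
      case False
      then have "Suc (?K - s) = ?K - (s - 1)" using s by simp
      moreover have "s - 1 < k" using s by simp
      ultimately show ?thesis using False s 1 by (simp add: shift_apply \<Psi>_def)
    qed
  qed
  have Jt: "(\<lambda>s. (\<phi> ^^ s) (\<theta> (f s))) \<in> {..<k} \<rightarrow> carrier T" if "f \<in> carrier TV" for f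
    using TV_closed[OF that] pc by auto
  have Jc: "J f \<in> carrier T" if "f \<in> carrier TV" for f
    unfolding J_def by (rule Y.T.M.finsum_closed[OF Jt[OF that]])
  have Jh: "left_module_hom kG TV T J"
  proof (rule left_module_hom_monoid_algebraI[OF L.T.left_module_axioms Y.T.left_module_axioms Jc])
    fix f assume f: "f \<in> carrier TV"
    show "J (f \<oplus>\<^bsub>TV\<^esub> f') = J f \<oplus>\<^bsub>T\<^esub> J f'" if f': "f' \<in> carrier TV" for f'
    proof -
      have "J (f \<oplus>\<^bsub>TV\<^esub> f') = (\<Oplus>\<^bsub>T\<^esub>s\<in>{..<k}. (\<phi> ^^ s) (\<theta> (f s)) \<oplus>\<^bsub>T\<^esub> (\<phi> ^^ s) (\<theta> (f' s)))"
        unfolding J_def using TV_closed[OF f] TV_closed[OF f'] pc th'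
        by (intro Y.T.M.finsum_cong') (auto simp: Y.y_pow_add)
      also have "\<dots> = J f \<oplus>\<^bsub>T\<^esub> J f'" unfolding J_def by (rule Y.T.M.finsum_addf[OF Jt[OF f] Jt[OF f']])
      finally show ?thesis .
    qed
    fix c h assume h: "h \<in> carrier G"
    have "J (single c h \<odot>\<^bsub>TV\<^esub> f) = (\<Oplus>\<^bsub>T\<^esub>s\<in>{..<k}. single c h \<odot>\<^bsub>T\<^esub> (\<phi> ^^ s) (\<theta> (f s)))"
      unfolding J_def
    proof (rule Y.T.M.finsum_cong'[OF refl])
      show "(\<lambda>s. single c h \<odot>\<^bsub>T\<^esub> (\<phi> ^^ s) (\<theta> (f s))) \<in> {..<k} \<rightarrow> carrier T"
        using h pc TV_closed[OF f] by (intro Pi_I Y.single_smult_closed) auto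
      fix s assume "s \<in> {..<k}"
      then show "(\<phi> ^^ s) (\<theta> ((single c h \<odot>\<^bsub>TV\<^esub> f) s)) = single c h \<odot>\<^bsub>T\<^esub> (\<phi> ^^ s) (\<theta> (f s))"
        using left_module_homD(3)[OF Y.left_module_hom_y_pow[OF VV th, of s], of "single c h" "f s"]
          TV_closed[OF f] h by simp
    qed
    also have "\<dots> = single c h \<odot>\<^bsub>T\<^esub> J f"
      unfolding J_def by (rule Y.T.smult_finsum[symmetric, OF single_closed[OF h] Jt[OF f]])
    finally show "J (single c h \<odot>\<^bsub>TV\<^esub> f) = single c h \<odot>\<^bsub>T\<^esub> J f" .
  qed
  have J_y: "J (shift f) = \<phi> (J f)" if f: "f \<in> carrier TV" for f
  proof -
    \<comment> \<open>The terms of \<open>J (shift f)\<close> arranged so that the sum can be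
      rotated: \<open>u 0\<close> is the wrapped term and \<open>u k\<close> is the same vector. The
      value zero beyond \<open>k\<close> only keeps \<open>u\<close> inside the carrier.\<close>
    define u where "u s = (if s = 0 then (\<phi> ^^ k) (\<theta> (f ?K)) else if s \<le> k then (\<phi> ^^ s) (\<theta> (f (s - 1))) else \<zero>\<^bsub>T\<^esub>)" for s
    have uc: "u s \<in> carrier T" for s
      using TV_closed[OF f] pc k_pos by (auto simp: u_def)
    have "u k = u 0" using k_pos by (simp add: u_def)
    note cyc = Y.T.M.finsum_cyclic_shift[of u, OF uc this]
    have "\<phi> (J f) = (\<Oplus>\<^bsub>T\<^esub>s\<in>{..<k}. \<phi> ((\<phi> ^^ s) (\<theta> (f s))))" unfolding J_def
      by (rule additive_finsum[OF Y.T.M.abelian_group_axioms Y.T.M.abelian_group_axioms])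
        (use Jt[OF f] in \<open>auto simp: Y.y_closed Y.y_add\<close>)
    also have "\<dots> = (\<Oplus>\<^bsub>T\<^esub>s\<in>{..<k}. u (Suc s))"
      by (rule Y.T.M.finsum_cong'[OF refl], rule Pi_I, rule uc) (simp add: u_def)
    also have "\<dots> = (\<Oplus>\<^bsub>T\<^esub>s\<in>{..<k}. u s)" by (rule cyc)
    also have "\<dots> = J (shift f)" unfolding J_def
    proof (rule Y.T.M.finsum_cong'[OF refl Jt[OF shift_closed[OF f]]])
      fix s assume "s \<in> {..<k}"
      moreover have "f ?K \<in> carrier V" using TV_closed[OF f] k_pos by simp
      ultimately show "u s = (\<phi> ^^ s) (\<theta> (shift f s))"
        using phik[of "\<theta> (f ?K)"] th' by (auto simp: u_def shift_apply)
    qed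
    finally show ?thesis ..
  qed
  have PsiJ: "\<Psi> (J f) = f" if f: "f \<in> carrier TV" for f
  proof (rule TV_eqI[OF _ f])
    show "\<Psi> (J f) \<in> carrier TV" using left_module_homD(1)[OF Psi Jc[OF f]] .
    fix s assume s: "s < k"
    have "(\<phi> ^^ (?K - s)) (J f) = (\<Oplus>\<^bsub>T\<^esub>t\<in>{..<k}. (\<phi> ^^ (?K - s)) ((\<phi> ^^ t) (\<theta> (f t))))" unfolding J_def
      by (rule additive_finsum[OF Y.T.M.abelian_group_axioms Y.T.M.abelian_group_axioms])
        (use Jt[OF f] in \<open>auto simp: Y.y_pow_closed Y.y_pow_add\<close>)
    then have "\<Psi> (J f) s = \<rho> (\<Oplus>\<^bsub>T\<^esub>t\<in>{..<k}. (\<phi> ^^ (?K - s)) ((\<phi> ^^ t) (\<theta> (f t))))" using s by (simp add: \<Psi>_def)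
    also have "\<dots> = (\<Oplus>\<^bsub>V\<^esub>t\<in>{..<k}. \<rho> ((\<phi> ^^ (?K - s)) ((\<phi> ^^ t) (\<theta> (f t)))))"
      by (rule additive_finsum[OF Y.T.M.abelian_group_axioms V.T.M.abelian_group_axioms])
        (use pc TV_closed[OF f] rho'(1,2) in \<open>auto simp: Y.y_pow_closed\<close>)
    also have "\<dots> = (\<Oplus>\<^bsub>V\<^esub>t\<in>{..<k}. if s = t then f t else \<zero>\<^bsub>V\<^esub>)"
    proof (rule V.T.M.finsum_cong'[OF refl])
      show "(\<lambda>t. if s = t then f t else \<zero>\<^bsub>V\<^esub>) \<in> {..<k} \<rightarrow> carrier V" using TV_closed[OF f] by auto
      fix t assume t: "t \<in> {..<k}"
      then have ft: "f t \<in> carrier V" using TV_closed[OF f] by simp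
      have sum: "(\<phi> ^^ (?K - s)) ((\<phi> ^^ t) (\<theta> (f t))) = (\<phi> ^^ (?K - s + t)) (\<theta> (f t))"
        by (simp add: funpow_add)
      show "\<rho> ((\<phi> ^^ (?K - s)) ((\<phi> ^^ t) (\<theta> (f t)))) = (if s = t then f t else \<zero>\<^bsub>V\<^esub>)"
      proof (cases "s = t")
        case True
        then have "?K - s + t = ?K" using s by simp
        then show ?thesis unfolding sum using True rho_j[OF ft] by simp
      next
        case False
        \<comment> \<open>The exponents differ by \<open>t - s\<close>, which is nonzero and smaller
          than \<open>k \<le> n\<close> in absolute value.\<close>
        have "\<chi> g ^ (?K - s + t) \<noteq> \<chi> g ^ ?K"
        proof
          assume eq: "\<chi> g ^ (?K - s + t) = \<chi> g ^ ?K"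
          show False
          proof (cases "s \<le> t")
            case True
            then have "?K \<le> ?K - s + t" "?K - s + t < ?K + n" using s t k_le by auto
            then have "?K = ?K - s + t" using chi_g_pow_eqD[OF eq[symmetric]] by blast
            then show False using False True s by simp
          next
            case le: False
            then have "?K - s + t \<le> ?K" "?K < ?K - s + t + n" using s t k_le by auto
            then have "?K - s + t = ?K" using chi_g_pow_eqD[OF eq] by blast
            then show False using le s by simp
          qed
        qed
        then have "nu * iq ^ (?K - s + t) \<noteq> ?r" using nu_nonzero by (simp add: power_inverse)
        then show ?thesis unfolding sum using rho_other[OF ft] False by simp
      qed
    qed
    also have "\<dots> = f s"
      using V.T.M.finsum_singleton[of s "{..<k}" f] s TV_closed[OF f] by simp
    finally show "\<Psi> (J f) s = f s" .
  qed
  have HJ: "left_module_hom H L.HT (H_module G T \<phi>) J"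
    by (rule H_module_homI[OF y_module_TV Y Jh]) (rule J_y)
  have HP: "left_module_hom H (H_module G T \<phi>) L.HT \<Psi>"
    by (rule H_module_homI[OF Y y_module_TV Psi]) (rule Psi_y)
  have "bij_betw \<Psi> (carrier (H_module G T \<phi>)) (carrier L.HT)"
  proof (rule indecomposable_retract[OF indec L.left_module_H_module _ HJ HP])
    show "carrier L.HT \<noteq> {\<zero>\<^bsub>L.HT\<^esub>}" unfolding L.H_module_simps by (rule zero_not_carrier)
    show "\<Psi> (J f) = f" if "f \<in> carrier L.HT" for f
      using that unfolding L.H_module_simps by (rule PsiJ)
  qed
  then show ?thesis by (rule module_isoI[OF HP])
qed

section \<open>Isomorphisms between towers\<close>

lemma schur_bij:
  assumes "simple_module R M" "simple_module R N" "left_module_hom R M N f"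
    and v: "v \<in> carrier M" "f v \<noteq> \<zero>\<^bsub>N\<^esub>"
  shows "bij_betw f (carrier M) (carrier N)"
proof -
  interpret M: left_module R M using assms(1) by (simp add: simple_module_def)
  interpret N: left_module R N using assms(2) by (simp add: simple_module_def)
  note D = left_module_homD[OF assms(3)]
  let ?K = "{x \<in> carrier M. f x = \<zero>\<^bsub>N\<^esub>}"
  have "submodule ?K R M" by (rule M.submodule_kernel[OF N.left_module_axioms assms(3)])
  then have "?K = {\<zero>\<^bsub>M\<^esub>} \<or> ?K = carrier M" using assms(1) by (simp add: simple_module_def)
  then have K: "?K = {\<zero>\<^bsub>M\<^esub>}" using v by blast
  have "submodule (f ` carrier M) R N"
    by (rule M.submodule_image[OF N.left_module_axioms assms(3) M.submodule_carrier])
  then have "f ` carrier M = {\<zero>\<^bsub>N\<^esub>} \<or> f ` carrier M = carrier N" using assms(2) by (simp add: simple_module_def)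
  then have "f ` carrier M = carrier N" using v by blast
  moreover have "inj_on f (carrier M)"

    by (rule additive_inj_on[OF M.M.abelian_group_axioms N.M.abelian_group_axioms])
      (use D(1,2) K in auto)
  ultimately show ?thesis by (simp add: bij_betw_def)
qed

context nonnilpotent_group_datum
begin

lemma twist_0_smult: "a \<odot>\<^bsub>twist 0 V\<^esub> v = a \<odot>\<^bsub>V\<^esub> v"
  by (simp add: twist_smult)

lemma tower_iso_homD:
  assumes "tower_module G \<chi> g n V k \<mu> lam" "tower_module G \<chi> g n V' k' \<mu>' lam'"
    and "module_iso H (H_module G (tower G \<chi> k V) (tower_shift G k V \<mu>))
           (H_module G (tower G \<chi> k' V') (tower_shift G k' V' \<mu>'))"
  shows "\<exists>F. left_module_hom kG (tower G \<chi> k V) (tower G \<chi> k' V') F \<and>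
    bij_betw F (carrier (tower G \<chi> k V)) (carrier (tower G \<chi> k' V')) \<and>
    (\<forall>f\<in>carrier (tower G \<chi> k V). F (tower_shift G k V \<mu> f) = tower_shift G k' V' \<mu>' (F f))"
proof -
  interpret A: tower_module G \<chi> g n V k \<mu> lam by fact
  interpret B: tower_module G \<chi> g n V' k' \<mu>' lam' by fact
  obtain F where F: "left_module_hom H A.L.HT B.L.HT F" "bij_betw F (carrier A.TV) (carrier B.TV)"
    using assms(3) unfolding module_iso_altdef A.L.H_module_simps B.L.H_module_simps by blast
  have "left_module_hom kG A.TV B.TV F" "\<And>f. f \<in> carrier A.TV \<Longrightarrow> F (A.shift f) = B.shift (F f)"
    by (rule H_module_homD[OF A.y_module_TV B.y_module_TV F(1)],
        rule H_module_homD(2)[OF A.y_module_TV B.y_module_TV F(1)])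
  then show ?thesis using F(2) by blast
qed

text \<open>A nonzero component of the image of a bottom vector gives, by Schur's lemma, an
  isomorphism onto that layer. If \<mu> = 0, the bottom component itself is nonzero, so V and
  \<open>V'\<close> are isomorphic; otherwise any layer may occur and only the twist class is
  determined.\<close>

lemma tower_iso_base:
  assumes A: "tower_module G \<chi> g n V k \<mu> lam" and B: "tower_module G \<chi> g n V' k' \<mu>' lam'"
    and iso: "module_iso H (H_module G (tower G \<chi> k V) (tower_shift G k V \<mu>))
           (H_module G (tower G \<chi> k' V') (tower_shift G k' V' \<mu>'))"
  shows "\<exists>s<k'. module_iso kG V (twist s V') \<and> (\<mu> = 0 \<longrightarrow> s = 0)"
proof -
  interpret A: tower_module G \<chi> g n V k \<mu> lam by fact
  interpret B: tower_module G \<chi> g n V' k' \<mu>' lam' by fact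
  obtain F where F: "left_module_hom kG A.TV B.TV F" "bij_betw F (carrier A.TV) (carrier B.TV)"
    and Fs: "\<And>f. f \<in> carrier A.TV \<Longrightarrow> F (A.shift f) = B.shift (F f)"
    using tower_iso_homD[OF assms] by blast
  note D = left_module_homD[OF F(1)]
  obtain v where v: "v \<in> carrier V" "v \<noteq> \<zero>\<^bsub>V\<^esub>" using simple_moduleD(3)[OF A.simple] by blast
  let ?x = "A.xpow 0 v"
  have xc: "?x \<in> carrier A.TV" by (rule A.monomial_closed[OF v(1)])
  have yc: "F ?x \<in> carrier B.TV" by (rule D(1)[OF xc])
  have F0: "F \<zero>\<^bsub>A.TV\<^esub> = \<zero>\<^bsub>B.TV\<^esub>"
    by (rule additive_zero[OF A.L.T.M.abelian_group_axioms B.L.T.M.abelian_group_axioms])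
      (use D in \<open>auto simp del: tower_simps\<close>)
  have y0: "F ?x \<noteq> \<zero>\<^bsub>B.TV\<^esub>"
  proof
    assume "F ?x = \<zero>\<^bsub>B.TV\<^esub>"
    then have "F ?x = F \<zero>\<^bsub>A.TV\<^esub>" unfolding F0 .
    then have "?x = \<zero>\<^bsub>A.TV\<^esub>" by (rule inj_onD[OF bij_betw_imp_inj_on[OF F(2)] _ xc A.L.T.M.zero_closed])
    then show False using A.monomial_eq_zeroD[of 0 v] A.k_pos v(2) by blast
  qed
  have "\<exists>s<k'. F ?x s \<noteq> \<zero>\<^bsub>V'\<^esub> \<and> (\<mu> = 0 \<longrightarrow> s = 0)"
  proof (cases "\<mu> = 0")
    case True
    \<comment> \<open>Otherwise \<open>F ?x\<close> would be in the range of \<open>y\<close>, and hence so would \<open>?x\<close>.\<close>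
    have "F ?x 0 \<noteq> \<zero>\<^bsub>V'\<^esub>"
    proof
      assume z0: "F ?x 0 = \<zero>\<^bsub>V'\<^esub>"
      \<comment> \<open>A preimage of \<open>F ?x\<close> under y, obtained by lowering all
        components by one layer. The zero in the top component makes the wrapped term vanish,
        matching the vanishing bottom component of \<open>F ?x\<close>.\<close>
      define z where "z = (\<lambda>s\<in>{..<k'}. if Suc s < k' then F ?x (Suc s) else \<zero>\<^bsub>V'\<^esub>)"
      have zc: "z \<in> carrier B.TV" using B.TV_closed[OF yc] by (auto simp: z_def)
      have "B.shift z = F ?x"
      proof (rule B.TV_eqI[OF B.shift_closed[OF zc] yc])
        fix s assume s: "s < k'"
        show "B.shift z s = F ?x s"
        proof (cases "s = 0")
          case True
          then show ?thesis using s z0 B.V.T.smult_r_zero[of "single \<mu>' \<one>"]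
            by (simp add: B.shift_apply z_def)
        next
          case False
          then have "s - 1 < k'" "Suc (s - 1) = s" using s by auto
          then show ?thesis using s False by (simp add: B.shift_apply z_def)
        qed
      qed
      moreover obtain w where w: "w \<in> carrier A.TV" "z = F w"
        using zc bij_betw_imp_surj_on[OF F(2)] by blast
      ultimately have "F (A.shift w) = F ?x" using Fs[OF w(1)] by simp
      then have "A.shift w = ?x"
        using bij_betw_imp_inj_on[OF F(2)] A.shift_closed[OF w(1)] xc by (auto dest: inj_onD simp del: tower_simps)
      then have "?x 0 = A.V.sc \<mu> (w (k - 1))" using A.shift_apply[OF A.k_pos, of w] by simp
      then have "v = \<zero>\<^bsub>V\<^esub>"
        using True A.k_pos A.V.single_0_smult[of \<one> "w (k - 1)"] A.TV_closed[OF w(1), of "k - 1"]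
        by (simp add: A.monomial_apply)
      then show False using v(2) by simp
    qed
    then show ?thesis using B.k_pos by blast
  next
    case False
    then show ?thesis using y0 B.TV_eqI[OF yc B.L.T.M.zero_closed] by auto
  qed
  then obtain s where s: "s < k'" "F ?x s \<noteq> \<zero>\<^bsub>V'\<^esub>" "\<mu> = 0 \<longrightarrow> s = 0" by blast
  have "left_module_hom kG (twist 0 V) (twist s V') (\<lambda>u. F (A.xpow 0 u) s)"
    by (rule left_module_hom_comp[OF left_module_hom_comp[OF A.monomial_hom[OF A.k_pos] F(1)] B.component_hom[OF s(1)]])
  then have h: "left_module_hom kG V (twist s V') (\<lambda>u. F (A.xpow 0 u) s)"
    unfolding left_module_hom_def by (simp add: twist_0_smult)
  have "bij_betw (\<lambda>u. F (A.xpow 0 u) s) (carrier V) (carrier (twist s V'))"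
    by (rule schur_bij[OF A.simple simple_module_twist[OF B.simple] h v(1)]) (use s(2) in simp)
  then show ?thesis using s module_isoI[OF h] by blast
qed

text \<open>\<open>y^k\<close> annihilates the source, but for \<open>k < k'\<close> it moves a
  bottom vector of the target to the nonzero vector \<open>x^k v\<close>. Applied in both
  directions, this compares the heights of two nilpotent towers.\<close>

lemma tower_iso_length:
  assumes A: "tower_module G \<chi> g n V k 0 lam" and B: "tower_module G \<chi> g n V' k' \<mu>' lam'"
    and iso: "module_iso H (H_module G (tower G \<chi> k V) (tower_shift G k V 0))
           (H_module G (tower G \<chi> k' V') (tower_shift G k' V' \<mu>'))"
  shows "k' \<le> k"
proof (rule ccontr)
  assume k: "\<not> k' \<le> k"
  interpret A: tower_module G \<chi> g n V k 0 lam by fact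
  interpret B: tower_module G \<chi> g n V' k' \<mu>' lam' by fact
  obtain F where F: "left_module_hom kG A.TV B.TV F" "bij_betw F (carrier A.TV) (carrier B.TV)"
    and Fs: "\<And>f. f \<in> carrier A.TV \<Longrightarrow> F (A.shift f) = B.shift (F f)"
    using tower_iso_homD[OF assms] by blast
  note D = left_module_homD[OF F(1)]
  obtain v where v: "v \<in> carrier V'" "v \<noteq> \<zero>\<^bsub>V'\<^esub>" using simple_moduleD(3)[OF B.simple] by blast
  obtain f where f: "f \<in> carrier A.TV" "B.xpow 0 v = F f"
    using B.monomial_closed[OF v(1), of 0] bij_betw_imp_surj_on[OF F(2)] by blast
  have pow: "F ((A.shift ^^ m) f) = (B.shift ^^ m) (F f)" for m
    by (induct m) (simp_all add: Fs A.shift_pow_closed[OF f(1)] del: tower_simps)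
  have "B.xpow k v = (B.shift ^^ k) (F f)"
    using B.shift_pow_monomial[OF v(1), of 0 k] k f(2) by simp
  also have "\<dots> = F (single 0 \<one> \<odot>\<^bsub>A.TV\<^esub> f)" using pow[of k] A.shift_pow_k[OF f(1)] by simp
  also have "\<dots> = single 0 \<one> \<odot>\<^bsub>B.TV\<^esub> F f" by (rule D(3)[OF single_closed[OF one_closed] f(1)])
  also have "\<dots> = \<zero>\<^bsub>B.TV\<^esub>" by (rule B.L.single_0_smult[OF one_closed D(1)[OF f(1)]])
  finally have "v = \<zero>\<^bsub>V'\<^esub>" using k by (intro B.monomial_eq_zeroD[of k v]) auto
  then show False using v(2) by simp
qed

section \<open>Simple modules of the group algebra\<close>

lemma (in group_module) smult_expand:
  assumes "a \<in> carrier (monoid_algebra G)" "x \<in> carrier T"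
  shows "a \<odot>\<^bsub>T\<^esub> x = (\<Oplus>\<^bsub>T\<^esub>h\<in>carrier G. single (a h) h \<odot>\<^bsub>T\<^esub> x)"
  using assms(1)
proof (induct a rule: monoid_algebra_induct)
  case zero
  have "(\<Oplus>\<^bsub>T\<^esub>h\<in>carrier G. single 0 h \<odot>\<^bsub>T\<^esub> x) = \<zero>\<^bsub>T\<^esub>"
    by (rule T.M.add.finprod_one_eqI) (simp add: single_0_smult assms(2))
  then show ?case using assms(2) by (simp add: T.smult_l_zero) (simp add: monoid_algebra_zero)
next
  case (single c k)
  have "(\<Oplus>\<^bsub>T\<^esub>h\<in>carrier G. single (single c k h) h \<odot>\<^bsub>T\<^esub> x) = (\<Oplus>\<^bsub>T\<^esub>h\<in>carrier G. if k = h then single c h \<odot>\<^bsub>T\<^esub> x else \<zero>\<^bsub>T\<^esub>)"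
    by (rule T.M.finsum_cong') (use assms(2) in \<open>auto simp: single_def[of c k] single_0_smult\<close>)
  also have "\<dots> = single c k \<odot>\<^bsub>T\<^esub> x"
    using T.M.finsum_singleton[of k "carrier G" "\<lambda>h. single c h \<odot>\<^bsub>T\<^esub> x"] single assms(2) finite_carrier by simp
  finally show ?case ..
next
  case (add a b)
  have "(\<Oplus>\<^bsub>T\<^esub>h\<in>carrier G. single ((a \<oplus>\<^bsub>monoid_algebra G\<^esub> b) h) h \<odot>\<^bsub>T\<^esub> x)
      = (\<Oplus>\<^bsub>T\<^esub>h\<in>carrier G. single (a h) h \<odot>\<^bsub>T\<^esub> x \<oplus>\<^bsub>T\<^esub> single (b h) h \<odot>\<^bsub>T\<^esub> x)"
    by (rule T.M.finsum_cong')
      (use assms(2) in \<open>auto simp: monoid_algebra_add T.smult_l_distr[symmetric] single_add\<close>)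
  also have "\<dots> = a \<odot>\<^bsub>T\<^esub> x \<oplus>\<^bsub>T\<^esub> b \<odot>\<^bsub>T\<^esub> x"
    using assms(2) add by (subst T.M.finsum_addf) auto
  finally show ?case using add assms(2) by (simp add: T.smult_l_distr)
qed

text \<open>A simple module is generated by any nonzero \<open>w\<close>. Choosing for each element
  a coefficient function on the group and enumerating the group gives an injection into functions on
  \<open>nat\<close>; the finitely many vectors \<open>h w\<close> span, which gives the finite
  dimension.\<close>

lemma simple_module_on_functions:
  fixes W :: "('g \<Rightarrow> 'k, 'x) module"
  assumes W: "simple_module kG W"
  shows "\<exists>S :: ('g \<Rightarrow> 'k, nat \<Rightarrow> 'k) module. simple_module kG S \<and>
    finite_dim (group_algebra_scalar G) S \<and> module_iso kG W S"
proof -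
  interpret W: group_module G W by (rule simple_moduleD(2)[OF W])
  obtain w where w: "w \<in> carrier W" "w \<noteq> \<zero>\<^bsub>W\<^esub>" using simple_moduleD(3)[OF W] by blast
  let ?L = "(\<lambda>a. a \<odot>\<^bsub>W\<^esub> w) ` carrier kG"
  have "submodule ?L kG W"
  proof (rule W.T.submoduleI)
    show "?L \<subseteq> carrier W" using w by (auto simp: W.T.smult_closed)
    show "\<zero>\<^bsub>W\<^esub> \<in> ?L" using w W.T.smult_l_zero[OF w(1)] by (intro image_eqI[of _ _ "\<zero>\<^bsub>kG\<^esub>"]) auto
    show "u \<oplus>\<^bsub>W\<^esub> u' \<in> ?L" if "u \<in> ?L" "u' \<in> ?L" for u u'
      using that w by (auto simp: W.T.smult_l_distr[symmetric])
    show "r \<odot>\<^bsub>W\<^esub> u \<in> ?L" if "r \<in> carrier kG" "u \<in> ?L" for r u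
      using that w by (auto simp: W.T.smult_assoc[symmetric])
  qed
  then have "?L = {\<zero>\<^bsub>W\<^esub>} \<or> ?L = carrier W" using W by (simp add: simple_module_def)
  moreover have "w \<in> ?L" using w W.T.smult_one by (intro image_eqI[of _ _ "\<one>\<^bsub>kG\<^esub>"]) auto
  ultimately have L: "?L = carrier W" using w(2) by blast
  then have "\<forall>x\<in>carrier W. \<exists>a. a \<in> carrier kG \<and> x = a \<odot>\<^bsub>W\<^esub> w" by blast
  then obtain c where c: "\<And>x. x \<in> carrier W \<Longrightarrow> c x \<in> carrier kG" "\<And>x. x \<in> carrier W \<Longrightarrow> x = c x \<odot>\<^bsub>W\<^esub> w" by metis
  obtain e :: "nat \<Rightarrow> 'g" where e: "bij_betw e {0..<card (carrier G)} (carrier G)"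
    using ex_bij_betw_nat_finite[OF finite_G] by blast
  \<comment> \<open>Any injection into \<open>nat \<Rightarrow> 'k\<close> will do: the module structure is transported along it.\<close>
  define J where "J x i = c x (e i)" for x i
  have inj: "inj_on J (carrier W)"
  proof (rule inj_onI)
    fix x y assume xy: "x \<in> carrier W" "y \<in> carrier W" "J x = J y"
    have "c x h = c y h" for h
    proof (cases "h \<in> carrier G")
      case True
      then obtain i where "h = e i" using bij_betw_imp_surj_on[OF e] by blast
      then show ?thesis using fun_cong[OF xy(3), of i] by (simp add: J_def)
    next
      case False
      then have "c x h = 0" "c y h = 0" using c(1)[OF xy(1)] c(1)[OF xy(2)] by (auto simp: monoid_algebra_def)
      then show ?thesis by simp
    qed
    then have "c x = c y" by blast
    then show "x = y" using c(2)[OF xy(1)] c(2)[OF xy(2)] by simp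
  qed
  let ?S = "transport_module J W"
  note S = transport_module[OF W.T.left_module_axioms inj]
  have iso: "module_iso kG W ?S" by (rule module_isoI[OF S(2,3)])
  have sc: "group_algebra_scalar G c \<in> carrier kG" for c :: 'k by (simp add: group_algebra_scalar_def)
  have "finite_dim (group_algebra_scalar G) W"
  proof (rule finite_dimI[where b = "\<lambda>h. single 1 h \<odot>\<^bsub>W\<^esub> w", OF W.T.left_module_axioms sc _ finite_G])
    fix x assume x: "x \<in> carrier W"
    have "x = c x \<odot>\<^bsub>W\<^esub> w" by (rule c(2)[OF x])
    also have "\<dots> = (\<Oplus>\<^bsub>W\<^esub>h\<in>carrier G. single (c x h) h \<odot>\<^bsub>W\<^esub> w)" by (rule W.smult_expand[OF c(1)[OF x] w(1)])
    also have "\<dots> = (\<Oplus>\<^bsub>W\<^esub>h\<in>carrier G. group_algebra_scalar G (c x h) \<odot>\<^bsub>W\<^esub> (single 1 h \<odot>\<^bsub>W\<^esub> w))"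
      by (rule W.T.M.finsum_cong') (use w(1) in \<open>auto simp: group_algebra_scalar_def W.single_smult_single\<close>)
    finally show "\<exists>c. x = (\<Oplus>\<^bsub>W\<^esub>h\<in>carrier G. group_algebra_scalar G (c h) \<odot>\<^bsub>W\<^esub> (single 1 h \<odot>\<^bsub>W\<^esub> w))" by blast
  qed (use w(1) in \<open>auto simp: group_algebra_scalar_def single_add\<close>)
  then have "finite_dim (group_algebra_scalar G) ?S"
    by (rule finite_dim_iso[OF W.T.left_module_axioms S(1) iso sc])
  then show ?thesis using simple_module_iso[OF W S(1) iso] iso by blast
qed

end

section \<open>Tensoring with a character\<close>

lemma single_apply: "single c a b = (if b = a then c else 0)"
  by (simp add: single_def)

locale character_tensor = group_module G V
  for G :: "'g monoid" (structure) and V :: "('g \<Rightarrow> 'k::field, 'v) module" +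
  fixes \<psi> :: "'g \<Rightarrow> 'k"
  assumes psi_one: "\<psi> \<one> = 1"
begin

abbreviation "Ch \<equiv> character_module G \<psi>"
abbreviation "FP \<equiv> free_on_pairs G Ch V"
abbreviation "BR \<equiv> bilinear_relations G Ch V"
abbreviation "RS \<equiv> subspace_spanned BR"

text \<open>A record with a dummy multiplication. It only gives the free space on pairs the form of
  a \<open>monoid_algebra\<close>, for the sake of \<open>monoid_algebra_induct\<close>.\<close>

abbreviation pairs_monoid :: "('k \<times> 'v) monoid" where
  "pairs_monoid \<equiv> \<lparr>carrier = UNIV \<times> carrier V, mult = (\<lambda>x y. x), one = undefined\<rparr>"

lemma Ch_smult: "h \<in> carrier G \<Longrightarrow> single d h \<odot>\<^bsub>Ch\<^esub> c = d * \<psi> h * c"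
proof -
  assume h: "h \<in> carrier G"
  have "single d h \<odot>\<^bsub>Ch\<^esub> c = (\<Sum>h'\<in>carrier G. if h' = h then d * \<psi> h * c else 0)"
    unfolding character_module_def by (auto simp: single_def intro!: sum.cong)
  then show ?thesis using h finite_carrier by simp
qed

lemma FP_carrier: "f \<in> carrier FP \<longleftrightarrow> finite {p. f p \<noteq> 0} \<and> {p. f p \<noteq> 0} \<subseteq> UNIV \<times> carrier V"
  by (simp add: free_on_pairs_def character_module_def)

lemma FP_carrier_monoid_algebra: "carrier FP = carrier (monoid_algebra pairs_monoid)"
  by (auto simp: FP_carrier monoid_algebra_def)

lemma FP_add: "(f \<oplus>\<^bsub>FP\<^esub> f') = (\<lambda>p. f p + f' p)"
  by (simp add: free_on_pairs_def)

lemma single_in_FP: "v \<in> carrier V \<Longrightarrow> single c (d, v) \<in> carrier FP"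
  unfolding FP_carrier_monoid_algebra by (rule single_closed) simp

lemma FP_closed_add: "\<lbrakk>f \<in> carrier FP; f' \<in> carrier FP\<rbrakk> \<Longrightarrow> (\<lambda>p. f p + f' p) \<in> carrier FP"
proof -
  assume "f \<in> carrier FP" "f' \<in> carrier FP"
  moreover have "{p. f p + f' p \<noteq> 0} \<subseteq> {p. f p \<noteq> 0} \<union> {p. f' p \<noteq> 0}" by auto
  ultimately show ?thesis unfolding FP_carrier by (meson finite_UnI finite_subset le_sup_iff order_trans)
qed

lemma FP_closed_scale: "f \<in> carrier FP \<Longrightarrow> (\<lambda>p. c * f p) \<in> carrier FP"
proof -
  assume "f \<in> carrier FP"
  moreover have "{p. c * f p \<noteq> 0} \<subseteq> {p. f p \<noteq> 0}" by auto
  ultimately show ?thesis unfolding FP_carrier by (meson finite_subset order_trans)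
qed

text \<open>The linear map sending the pair \<open>(c, v)\<close> to \<open>c v\<close>. It will
  induce the isomorphism of the tensor product with V, whose inverse sends \<open>v\<close> to the
  class of \<open>(1, v)\<close>.\<close>

definition ev :: "('k \<times> 'v \<Rightarrow> 'k) \<Rightarrow> 'v" where
  "ev f = (\<Oplus>\<^bsub>V\<^esub>p\<in>{p. f p \<noteq> 0}. sc (f p * fst p) (snd p))"

lemma ev_superset:
  assumes "finite A" "{p. f p \<noteq> 0} \<subseteq> A" "A \<subseteq> UNIV \<times> carrier V"
  shows "ev f = (\<Oplus>\<^bsub>V\<^esub>p\<in>A. sc (f p * fst p) (snd p))"
  unfolding ev_def
  by (rule T.M.add.finprod_mono_neutral_cong_left) (use assms in \<open>auto simp: single_0_smult subset_iff\<close>)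

lemma ev_closed: "f \<in> carrier FP \<Longrightarrow> ev f \<in> carrier V"
  unfolding ev_def FP_carrier by (intro T.M.finsum_closed) auto

lemma ev_add:
  assumes "f \<in> carrier FP" "f' \<in> carrier FP"
  shows "ev (\<lambda>p. f p + f' p) = ev f \<oplus>\<^bsub>V\<^esub> ev f'"
proof -
  let ?A = "{p. f p \<noteq> 0} \<union> {p. f' p \<noteq> 0}"
  have A: "finite ?A" "?A \<subseteq> UNIV \<times> carrier V" using assms by (auto simp: FP_carrier)
  have "ev (\<lambda>p. f p + f' p) = (\<Oplus>\<^bsub>V\<^esub>p\<in>?A. sc ((f p + f' p) * fst p) (snd p))"
    using A by (intro ev_superset) auto
  also have "\<dots> = (\<Oplus>\<^bsub>V\<^esub>p\<in>?A. sc (f p * fst p) (snd p) \<oplus>\<^bsub>V\<^esub> sc (f' p * fst p) (snd p))"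
  proof (rule T.M.finsum_cong'[OF refl])
    have v: "snd p \<in> carrier V" if "p \<in> ?A" for p using A(2) that by auto
    show "(\<lambda>p. sc (f p * fst p) (snd p) \<oplus>\<^bsub>V\<^esub> sc (f' p * fst p) (snd p)) \<in> ?A \<rightarrow> carrier V"
      using v by (intro Pi_I T.M.a_closed single_smult_closed one_closed)
    show "sc ((f p + f' p) * fst p) (snd p) = sc (f p * fst p) (snd p) \<oplus>\<^bsub>V\<^esub> sc (f' p * fst p) (snd p)"
      if "p \<in> ?A" for p
      using v[OF that] by (simp add: T.smult_l_distr[symmetric] single_add distrib_right)
  qed
  also have "\<dots> = ev f \<oplus>\<^bsub>V\<^esub> ev f'"
    using A by (subst (1 2) ev_superset[of ?A]) (auto intro!: T.M.finsum_addf)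
  finally show ?thesis .
qed

lemma ev_scale:
  assumes "f \<in> carrier FP" shows "ev (\<lambda>p. c * f p) = sc c (ev f)"
proof -
  let ?A = "{p. f p \<noteq> 0}"
  have A: "finite ?A" "?A \<subseteq> UNIV \<times> carrier V" using assms by (auto simp: FP_carrier)
  have "ev (\<lambda>p. c * f p) = (\<Oplus>\<^bsub>V\<^esub>p\<in>?A. sc (c * f p * fst p) (snd p))" using A by (intro ev_superset) auto
  also have "\<dots> = (\<Oplus>\<^bsub>V\<^esub>p\<in>?A. sc c (sc (f p * fst p) (snd p)))"
    by (rule T.M.finsum_cong') (use A(2) in \<open>auto simp: sc_sc mult.assoc subset_iff\<close>)
  also have "\<dots> = sc c (ev f)" unfolding ev_def using A(2) by (intro T.smult_finsum[symmetric]) auto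
  finally show ?thesis .
qed

lemma ev_single: "v \<in> carrier V \<Longrightarrow> ev (single c (d, v)) = sc (c * d) v"
proof -
  assume v: "v \<in> carrier V"
  have "ev (single c (d, v)) = (\<Oplus>\<^bsub>V\<^esub>p\<in>{(d, v)}. sc (single c (d, v) p * fst p) (snd p))"
    using v by (intro ev_superset) (auto simp: single_def)
  then show ?thesis using v T.M.finsum_insert[of "{}" "(d, v)" "\<lambda>p. sc (single c (d, v) p * fst p) (snd p)"]
    by (simp add: single_def[of c])
qed

definition is_subspace :: "('k \<times> 'v \<Rightarrow> 'k) set \<Rightarrow> bool" where
  "is_subspace U \<longleftrightarrow> (\<lambda>_. 0) \<in> U \<and> (\<forall>f\<in>U. \<forall>f'\<in>U. (\<lambda>p. f p + f' p) \<in> U) \<and> (\<forall>c. \<forall>f\<in>U. (\<lambda>p. c * f p) \<in> U)"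

lemma RS_eq: "RS = \<Inter>{U. BR \<subseteq> U \<and> is_subspace U}"
  by (simp add: subspace_spanned_def is_subspace_def)

lemma is_subspace_RS: "is_subspace RS"
  unfolding RS_eq by (auto simp: is_subspace_def)

lemma RS_add: "\<lbrakk>f \<in> RS; f' \<in> RS\<rbrakk> \<Longrightarrow> (\<lambda>p. f p + f' p) \<in> RS"
  and RS_scale: "f \<in> RS \<Longrightarrow> (\<lambda>p. c * f p) \<in> RS"
  and RS_zero: "(\<lambda>_. 0) \<in> RS"
  using is_subspace_RS by (auto simp: is_subspace_def)

lemma RS_diff: "\<lbrakk>f \<in> RS; f' \<in> RS\<rbrakk> \<Longrightarrow> (\<lambda>p. f p - f' p) \<in> RS"
  using RS_add[OF _ RS_scale[of f' "- 1"], of f] by simp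

lemma BR_in_RS: "r \<in> BR \<Longrightarrow> r \<in> RS"
  unfolding RS_eq by blast

lemma ev_diff:
  assumes "f \<in> carrier FP" "f' \<in> carrier FP"
  shows "(\<lambda>p. f p - f' p) \<in> carrier FP" "ev (\<lambda>p. f p - f' p) = ev f \<ominus>\<^bsub>V\<^esub> ev f'"
proof -
  have 1: "(\<lambda>p. f p - f' p) = (\<lambda>p. f p + (- 1) * f' p)" by simp
  have 2: "(\<lambda>p. (- 1) * f' p) \<in> carrier FP" by (rule FP_closed_scale[OF assms(2)])
  show "(\<lambda>p. f p - f' p) \<in> carrier FP" unfolding 1 by (rule FP_closed_add[OF assms(1) 2])
  have "sc (- 1) (ev f') = \<ominus>\<^bsub>V\<^esub> ev f'"
  proof (rule T.M.minus_equality[symmetric])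
    have "sc (- 1) (ev f') \<oplus>\<^bsub>V\<^esub> sc 1 (ev f') = sc 0 (ev f')"
      using ev_closed[OF assms(2)] by (simp add: T.smult_l_distr[symmetric] single_add del: single_1_smult)
    then show "sc (- 1) (ev f') \<oplus>\<^bsub>V\<^esub> ev f' = \<zero>\<^bsub>V\<^esub>" using ev_closed[OF assms(2)] by (simp add: single_0_smult)
  qed (use ev_closed[OF assms(2)] in auto)
  then show "ev (\<lambda>p. f p - f' p) = ev f \<ominus>\<^bsub>V\<^esub> ev f'"
    unfolding 1 ev_add[OF assms(1) 2] ev_scale[OF assms(2)] by (simp add: a_minus_def)
qed

lemma ev_diff2:
  assumes "a \<in> carrier FP" "b \<in> carrier FP" "d \<in> carrier FP"
  shows "(\<lambda>p. a p - b p - d p) \<in> carrier FP" "ev (\<lambda>p. a p - b p - d p) = ev a \<ominus>\<^bsub>V\<^esub> ev b \<ominus>\<^bsub>V\<^esub> ev d"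
  using ev_diff[OF ev_diff(1)[OF assms(1,2)] assms(3)] ev_diff(2)[OF assms(1,2)] by simp_all

lemma cancel3: "\<lbrakk>y \<in> carrier V; z \<in> carrier V\<rbrakk> \<Longrightarrow> (y \<oplus>\<^bsub>V\<^esub> z) \<ominus>\<^bsub>V\<^esub> y \<ominus>\<^bsub>V\<^esub> z = \<zero>\<^bsub>V\<^esub>"
proof -
  assume yz: "y \<in> carrier V" "z \<in> carrier V"
  then have "(y \<oplus>\<^bsub>V\<^esub> z) \<ominus>\<^bsub>V\<^esub> y \<ominus>\<^bsub>V\<^esub> z = (y \<oplus>\<^bsub>V\<^esub> \<ominus>\<^bsub>V\<^esub> y) \<oplus>\<^bsub>V\<^esub> (z \<oplus>\<^bsub>V\<^esub> \<ominus>\<^bsub>V\<^esub> z)"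
    by (simp add: a_minus_def T.M.a_ac)
  then show ?thesis using yz by (simp add: T.M.r_neg)
qed

lemma Ch_scalar: "group_algebra_scalar G e \<odot>\<^bsub>Ch\<^esub> c = e * c"
  using Ch_smult[OF one_closed, of e c] by (simp add: group_algebra_scalar_def psi_one)

lemma BR_cases:
  assumes "r \<in> BR"
  obtains (add1) c c' v where "v \<in> carrier V"
      "r = (\<lambda>p. single 1 (c + c', v) p - single 1 (c, v) p - single 1 (c', v) p)"
  | (add2) c v w where "v \<in> carrier V" "w \<in> carrier V"
      "r = (\<lambda>p. single 1 (c, v \<oplus>\<^bsub>V\<^esub> w) p - single 1 (c, v) p - single 1 (c, w) p)"
  | (scale1) e c v where "v \<in> carrier V" "r = (\<lambda>p. single 1 (e * c, v) p - single e (c, v) p)"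
  | (scale2) e c v where "v \<in> carrier V" "r = (\<lambda>p. single 1 (c, sc e v) p - single e (c, v) p)"
  using assms unfolding bilinear_relations_def Ch_scalar
  unfolding group_algebra_scalar_def character_module_def by auto

text \<open>The kernel of \<open>ev\<close> is a subspace, and it contains each of the four families
  of bilinearity relations.\<close>

lemma RS_kernel: "f \<in> RS \<Longrightarrow> f \<in> carrier FP \<and> ev f = \<zero>\<^bsub>V\<^esub>"
proof -
  let ?U = "{f \<in> carrier FP. ev f = \<zero>\<^bsub>V\<^esub>}"
  have "is_subspace ?U" unfolding is_subspace_def
  proof (intro conjI ballI allI)
    show "(\<lambda>_. 0) \<in> ?U" by (simp add: FP_carrier ev_def)
  qed (auto simp: FP_closed_add FP_closed_scale ev_add ev_scale T.smult_r_zero)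
  moreover have "BR \<subseteq> ?U"
  proof
    fix r assume "r \<in> BR"
    then show "r \<in> ?U"
    proof (cases rule: BR_cases)
      case (add1 c c' v)
      have "sc (c + c') v = sc c v \<oplus>\<^bsub>V\<^esub> sc c' v"
        using add1(1) by (simp add: sc_add)
      then show ?thesis using add1(1) unfolding add1(2)
        by (simp add: ev_diff2 single_in_FP ev_single cancel3)
    next
      case (add2 c v w)
      then show ?thesis unfolding add2(3)
        by (simp add: ev_diff2 single_in_FP ev_single T.smult_r_distr cancel3)
    next
      case (scale1 e c v)
      then show ?thesis unfolding scale1(2)
        by (simp add: ev_diff single_in_FP ev_single T.M.minus_self)
    next
      case (scale2 e c v)
      then show ?thesis unfolding scale2(2)
        by (simp add: ev_diff single_in_FP ev_single sc_sc mult.commute T.M.minus_self)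
    qed
  qed
  ultimately have "RS \<subseteq> ?U" unfolding RS_eq by blast
  then show "f \<in> RS \<Longrightarrow> f \<in> carrier FP \<and> ev f = \<zero>\<^bsub>V\<^esub>" by blast
qed

lemma add2_in_RS: "\<lbrakk>v \<in> carrier V; w \<in> carrier V\<rbrakk> \<Longrightarrow>
    (\<lambda>p. single 1 (c, v \<oplus>\<^bsub>V\<^esub> w) p - single 1 (c, v) p - single 1 (c, w) p) \<in> RS"
  by (rule BR_in_RS) (auto simp: bilinear_relations_def character_module_def)

lemma scale1_in_RS: "v \<in> carrier V \<Longrightarrow> (\<lambda>p. single 1 (e * c, v) p - single e (c, v) p) \<in> RS"
  by (rule BR_in_RS) (unfold bilinear_relations_def Ch_scalar, auto simp: character_module_def)

lemma scale2_in_RS: "v \<in> carrier V \<Longrightarrow> (\<lambda>p. single 1 (c, sc e v) p - single e (c, v) p) \<in> RS"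
  by (rule BR_in_RS) (auto simp: bilinear_relations_def character_module_def group_algebra_scalar_def)

text \<open>Additivity in the second entry for \<open>0 + 0\<close> yields the negative of this
  tensor.\<close>

lemma zero_tensor_in_RS: "single 1 (1, \<zero>\<^bsub>V\<^esub>) \<in> RS"
  using RS_scale[OF add2_in_RS[OF T.M.zero_closed T.M.zero_closed, of 1], of "- 1"] by simp

text \<open>Modulo the relations every element collapses to a pure tensor with first entry 1:
  scalars move to the second entry, and tensors with equal first entry are then added there.\<close>

lemma pure_tensor:
  assumes "f \<in> carrier FP"
  shows "(\<lambda>p. f p - single 1 (1, ev f) p) \<in> RS"
proof -
  have "f \<in> carrier (monoid_algebra pairs_monoid)" using assms by (simp add: FP_carrier_monoid_algebra)
  then show ?thesis
  proof (induct f rule: monoid_algebra_induct)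
    case zero
    have "ev \<zero>\<^bsub>monoid_algebra pairs_monoid\<^esub> = \<zero>\<^bsub>V\<^esub>" by (simp add: ev_def monoid_algebra_zero)
    then show ?case using RS_scale[OF zero_tensor_in_RS, of "- 1"] by (simp add: monoid_algebra_zero)
  next
    case (single d x)
    obtain c v where x: "x = (c, v)" by (cases x)
    have v: "v \<in> carrier V" using single x by simp
    \<comment> \<open>Three scaling relations: \<open>d (c, v)\<close> becomes
      \<open>(d c, v)\<close>, then \<open>d c (1, v)\<close>, then
      \<open>(1, d c v)\<close>.\<close>
    have "(\<lambda>p. (single 1 (d * c * 1, v) p - single (d * c) (1, v) p) - (single 1 (d * c, v) p - single d (c, v) p)
        - (single 1 (1, sc (d * c) v) p - single (d * c) (1, v) p)) \<in> RS"
      by (rule RS_diff[OF RS_diff[OF scale1_in_RS scale1_in_RS] scale2_in_RS]) (fact v)+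
    then show ?case using v by (simp add: x ev_single)
  next
    case (add f f')
    have c: "f \<in> carrier FP" "f' \<in> carrier FP" using add(1,2) by (simp_all add: FP_carrier_monoid_algebra)
    have e: "f \<oplus>\<^bsub>monoid_algebra pairs_monoid\<^esub> f' = (\<lambda>p. f p + f' p)" by (rule ext) (simp add: monoid_algebra_add)
    have "(\<lambda>p. ((f p - single 1 (1, ev f) p) + (f' p - single 1 (1, ev f') p)) -
        (single 1 (1, ev f \<oplus>\<^bsub>V\<^esub> ev f') p - single 1 (1, ev f) p - single 1 (1, ev f') p)) \<in> RS"
      by (rule RS_diff[OF RS_add[OF add(3,4)] add2_in_RS]) (use c ev_closed in auto)
    then show ?case unfolding e ev_add[OF c] by (simp add: algebra_simps)
  qed
qed

text \<open>An element of the kernel is congruent to the pure tensor of 1 with zero, which is itself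
  a relation.\<close>

lemma RS_iff: "f \<in> RS \<longleftrightarrow> f \<in> carrier FP \<and> ev f = \<zero>\<^bsub>V\<^esub>"
  using RS_kernel pure_tensor[of f] RS_add[OF _ zero_tensor_in_RS, of "\<lambda>p. f p - single 1 (1, ev f) p"]
  by auto

text \<open>The cosets of the relation space, that is, the elements of the tensor product, are
  exactly these fibres of \<open>ev\<close>.\<close>

definition fibre :: "'v \<Rightarrow> ('k \<times> 'v \<Rightarrow> 'k) set" where
  "fibre v = {x \<in> carrier FP. ev x = v}"

lemma coset_eq:
  assumes f: "f \<in> carrier FP" shows "RS +>\<^bsub>FP\<^esub> f = fibre (ev f)"
proof
  show "RS +>\<^bsub>FP\<^esub> f \<subseteq> fibre (ev f)"
    using f by (auto simp: a_r_coset_def' FP_add fibre_def RS_iff FP_closed_add ev_add ev_closed)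
  show "fibre (ev f) \<subseteq> RS +>\<^bsub>FP\<^esub> f"
  proof
    fix x assume "x \<in> fibre (ev f)"
    then have "(\<lambda>p. x p - f p) \<in> RS" using f ev_closed[OF f]
      by (simp add: fibre_def RS_iff ev_diff T.M.minus_self)
    moreover have "x = (\<lambda>p. x p - f p) \<oplus>\<^bsub>FP\<^esub> f" by (simp add: FP_add)
    ultimately show "x \<in> RS +>\<^bsub>FP\<^esub> f" unfolding a_r_coset_def' by blast
  qed
qed

lemma pure_in_fibre: "v \<in> carrier V \<Longrightarrow> single 1 (1, v) \<in> fibre v"
  by (simp add: fibre_def single_in_FP ev_single)

lemma ev_sum:
  assumes "finite I" "\<And>i. i \<in> I \<Longrightarrow> u i \<in> carrier FP"
  shows "(\<lambda>z. \<Sum>i\<in>I. u i z) \<in> carrier FP \<and> ev (\<lambda>z. \<Sum>i\<in>I. u i z) = (\<Oplus>\<^bsub>V\<^esub>i\<in>I. ev (u i))"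
  using assms
proof (induct I rule: finite_induct)
  case empty show ?case by (simp add: FP_carrier ev_def)
next
  case (insert i I)
  then have "(\<lambda>i. ev (u i)) \<in> I \<rightarrow> carrier V" using ev_closed by auto
  then show ?case using insert ev_closed[of "u i"]
    by (simp add: FP_closed_add ev_add T.M.finsum_insert)
qed

text \<open>The diagonal action sends \<open>(c, v)\<close> to \<open>(\<psi> h * c, h v)\<close>,
  so under \<open>ev\<close> the coefficient of each \<open>h\<close> is multiplied by
  \<open>\<psi> h\<close>.\<close>

lemma ev_smult:
  assumes a: "a \<in> carrier (monoid_algebra G)" and f: "f \<in> carrier FP"
  shows "a \<odot>\<^bsub>FP\<^esub> f \<in> carrier FP" "ev (a \<odot>\<^bsub>FP\<^esub> f) = (\<lambda>h. a h * \<psi> h) \<odot>\<^bsub>V\<^esub> ev f"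
proof -
  let ?S = "{p. f p \<noteq> 0}"
  have S: "finite ?S" "?S \<subseteq> UNIV \<times> carrier V" using f by (auto simp: FP_carrier)
  have Sv: "snd p \<in> carrier V" if "p \<in> ?S" for p using S(2) that by auto
  let ?t = "\<lambda>h p. single (a h * f p) (\<psi> h * fst p, single 1 h \<odot>\<^bsub>V\<^esub> snd p)"
  have tc: "?t h p \<in> carrier FP" if "h \<in> carrier G" "p \<in> ?S" for h p
    using that Sv by (intro single_in_FP) simp
  \<comment> \<open>The action in \<open>free_on_pairs\<close> collects, for each pair
    \<open>q\<close>, the pairs that \<open>h\<close> sends to \<open>q\<close>; here the sum runs
    over the sources instead.\<close>
  have eq: "a \<odot>\<^bsub>FP\<^esub> f = (\<lambda>q. \<Sum>h\<in>carrier G. \<Sum>p\<in>?S. ?t h p q)"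
  proof
    fix q
    have "(\<Sum>(c, v)\<in>{(c, v). f (c, v) \<noteq> 0 \<and> (single 1 h \<odot>\<^bsub>Ch\<^esub> c, single 1 h \<odot>\<^bsub>V\<^esub> v) = q}. a h * f (c, v))
        = (\<Sum>p\<in>?S. ?t h p q)" if h: "h \<in> carrier G" for h
      by (rule sum.mono_neutral_cong_left) (use S h in \<open>auto simp: Ch_smult single_apply\<close>)
    then show "(a \<odot>\<^bsub>FP\<^esub> f) q = (\<Sum>h\<in>carrier G. \<Sum>p\<in>?S. ?t h p q)"
      by (simp add: free_on_pairs_def)
  qed
  have inner: "(\<lambda>z. \<Sum>p\<in>?S. ?t h p z) \<in> carrier FP \<and>
      ev (\<lambda>z. \<Sum>p\<in>?S. ?t h p z) = (\<Oplus>\<^bsub>V\<^esub>p\<in>?S. ev (?t h p))" if "h \<in> carrier G" for h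
    by (rule ev_sum[OF S(1)]) (use tc that in auto)
  note outer = ev_sum[OF finite_carrier, of "\<lambda>h z. \<Sum>p\<in>?S. ?t h p z", OF inner[THEN conjunct1]]
  have *: "a \<odot>\<^bsub>FP\<^esub> f \<in> carrier FP"
    "ev (a \<odot>\<^bsub>FP\<^esub> f) = (\<Oplus>\<^bsub>V\<^esub>h\<in>carrier G. ev (\<lambda>z. \<Sum>p\<in>?S. ?t h p z))"
    unfolding eq using outer by blast+
  then show "a \<odot>\<^bsub>FP\<^esub> f \<in> carrier FP" by simp
  have aG: "(\<lambda>h. a h * \<psi> h) \<in> carrier (monoid_algebra G)"
  proof -
    have "{h. a h * \<psi> h \<noteq> 0} \<subseteq> {h. a h \<noteq> 0}" by auto
    then show ?thesis using a by (auto simp: monoid_algebra_def intro: finite_subset)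
  qed
  have "(\<lambda>h. a h * \<psi> h) \<odot>\<^bsub>V\<^esub> ev f = (\<Oplus>\<^bsub>V\<^esub>h\<in>carrier G. single (a h * \<psi> h) h \<odot>\<^bsub>V\<^esub> ev f)"
    by (rule smult_expand[OF aG ev_closed[OF f]])
  also have "\<dots> = (\<Oplus>\<^bsub>V\<^esub>h\<in>carrier G. ev (\<lambda>z. \<Sum>p\<in>?S. ?t h p z))"
  proof (rule T.M.finsum_cong'[OF refl])
    show "(\<lambda>h. ev (\<lambda>z. \<Sum>p\<in>?S. ?t h p z)) \<in> carrier G \<rightarrow> carrier V" using inner ev_closed by auto
    fix h assume h: "h \<in> carrier G"
    have "single (a h * \<psi> h) h \<odot>\<^bsub>V\<^esub> ev f = (\<Oplus>\<^bsub>V\<^esub>p\<in>?S. single (a h * \<psi> h) h \<odot>\<^bsub>V\<^esub> sc (f p * fst p) (snd p))"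
      unfolding ev_def using h Sv by (intro T.smult_finsum) auto
    also have "\<dots> = (\<Oplus>\<^bsub>V\<^esub>p\<in>?S. ev (?t h p))"
      by (rule T.M.finsum_cong')
        (use h Sv in \<open>auto simp: ev_single single_smult_single mult_ac\<close>)
    finally show "single (a h * \<psi> h) h \<odot>\<^bsub>V\<^esub> ev f = ev (\<lambda>z. \<Sum>p\<in>?S. ?t h p z)" using inner[OF h] by simp
  qed
  finally show "ev (a \<odot>\<^bsub>FP\<^esub> f) = (\<lambda>h. a h * \<psi> h) \<odot>\<^bsub>V\<^esub> ev f" using *(2) by simp
qed

text \<open>With \<open>\<psi>\<close> the inverse of \<open>\<chi>\<close>, this identifies the
  tensor product that defines \<tau> with \<open>twist 1\<close>.\<close>

theorem tensor_character_iso: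
  "module_iso (monoid_algebra G) (restrict_scalars (\<lambda>a h. a h * \<psi> h) V) (tensor_module G Ch V)"
proof (rule module_isoI)
  let ?N = "tensor_module G Ch V"
  have N: "carrier ?N = a_rcosets\<^bsub>FP\<^esub> RS" "add ?N = set_add FP"
    "\<And>a C. a \<odot>\<^bsub>?N\<^esub> C = (\<Union>x\<in>C. RS +>\<^bsub>FP\<^esub> (a \<odot>\<^bsub>FP\<^esub> x))"
    by (simp_all add: tensor_module_def quotient_module_def)
  have carr: "carrier ?N = fibre ` carrier V"
  proof
    show "carrier ?N \<subseteq> fibre ` carrier V" using coset_eq ev_closed by (auto simp: N A_RCOSETS_def')
    show "fibre ` carrier V \<subseteq> carrier ?N"
    proof
      fix C assume "C \<in> fibre ` carrier V"
      then obtain v where v: "v \<in> carrier V" "C = fibre v" by blast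
      then have "C = RS +>\<^bsub>FP\<^esub> single 1 (1, v)" using coset_eq[OF single_in_FP[OF v(1)], of 1 1] by (simp add: ev_single)
      then show "C \<in> carrier ?N" using single_in_FP[OF v(1)] by (auto simp: N A_RCOSETS_def')
    qed
  qed
  show "left_module_hom (monoid_algebra G) (restrict_scalars (\<lambda>a h. a h * \<psi> h) V) ?N fibre"
  proof (rule left_module_homI)
    fix v assume "v \<in> carrier (restrict_scalars (\<lambda>a h. a h * \<psi> h) V)"
    then have v: "v \<in> carrier V" by simp
    show "fibre v \<in> carrier ?N" using v by (simp add: carr)
    show "fibre (v \<oplus>\<^bsub>restrict_scalars (\<lambda>a h. a h * \<psi> h) V\<^esub> w) = fibre v \<oplus>\<^bsub>?N\<^esub> fibre w"
      if "w \<in> carrier (restrict_scalars (\<lambda>a h. a h * \<psi> h) V)" for w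
    proof -
      have w: "w \<in> carrier V" using that by simp
      have "fibre (v \<oplus>\<^bsub>V\<^esub> w) = fibre v <+>\<^bsub>FP\<^esub> fibre w"
      proof
        show "fibre v <+>\<^bsub>FP\<^esub> fibre w \<subseteq> fibre (v \<oplus>\<^bsub>V\<^esub> w)"
          by (auto simp: set_add_def' FP_add fibre_def FP_closed_add ev_add)
        show "fibre (v \<oplus>\<^bsub>V\<^esub> w) \<subseteq> fibre v <+>\<^bsub>FP\<^esub> fibre w"
        proof
          fix x assume x: "x \<in> fibre (v \<oplus>\<^bsub>V\<^esub> w)"
          let ?y = "single 1 (1, v)"
          have "(v \<oplus>\<^bsub>V\<^esub> w) \<ominus>\<^bsub>V\<^esub> v = w" using v w by (intro T.M.minus_eqI) (auto simp: T.M.a_comm)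
          then have "(\<lambda>p. x p - ?y p) \<in> fibre w" using x v single_in_FP[OF v]
            by (simp add: fibre_def ev_diff ev_single)
          moreover have "x = ?y \<oplus>\<^bsub>FP\<^esub> (\<lambda>p. x p - ?y p)" by (simp add: FP_add)
          ultimately show "x \<in> fibre v <+>\<^bsub>FP\<^esub> fibre w" unfolding set_add_def' using pure_in_fibre[OF v] by blast
        qed
      qed
      then show ?thesis by (simp add: N)
    qed
    fix a :: "'g \<Rightarrow> 'k" assume a: "a \<in> carrier (monoid_algebra G)"
    have "RS +>\<^bsub>FP\<^esub> (a \<odot>\<^bsub>FP\<^esub> x) = fibre ((\<lambda>h. a h * \<psi> h) \<odot>\<^bsub>V\<^esub> v)" if "x \<in> fibre v" for x
      using that a ev_smult[OF a, of x] coset_eq[of "a \<odot>\<^bsub>FP\<^esub> x"] by (simp add: fibre_def)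
    then show "fibre (a \<odot>\<^bsub>restrict_scalars (\<lambda>a h. a h * \<psi> h) V\<^esub> v) = a \<odot>\<^bsub>?N\<^esub> fibre v"
      using pure_in_fibre[OF v] by (auto simp: N)
  qed
  have "inj_on fibre (carrier V)"
  proof (rule inj_onI)
    fix x y assume xy: "x \<in> carrier V" "y \<in> carrier V" "fibre x = fibre y"
    then have "single 1 (1, x) \<in> fibre x" "single 1 (1, x) \<in> fibre y" using pure_in_fibre[OF xy(1)] by simp_all
    then show "x = y" by (simp add: fibre_def)
  qed
  then show "bij_betw fibre (carrier (restrict_scalars (\<lambda>a h. a h * \<psi> h) V)) (carrier ?N)"
    by (simp add: bij_betw_def carr)
qed

end

section \<open>The classification\<close>

lemma indecomposable_module_iso:
  assumes "indecomposable_module R M" "left_module R N" "module_iso R M N"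
  shows "indecomposable_module R N"
proof -
  obtain f where f: "left_module_hom R M N f" "bij_betw f (carrier M) (carrier N)"
    using assms(3) by (auto simp: module_iso_altdef)
  interpret M: left_module R M using assms(1) by (simp add: indecomposable_module_def)
  interpret N: left_module R N by fact
  note D = left_module_homD[OF f(1)]
  let ?g = "the_inv_into (carrier M) f"
  note g = left_module_hom_inv[OF M.left_module_axioms f]
  note gD = left_module_homD[OF g(1)]
  have fg: "f (?g y) = y" if "y \<in> carrier N" for y
    using that f(2) by (auto intro: f_the_inv_into_f simp: bij_betw_def)
  have g0: "?g \<zero>\<^bsub>N\<^esub> = \<zero>\<^bsub>M\<^esub>"
    by (rule additive_zero[OF N.M.abelian_group_axioms M.M.abelian_group_axioms]) (use gD in auto)
  have f0: "f \<zero>\<^bsub>M\<^esub> = \<zero>\<^bsub>N\<^esub>" using fg[of "\<zero>\<^bsub>N\<^esub>"] g0 by simp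
  show ?thesis unfolding indecomposable_module_def
  proof (intro conjI allI impI)
    show "left_module R N" by fact
    show "carrier N \<noteq> {\<zero>\<^bsub>N\<^esub>}"
    proof
      assume N0: "carrier N = {\<zero>\<^bsub>N\<^esub>}"
      have "carrier M = ?g ` carrier N" using bij_betw_imp_surj_on[OF g(2)] ..
      then have "carrier M = {\<zero>\<^bsub>M\<^esub>}" unfolding N0 by (simp add: g0)
      then show False using assms(1) by (simp add: indecomposable_module_def)
    qed
    fix K K' assume K: "submodule K R N \<and> submodule K' R N \<and> K \<inter> K' = {\<zero>\<^bsub>N\<^esub>} \<and> K <+>\<^bsub>N\<^esub> K' = carrier N"
    then have Kc: "K \<subseteq> carrier N" "K' \<subseteq> carrier N" using N.submoduleD(1) by blast+
    have fgA: "f ` ?g ` A = A" if "A \<subseteq> carrier N" for A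
    proof -
      have "(\<lambda>x. f (?g x)) ` A = id ` A" using that fg by (intro image_cong) auto
      then show ?thesis by (simp add: image_image)
    qed
    have sub: "submodule (?g ` K) R M" "submodule (?g ` K') R M"
      using K N.submodule_image[OF M.left_module_axioms g(1)] by blast+
    have "?g ` K \<inter> ?g ` K' = ?g ` (K \<inter> K')"
      using inj_on_image_Int[OF bij_betw_imp_inj_on[OF g(2)] Kc] by simp
    then have int: "?g ` K \<inter> ?g ` K' = {\<zero>\<^bsub>M\<^esub>}" using K by (simp add: g0)
    have "?g ` K <+>\<^bsub>M\<^esub> ?g ` K' = carrier M"
    proof
      show "?g ` K <+>\<^bsub>M\<^esub> ?g ` K' \<subseteq> carrier M"
        using M.submoduleD(1)[OF sub(1)] M.submoduleD(1)[OF sub(2)] by (auto simp: set_add_def')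
      show "carrier M \<subseteq> ?g ` K <+>\<^bsub>M\<^esub> ?g ` K'"
      proof
        fix x assume "x \<in> carrier M"
        then have "x \<in> ?g ` (K <+>\<^bsub>N\<^esub> K')" using K bij_betw_imp_surj_on[OF g(2)] by simp
        then obtain a b where ab: "a \<in> K" "b \<in> K'" "x = ?g (a \<oplus>\<^bsub>N\<^esub> b)" by (auto simp: set_add_def')
        then have "x = ?g a \<oplus>\<^bsub>M\<^esub> ?g b" using gD(2) Kc by blast
        then show "x \<in> ?g ` K <+>\<^bsub>M\<^esub> ?g ` K'" unfolding set_add_def' using ab(1,2) by blast
      qed
    qed
    then have "?g ` K = {\<zero>\<^bsub>M\<^esub>} \<or> ?g ` K' = {\<zero>\<^bsub>M\<^esub>}"
      using assms(1) sub int by (simp add: indecomposable_module_def)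
    then show "K = {\<zero>\<^bsub>N\<^esub>} \<or> K' = {\<zero>\<^bsub>N\<^esub>}"
    proof
      assume "?g ` K = {\<zero>\<^bsub>M\<^esub>}"
      then have "f ` ?g ` K = {\<zero>\<^bsub>N\<^esub>}" by (simp add: f0)
      then show ?thesis using fgA[OF Kc(1)] by simp
    next
      assume "?g ` K' = {\<zero>\<^bsub>M\<^esub>}"
      then have "f ` ?g ` K' = {\<zero>\<^bsub>N\<^esub>}" by (simp add: f0)
      then show ?thesis using fgA[OF Kc(2)] by simp
    qed
  qed
qed

text \<open>Because \<open>\<chi>(g^n) = 1\<close>, the element \<open>g^n\<close> commutes with y
  as well as with the group, so its eigenprojection is an idempotent endomorphism over
  \<open>H\<close>. The vector \<open>x0\<close> makes its image nonzero, and an indecomposable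
  module has no proper nonzero retract.\<close>

lemma (in y_module) indecomposable_central_scalar:
  assumes indec: "indecomposable_module H HT"
    and x0: "x0 \<in> carrier T" "x0 \<noteq> \<zero>\<^bsub>T\<^esub>" "single 1 (g [^] n) \<odot>\<^bsub>T\<^esub> x0 = sc lam x0"
    and x: "x \<in> carrier T"
  shows "single 1 (g [^] n) \<odot>\<^bsub>T\<^esub> x = sc lam x"
proof -
  let ?z = "g [^] n"
  have z: "?z \<in> carrier G" using g_closed by simp
  note e = order_nonzero z g_pow_central eigenvalue_root[OF z x0]
  let ?E = "eigenproj ?z lam"
  have Eh: "left_module_hom kG T T ?E" by (rule eigenproj_hom[OF e])
  have E_y: "?E (\<phi> y) = \<phi> (?E y)" if y: "y \<in> carrier T" for y
  proof -
    let ?t = "\<lambda>y m. single (inverse lam ^ m) (?z [^] (m::nat)) \<odot>\<^bsub>T\<^esub> y"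
    have tc: "?t y \<in> {..<order G} \<rightarrow> carrier T" if "y \<in> carrier T" for y using z that by auto
    have chi: "\<chi> (?z [^] m) = 1" for m :: nat
      by (simp only: chi_pow[OF z] chi_pow[OF g_closed] character_pow_n[OF g_closed] power_one)
    have "\<phi> (\<Oplus>\<^bsub>T\<^esub>m\<in>{..<order G}. ?t y m) = (\<Oplus>\<^bsub>T\<^esub>m\<in>{..<order G}. \<phi> (?t y m))"
      by (rule additive_finsum[OF T.M.abelian_group_axioms T.M.abelian_group_axioms])
        (use y_closed y_add tc[OF y] in auto)
    also have "\<dots> = (\<Oplus>\<^bsub>T\<^esub>m\<in>{..<order G}. ?t (\<phi> y) m)"
      by (rule T.M.finsum_cong'[OF refl tc[OF y_closed[OF y]]]) (use z y chi in \<open>simp add: y_single\<close>)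
    finally show ?thesis unfolding eigenproj_def
      using y_scalar[OF T.M.finsum_closed[OF tc[OF y]], of "inverse (of_nat (order G))"] by simp
  qed
  have EH: "left_module_hom H HT HT ?E"
    by (rule H_module_homI[OF y_module_axioms y_module_axioms Eh]) (rule E_y)
  have Efix: "?E (?E y) = ?E y" if "y \<in> carrier T" for y
    by (rule eigenproj_fix[OF e eigenproj_closed[OF e that] eigenproj_eigen[OF e that]])
  interpret HM: left_module H HT by (rule left_module_H_module)
  let ?N = "?E ` carrier T"
  let ?L = "HT\<lparr>carrier := ?N\<rparr>"
  have N: "submodule ?N H HT"
    using HM.submodule_image[OF HM.left_module_axioms EH HM.submodule_carrier] by simp
  have "bij_betw ?E (carrier HT) (carrier ?L)"
  proof (rule indecomposable_retract[OF indec HM.submodule_left_module[OF N], of "\<lambda>y. y" ?E])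
    have "x0 \<in> ?N" using eigenproj_fix[OF e x0(1,3)] x0(1) by force
    then show "carrier ?L \<noteq> {\<zero>\<^bsub>?L\<^esub>}" using x0(2) by auto
    have Nc: "?N \<subseteq> carrier T" using eigenproj_closed[OF e] by auto
    show "left_module_hom H ?L HT (\<lambda>y. y)" using Nc by (intro left_module_homI) auto
    show "left_module_hom H HT ?L ?E" using left_module_homD[OF EH] by (intro left_module_homI) auto
    show "?E y = y" if "y \<in> carrier ?L" for y using that Efix by auto
  qed
  then have "inj_on ?E (carrier T)" by (simp add: bij_betw_def)
  then have "?E x = x" using Efix[OF x] eigenproj_closed[OF e x] x by (auto dest: inj_onD)
  then show ?thesis using eigenproj_eigen[OF e x] by simp
qed

section \<open>The list of simple modules and the permutation \<tau>\<close>

locale simple_modules = nonnilpotent_group_datum G \<chi> g n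
  for G :: "'g monoid" (structure) and \<chi> :: "'g \<Rightarrow> 'k::{alg_closed_field, field_char_0}" and g n +
  fixes \<Omega> :: "'i set" and V :: "'i \<Rightarrow> ('g \<Rightarrow> 'k, 'v) module"
  assumes simples: "i \<in> \<Omega> \<Longrightarrow> simple_module kG (V i) \<and> finite_dim (group_algebra_scalar G) (V i)"
    and simples_distinct: "\<lbrakk>i \<in> \<Omega>; j \<in> \<Omega>; module_iso kG (V i) (V j)\<rbrakk> \<Longrightarrow> i = j"
    and simples_complete: "\<And>S :: ('g \<Rightarrow> 'k, nat \<Rightarrow> 'k) module.
          \<lbrakk>simple_module kG S; finite_dim (group_algebra_scalar G) S\<rbrakk> \<Longrightarrow> \<exists>i\<in>\<Omega>. module_iso kG S (V i)"
begin

abbreviation "lam i \<equiv> central_scalar G g n (V i)"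
abbreviation "\<tau> \<equiv> twist_perm G \<chi> \<Omega> V"

lemma simple: "i \<in> \<Omega> \<Longrightarrow> simple_module kG (V i)"
  using simples by blast

lemma left_module_V: "i \<in> \<Omega> \<Longrightarrow> left_module kG (V i)"
  by (rule simple_moduleD(1)[OF simple])

text \<open>Completeness of the list is assumed on one element type only; the isomorphic copy from
  \<open>simple_module_on_functions\<close> carries it to every type.\<close>

lemma classify_simple:
  assumes "simple_module kG W" shows "\<exists>i\<in>\<Omega>. module_iso kG W (V i)"
proof -
  obtain S :: "('g \<Rightarrow> 'k, nat \<Rightarrow> 'k) module" where S: "simple_module kG S"
    "finite_dim (group_algebra_scalar G) S" "module_iso kG W S"
    using simple_module_on_functions[OF assms] by blast
  then show ?thesis using simples_complete[OF S(1,2)] module_iso_trans[OF S(3)] by blast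
qed

lemma central_scalar_eq:
  assumes V: "left_module kG W" and v: "v \<in> carrier W" "v \<noteq> \<zero>\<^bsub>W\<^esub>"
    and c: "\<And>v. v \<in> carrier W \<Longrightarrow> single 1 (g [^] n) \<odot>\<^bsub>W\<^esub> v = single c \<one> \<odot>\<^bsub>W\<^esub> v"
  shows "central_scalar G g n W = c"
proof -
  interpret W: group_module G W by (rule group_moduleI[OF V])
  show ?thesis unfolding central_scalar_def group_algebra_scalar_def
  proof (rule the_equality)
    fix d assume d: "\<forall>v\<in>carrier W. single 1 (g [^] n) \<odot>\<^bsub>W\<^esub> v = W.sc d v"
    then have "W.sc d v = W.sc c v" using c[OF v(1)] v(1) by simp
    then show "d = c" by (rule W.sc_cancel) (rule v)+
  qed (use c in blast)
qed

lemma central_scalar: "\<lbrakk>i \<in> \<Omega>; v \<in> carrier (V i)\<rbrakk> \<Longrightarrow> single 1 (g [^] n) \<odot>\<^bsub>V i\<^esub> v = single (lam i) \<one> \<odot>\<^bsub>V i\<^esub> v"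
proof -
  assume i: "i \<in> \<Omega>" and v: "v \<in> carrier (V i)"
  obtain c where c: "\<And>v. v \<in> carrier (V i) \<Longrightarrow> single 1 (g [^] n) \<odot>\<^bsub>V i\<^esub> v = single c \<one> \<odot>\<^bsub>V i\<^esub> v"
    using schur_central[OF simple_moduleD(2)[OF simple[OF i]] simple[OF i], of "g [^] n"]
      g_closed g_pow_central by auto
  obtain w where "w \<in> carrier (V i)" "w \<noteq> \<zero>\<^bsub>V i\<^esub>" using simple_moduleD(3)[OF simple[OF i]] by blast
  then have "lam i = c" using c by (intro central_scalar_eq[OF left_module_V[OF i]])
  then show ?thesis using c[OF v] by simp
qed

lemma tower_module_M:
  "\<lbrakk>i \<in> \<Omega>; lam i = 1; 1 \<le> k; k \<le> n\<rbrakk> \<Longrightarrow> tower_module G \<chi> g n (V i) k 0 1"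
  using simple central_scalar[of i]
  by (auto simp: tower_module_def tower_module_axioms_def nonnilpotent_group_datum_axioms)

lemma tower_module_P: "i \<in> \<Omega> \<Longrightarrow> tower_module G \<chi> g n (V i) n (lam i - 1) (lam i)"
  using simple central_scalar[of i] n_ge_2
  by (auto simp: tower_module_def tower_module_axioms_def nonnilpotent_group_datum_axioms)

text \<open>The description that defines \<tau> is meaningful: a suitable index exists because
  twists of simple modules are simple, and it is unique because the list has no repetitions.\<close>

lemma twist_perm_iso:
  assumes i: "i \<in> \<Omega>" shows "\<tau> i \<in> \<Omega>" "module_iso kG (twist 1 (V i)) (V (\<tau> i))"
proof -
  interpret W: group_module G "V i" by (rule simple_moduleD(2)[OF simple[OF i]])
  interpret character_tensor G "V i" "\<lambda>h. inverse (\<chi> h)" by unfold_locales (simp add: chi_one)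
  have tw: "twist 1 (V i) = restrict_scalars (\<lambda>a h. a h * inverse (\<chi> h)) (V i)" by (simp add: twist_def)
  let ?N = "tensor_module G (character_module G (\<lambda>h. inverse (\<chi> h))) (V i)"
  have T: "module_iso kG (twist 1 (V i)) ?N" unfolding tw by (rule tensor_character_iso)
  have lm: "left_module kG (twist 1 (V i))" by (rule left_module_twist[OF left_module_V[OF i]])
  obtain t where t: "t \<in> \<Omega>" "module_iso kG (twist 1 (V i)) (V t)"
    using classify_simple[OF simple_module_twist[OF simple[OF i]]] by blast
  have "\<tau> i = t" unfolding twist_perm_def
  proof (rule the_equality)
    show "t \<in> \<Omega> \<and> module_iso kG ?N (V t)"
      using t module_iso_trans[OF module_iso_sym[OF lm T]] by blast
    fix t' assume t': "t' \<in> \<Omega> \<and> module_iso kG ?N (V t')"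
    then have "module_iso kG (V t) (V t')"
      using module_iso_trans[OF module_iso_sym[OF lm t(2)]] module_iso_trans[OF T] by blast
    then show "t' = t" using simples_distinct t(1) t' by blast
  qed
  then show "\<tau> i \<in> \<Omega>" "module_iso kG (twist 1 (V i)) (V (\<tau> i))" using t by simp_all
qed

lemma twist_Suc: "twist (Suc s) W = twist 1 (twist s W)"
  by (simp add: twist_def restrict_scalars_def mult.assoc)

lemma module_iso_twist:
  "module_iso kG W W' \<Longrightarrow> module_iso kG (twist s W) (twist s W')"
  unfolding module_iso_altdef twist_simps using left_module_hom_twist by blast

lemma twist_perm_pow:
  assumes i: "i \<in> \<Omega>"
  shows "(\<tau> ^^ s) i \<in> \<Omega> \<and> module_iso kG (twist s (V i)) (V ((\<tau> ^^ s) i))"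
proof (induct s)
  case 0
  have "left_module_hom kG (twist 0 (V i)) (V i) (\<lambda>x. x)"
    by (rule left_module_homI) (simp_all add: twist_0_smult)
  then have "module_iso kG (twist 0 (V i)) (V i)" by (rule module_isoI) (simp add: bij_betw_def)
  then show ?case using i by simp
next
  case (Suc s)
  then have "module_iso kG (twist 1 (twist s (V i))) (twist 1 (V ((\<tau> ^^ s) i)))"
    using module_iso_twist by blast
  then have "module_iso kG (twist (Suc s) (V i)) (V (\<tau> ((\<tau> ^^ s) i)))"
    unfolding twist_Suc using module_iso_trans twist_perm_iso(2) Suc by blast
  then show ?case using twist_perm_iso(1) Suc by simp
qed

text \<open>The n-th twist multiplies coefficients by \<open>\<chi>^(-n) = 1\<close>, so it leaves
  each module unchanged.\<close>

lemma twist_perm_pow_n: "i \<in> \<Omega> \<Longrightarrow> (\<tau> ^^ n) i = i"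
proof -
  assume i: "i \<in> \<Omega>"
  have "left_module_hom kG (V i) (twist n (V i)) (\<lambda>x. x)"
  proof (rule left_module_homI)
    fix a x assume a: "a \<in> carrier kG"
    have "(\<lambda>h. a h * inverse (\<chi> h) ^ n) = a"
    proof
      fix h show "a h * inverse (\<chi> h) ^ n = a h"
        using a character_pow_n[of h] by (cases "h \<in> carrier G") (auto simp: power_inverse monoid_algebra_def)
    qed
    then show "a \<odot>\<^bsub>V i\<^esub> x = a \<odot>\<^bsub>twist n (V i)\<^esub> x" by (simp add: twist_smult)
  qed simp_all
  then have "module_iso kG (V i) (twist n (V i))" by (rule module_isoI) (simp add: bij_betw_def)
  then have "module_iso kG (V i) (V ((\<tau> ^^ n) i))" using twist_perm_pow[OF i, of n] module_iso_trans by blast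
  then show ?thesis using simples_distinct[OF i] twist_perm_pow[OF i, of n] by metis
qed

lemma orbit_eq: "i \<in> \<Omega> \<Longrightarrow> orbit \<tau> i = {(\<tau> ^^ s) i | s. True}"
  using twist_perm_pow_n[of i] n_ge_2
  by (intro orbit_altdef_self_in) (auto simp: orbit_altdef intro!: exI[of _ n])

lemma orbit_cong: "\<lbrakk>i \<in> \<Omega>; j \<in> orbit \<tau> i\<rbrakk> \<Longrightarrow> orbit \<tau> j = orbit \<tau> i"
proof -
  assume i: "i \<in> \<Omega>" and j: "j \<in> orbit \<tau> i"
  have self: "i \<in> orbit \<tau> i" using orbit_eq[OF i] by (auto intro: exI[of _ 0])
  then have "i \<in> orbit \<tau> j" using j by (rule orbit_swap)
  then show "orbit \<tau> j = orbit \<tau> i" using j orbit_trans by fast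
qed

text \<open>Twisting does not change the scalar of \<open>g^n\<close>, as
  \<open>\<chi>(g)^n = 1\<close>. Hence \<open>lam\<close> is constant on \<tau>-orbits and tells
  the two families of towers apart.\<close>

lemma lam_twist_iso:
  assumes i: "i \<in> \<Omega>" and j: "j \<in> \<Omega>" and iso: "module_iso kG (V i) (twist s (V j))"
  shows "lam i = lam j"
proof -
  obtain f where f: "left_module_hom kG (V i) (twist s (V j)) f" "bij_betw f (carrier (V i)) (carrier (twist s (V j)))"
    using iso by (auto simp: module_iso_altdef)
  note D = left_module_homD[OF f(1)]
  interpret A: group_module G "V i" by (rule simple_moduleD(2)[OF simple[OF i]])
  interpret B: group_module G "V j" by (rule simple_moduleD(2)[OF simple[OF j]])
  obtain w where w: "w \<in> carrier (V j)" "w \<noteq> \<zero>\<^bsub>V j\<^esub>" using simple_moduleD(3)[OF simple[OF j]] by blast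
  obtain v where v: "v \<in> carrier (V i)" "w = f v" using w(1) bij_betw_imp_surj_on[OF f(2)] by auto
  have "B.sc (lam j) w = single 1 (g [^] n) \<odot>\<^bsub>twist s (V j)\<^esub> w"
    using central_scalar[OF j w(1)] by (simp add: chi_pow[OF g_closed] character_pow_n[OF g_closed])
  also have "\<dots> = f (single 1 (g [^] n) \<odot>\<^bsub>V i\<^esub> v)" using D(3)[of "single 1 (g [^] n)" v] v g_closed by simp
  also have "\<dots> = f (A.sc (lam i) v)" using central_scalar[OF i v(1)] by simp
  also have "\<dots> = B.sc (lam i) w" using D(3)[of "single (lam i) \<one>" v] v by (simp add: chi_one)
  finally have "lam j = lam i" by (rule B.sc_cancel) (rule w)+
  then show ?thesis ..
qed

lemma lam_twist_perm_pow: "i \<in> \<Omega> \<Longrightarrow> lam ((\<tau> ^^ s) i) = lam i"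
  using lam_twist_iso[of "(\<tau> ^^ s) i" i s] twist_perm_pow[of i s]
    module_iso_sym[OF left_module_twist[OF left_module_V[of i]]] by blast

lemma embed_simple:
  assumes "group_module G T" "submodule D kG T" "simple_module kG (T\<lparr>carrier := D\<rparr>)"
  shows "\<exists>i\<in>\<Omega>. \<exists>\<theta>. left_module_hom kG (V i) T \<theta> \<and> inj_on \<theta> (carrier (V i)) \<and> \<theta> ` carrier (V i) = D"
proof -
  interpret T: group_module G T by fact
  obtain i where i: "i \<in> \<Omega>" "module_iso kG (T\<lparr>carrier := D\<rparr>) (V i)" using classify_simple[OF assms(3)] by blast
  then have "module_iso kG (V i) (T\<lparr>carrier := D\<rparr>)"
    using module_iso_sym assms(3) by (auto simp: simple_module_def)
  then obtain \<theta> where t: "left_module_hom kG (V i) (T\<lparr>carrier := D\<rparr>) \<theta>" "bij_betw \<theta> (carrier (V i)) D"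
    by (auto simp: module_iso_altdef)
  have "left_module_hom kG (V i) T \<theta>"
    using left_module_homD[OF t(1)] T.T.submoduleD(1)[OF assms(2)] by (intro left_module_homI) auto
  then show ?thesis using i(1) t(2) by (auto simp: bij_betw_def)
qed

text \<open>In the second alternative the isomorphism is claimed for every index in the orbit,
  because the cyclic tower can be started at any of its layers. This makes the choice of orbit
  representatives immaterial.\<close>

lemma indecomposable_classification:
  assumes X: "indecomposable_module H X"
  shows "(\<exists>i\<in>\<Omega>. \<exists>k. lam i = 1 \<and> 1 \<le> k \<and> k \<le> n \<and> module_iso H X (M_module G \<chi> k (V i))) \<or>
    (\<exists>i\<in>\<Omega>. lam i \<noteq> 1 \<and> (\<forall>j\<in>orbit \<tau> i. module_iso H X (P_module G \<chi> g n (V j))))"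
proof -
  have lX: "left_module H X" using X by (simp add: indecomposable_module_def)
  define T where "T = restrict_scalars (\<lambda>a. proj (embed a)) X"
  define \<phi> where "\<phi> = (\<lambda>x. proj (letter Y_gen) \<odot>\<^bsub>X\<^esub> x)"
  have Y: "y_module G \<chi> g n T \<phi>" and XT: "module_iso H X (H_module G T \<phi>)"
    using H_module_of_module[OF lX] unfolding T_def \<phi>_def by blast+
  interpret y_module G \<chi> g n T \<phi> by (rule Y)
  have indec: "indecomposable_module H HT" by (rule indecomposable_module_iso[OF X left_module_H_module XT])
  obtain x0 where x0: "x0 \<in> carrier T" "x0 \<noteq> \<zero>\<^bsub>T\<^esub>"
    using indec T.M.zero_closed by (auto simp: indecomposable_module_def)
  have char: "of_nat (card (carrier G)) \<noteq> (0::'k)" using order_nonzero by (simp add: order_def)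
  have sub0: "submodule {\<zero>\<^bsub>T\<^esub>} kG T" by (rule T.submoduleI) (auto simp: T.smult_r_zero)
  have "x0 \<notin> {\<zero>\<^bsub>T\<^esub>}" using x0(2) by simp
  then obtain D where D: "submodule D kG T" "simple_module kG (T\<lparr>carrier := D\<rparr>)"
    using exists_simple_submodule[OF char sub0 x0(1)] by blast
  obtain i \<theta> where i: "i \<in> \<Omega>" and th: "left_module_hom kG (V i) T \<theta>" "inj_on \<theta> (carrier (V i))"
    using embed_simple[OF group_module_axioms D] by blast
  \<comment> \<open>An embedded simple module supplies the eigenvector of \<open>g^n\<close> that
    \<open>indecomposable_central_scalar\<close> asks for. It is stated for any \<open>j\<close>,
    because the nilpotent case chooses a second simple submodule.\<close>
  have theta_ex: "\<exists>y. y \<in> carrier T \<and> y \<noteq> \<zero>\<^bsub>T\<^esub> \<and> single 1 (g [^] n) \<odot>\<^bsub>T\<^esub> y = sc (lam j) y"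
    if j: "j \<in> \<Omega>" and h: "left_module_hom kG (V j) T \<theta>'" "inj_on \<theta>' (carrier (V j))" for j \<theta>'
  proof -
    interpret W: group_module G "V j" by (rule simple_moduleD(2)[OF simple[OF j]])
    note hD = left_module_homD[OF h(1)]
    obtain v where v: "v \<in> carrier (V j)" "v \<noteq> \<zero>\<^bsub>V j\<^esub>" using simple_moduleD(3)[OF simple[OF j]] by blast
    have h0: "\<theta>' \<zero>\<^bsub>V j\<^esub> = \<zero>\<^bsub>T\<^esub>"
      by (rule additive_zero[OF W.T.M.abelian_group_axioms T.M.abelian_group_axioms]) (use hD in auto)
    have "\<theta>' v \<noteq> \<zero>\<^bsub>T\<^esub>" using inj_onD[OF h(2), of v "\<zero>\<^bsub>V j\<^esub>"] v h0 by auto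
    moreover have "single 1 (g [^] n) \<odot>\<^bsub>T\<^esub> \<theta>' v = sc (lam j) (\<theta>' v)"
      using hD(3)[of "single 1 (g [^] n)" v] hD(3)[of "single (lam j) \<one>" v] central_scalar[OF j v(1)] v(1) g_closed
      by simp
    ultimately show ?thesis using hD(1)[OF v(1)] by blast
  qed
  obtain y where y: "y \<in> carrier T" "y \<noteq> \<zero>\<^bsub>T\<^esub>" "single 1 (g [^] n) \<odot>\<^bsub>T\<^esub> y = sc (lam i) y"
    using theta_ex[OF i th] by blast
  have gn: "single 1 (g [^] n) \<odot>\<^bsub>T\<^esub> x = sc (lam i) x" if "x \<in> carrier T" for x
    by (rule indecomposable_central_scalar[OF indec y that])
  have phin: "(\<phi> ^^ n) x = sc (lam i - 1) x" if x: "x \<in> carrier T" for x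
  proof -
    have "sc (lam i) x \<ominus>\<^bsub>T\<^esub> x = sc (lam i - 1) x"
    proof (rule T.M.minus_eqI)
      show "sc (lam i - 1) x \<oplus>\<^bsub>T\<^esub> x = sc (lam i) x"
        using x sc_add[of x "lam i - 1" 1] by simp
    qed (use x in auto)
    then show ?thesis using y_pow_n[OF x] gn[OF x] by simp
  qed
  show ?thesis
  proof (cases "lam i = 1")
    case False
    have inj: "inj_on (\<phi> ^^ m) (carrier T)" for m
    proof (rule inj_onI)
      fix x x' assume xx: "x \<in> carrier T" "x' \<in> carrier T" "(\<phi> ^^ m) x = (\<phi> ^^ m) x'"
      \<comment> \<open>\<open>y^n\<close> is the nonzero scalar \<open>lam i - 1\<close>, so y has
        a left inverse.\<close>
      have inj1: "u = u'" if u: "u \<in> carrier T" "u' \<in> carrier T" "\<phi> u = \<phi> u'" for u u'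
      proof -
        have "\<phi> ^^ n = \<phi> ^^ (n - 1) \<circ> \<phi>" using n_ge_2 by (cases n) (simp_all add: funpow_swap1 fun_eq_iff)
        then have "(\<phi> ^^ n) u = (\<phi> ^^ n) u'" using u(3) by simp
        then have "sc (inverse (lam i - 1)) (sc (lam i - 1) u) = sc (inverse (lam i - 1)) (sc (lam i - 1) u')"
          using phin u by simp
        then show ?thesis using False u by (simp add: sc_sc)
      qed
      show "x = x'" using xx(3) by (induct m) (auto intro: inj1 y_pow_closed xx(1,2))
    qed
    have "module_iso H X (P_module G \<chi> g n (V j))" if j: "j \<in> orbit \<tau> i" for j
    proof -
      obtain s where s: "j = (\<tau> ^^ s) i" using j orbit_eq[OF i] by blast
      have jO: "j \<in> \<Omega>" and ij: "module_iso kG (twist s (V i)) (V j)" using twist_perm_pow[OF i, of s] s by auto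
      have lj: "lam j = lam i" using lam_twist_perm_pow[OF i, of s] s by simp
      obtain f where f: "left_module_hom kG (V j) (twist s (V i)) f" "bij_betw f (carrier (V j)) (carrier (twist s (V i)))"
        using module_iso_sym[OF left_module_twist[OF left_module_V[OF i]] ij] by (auto simp: module_iso_altdef)
      \<comment> \<open>Starting the tower at \<open>y^s W\<close> instead of W realises it over
        \<open>V j\<close>, since the s-th twist of \<open>V i\<close> is isomorphic to
        \<open>V j\<close>.\<close>
      let ?t = "\<lambda>v. (\<phi> ^^ s) (\<theta> (f v))"
      have t: "left_module_hom kG (V j) T ?t"
        by (rule left_module_hom_comp[OF f(1) left_module_hom_y_pow[OF left_module_V[OF i] th(1)]])
      interpret P: tower_module G \<chi> g n "V j" n "lam j - 1" "lam j" by (rule tower_module_P[OF jO])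
      have fc: "f v \<in> carrier (V i)" if "v \<in> carrier (V j)" for v using left_module_homD(1)[OF f(1) that] by simp
      have "inj_on (\<lambda>v. (\<phi> ^^ (n - 1)) (?t v)) (carrier (V j))"
      proof (rule inj_onI)
        fix v w assume vw: "v \<in> carrier (V j)" "w \<in> carrier (V j)" "(\<phi> ^^ (n - 1)) (?t v) = (\<phi> ^^ (n - 1)) (?t w)"
        have c: "\<theta> (f v) \<in> carrier T" "\<theta> (f w) \<in> carrier T" using fc left_module_homD(1)[OF th(1)] vw by auto
        have "?t v = ?t w" by (rule inj_onD[OF inj vw(3)]) (use c y_pow_closed in auto)
        then have "\<theta> (f v) = \<theta> (f w)" by (rule inj_onD[OF inj]) (use c in auto)
        then have "f v = f w" by (rule inj_onD[OF th(2)]) (use fc vw in auto)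
        then show "v = w" by (rule inj_onD[OF bij_betw_imp_inj_on[OF f(2)]]) (use vw in auto)
      qed
      then have "module_iso H HT P.L.HT"
        by (intro P.tower_summand[OF Y indec t]) (use phin lj in auto)
      then show ?thesis using module_iso_trans[OF XT] by (simp add: P_module_def)
    qed
    then show ?thesis using i False by blast
  next
    case True
    have phin0: "(\<phi> ^^ n) x = \<zero>\<^bsub>T\<^esub>" if "x \<in> carrier T" for x using phin[OF that] True that by (simp add: single_0_smult)
    define k where "k = (LEAST k. \<forall>x\<in>carrier T. (\<phi> ^^ k) x = \<zero>\<^bsub>T\<^esub>)"
    have kz: "\<forall>x\<in>carrier T. (\<phi> ^^ k) x = \<zero>\<^bsub>T\<^esub>" unfolding k_def by (rule LeastI[of _ n]) (use phin0 in blast)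
    have kn: "k \<le> n" unfolding k_def by (rule Least_le) (use phin0 in blast)
    have k0: "k > 0" using kz x0 by (cases k) auto
    then have "k - 1 < k" by simp
    then have "\<not> (\<forall>x\<in>carrier T. (\<phi> ^^ (k - 1)) x = \<zero>\<^bsub>T\<^esub>)" unfolding k_def by (rule not_less_Least)
    then obtain x1 where x1: "x1 \<in> carrier T" "(\<phi> ^^ (k - 1)) x1 \<noteq> \<zero>\<^bsub>T\<^esub>" by blast
    \<comment> \<open>A simple submodule that meets this kernel trivially is mapped injectively by
      \<open>y^(k-1)\<close>. The kernel is proper, because it misses \<open>x1\<close>.\<close>
    let ?K = "{x \<in> carrier T. (\<phi> ^^ (k - 1)) x = \<zero>\<^bsub>T\<^esub>}"
    have K: "submodule ?K kG T"
      by (rule submodule_monoid_algebraI[OF T.left_module_axioms])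
        (auto simp: y_pow_zero y_pow_add y_pow_single T.smult_r_zero)
    obtain D' where D': "submodule D' kG T" "D' \<inter> ?K = {\<zero>\<^bsub>T\<^esub>}" "simple_module kG (T\<lparr>carrier := D'\<rparr>)"
      using exists_simple_submodule[OF char K x1(1)] x1 by auto
    obtain j \<theta>' where j: "j \<in> \<Omega>" and h: "left_module_hom kG (V j) T \<theta>'" "inj_on \<theta>' (carrier (V j))" "\<theta>' ` carrier (V j) = D'"
      using embed_simple[OF group_module_axioms D'(1,3)] by blast
    note hD = left_module_homD[OF h(1)]
    \<comment> \<open>\<open>V j\<close> need not be \<open>V i\<close>, but \<open>g^n\<close> acts
      on all of \<open>T\<close> as \<open>lam i\<close>, which forces
      \<open>lam j = lam i\<close>.\<close>
    obtain y' where y': "y' \<in> carrier T" "y' \<noteq> \<zero>\<^bsub>T\<^esub>" "single 1 (g [^] n) \<odot>\<^bsub>T\<^esub> y' = sc (lam j) y'"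
      using theta_ex[OF j h(1,2)] by blast
    then have lj: "lam j = 1" using gn[OF y'(1)] True sc_cancel[of "lam j" y' 1] by simp
    interpret P: tower_module G \<chi> g n "V j" k 0 1 by (rule tower_module_M[OF j lj _ kn]) (use k0 in simp)
    have h0: "\<theta>' \<zero>\<^bsub>V j\<^esub> = \<zero>\<^bsub>T\<^esub>"
      by (rule additive_zero[OF P.V.T.M.abelian_group_axioms T.M.abelian_group_axioms]) (use hD in auto)
    have "inj_on (\<lambda>v. (\<phi> ^^ (k - 1)) (\<theta>' v)) (carrier (V j))"
    proof (rule additive_inj_on[OF P.V.T.M.abelian_group_axioms T.M.abelian_group_axioms])
      fix v assume v: "v \<in> carrier (V j)" "(\<phi> ^^ (k - 1)) (\<theta>' v) = \<zero>\<^bsub>T\<^esub>"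
      then have "\<theta>' v \<in> D' \<inter> ?K" using hD(1) h(3) by auto
      then have "\<theta>' v = \<theta>' \<zero>\<^bsub>V j\<^esub>" unfolding D'(2) h0 by simp
      then show "v = \<zero>\<^bsub>V j\<^esub>" by (rule inj_onD[OF h(2)]) (use v in auto)
    qed (use hD y_pow_closed y_pow_add in auto)
    then have "module_iso H HT P.L.HT"
      by (intro P.tower_summand[OF Y indec h(1)]) (use kz in \<open>auto simp: single_0_smult\<close>)
    then have "module_iso H X (M_module G \<chi> k (V j))" using module_iso_trans[OF XT] by (simp add: M_module_def)
    then show ?thesis using j lj k0 kn by (intro disjI1 bexI[of _ j] exI[of _ k]) auto
  qed
qed

section \<open>The listed modules are indecomposable, finite-dimensional and pairwise
  non-isomorphic\<close>

lemma M_module_indecomposable: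
  assumes "i \<in> \<Omega>" "lam i = 1" "1 \<le> k" "k \<le> n"
  shows "indecomposable_module H (M_module G \<chi> k (V i))"
    and "finite_dim (H_scalar G \<chi> g n) (M_module G \<chi> k (V i))"
proof -
  interpret tower_module G \<chi> g n "V i" k 0 1 by (rule tower_module_M[OF assms])
  show "indecomposable_module H (M_module G \<chi> k (V i))"
    unfolding M_module_def by (rule indecomposable_tower)
  show "finite_dim (H_scalar G \<chi> g n) (M_module G \<chi> k (V i))"
    unfolding M_module_def by (rule finite_dim_tower) (use simples assms(1) in blast)
qed

lemma P_module_indecomposable:
  assumes "i \<in> \<Omega>"
  shows "indecomposable_module H (P_module G \<chi> g n (V i))"
    and "finite_dim (H_scalar G \<chi> g n) (P_module G \<chi> g n (V i))"
proof -
  interpret tower_module G \<chi> g n "V i" n "lam i - 1" "lam i" by (rule tower_module_P[OF assms])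
  show "indecomposable_module H (P_module G \<chi> g n (V i))"
    unfolding P_module_def by (rule indecomposable_tower)
  show "finite_dim (H_scalar G \<chi> g n) (P_module G \<chi> g n (V i))"
    unfolding P_module_def by (rule finite_dim_tower) (use simples assms in blast)
qed

text \<open>\<open>tower_iso_length\<close>, applied to the isomorphism and to its inverse, gives
  equal heights; the bottom layers then identify the simple modules without a twist.\<close>

lemma M_module_iso_M_moduleD:
  assumes i: "i \<in> \<Omega>" "lam i = 1" "1 \<le> k" "k \<le> n" and j: "j \<in> \<Omega>" "lam j = 1" "1 \<le> l" "l \<le> n"
    and iso: "module_iso H (M_module G \<chi> k (V i)) (M_module G \<chi> l (V j))"
  shows "k = l \<and> i = j"
proof -
  note ti = tower_module_M[OF i] and tj = tower_module_M[OF j]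
  have iso': "module_iso H (M_module G \<chi> l (V j)) (M_module G \<chi> k (V i))"
    using module_iso_sym[OF _ iso] M_module_indecomposable(1)[OF i]
    by (simp add: indecomposable_module_def)
  have "l \<le> k" "k \<le> l"
    using tower_iso_length[OF ti tj] tower_iso_length[OF tj ti] iso iso'
    unfolding M_module_def by blast+
  moreover have "module_iso kG (V i) (twist 0 (V j))"
    using tower_iso_base[OF ti tj] iso unfolding M_module_def by blast
  then have "module_iso kG (V i) (V j)"
    using twist_perm_pow[OF j(1), of 0] module_iso_trans by fastforce
  ultimately show ?thesis using simples_distinct i(1) j(1) by simp
qed

text \<open>The layer of the second tower that the bottom of the first one meets tells how far
  \<open>i\<close> is from \<open>j\<close> along the orbit.\<close>

lemma P_module_iso_P_moduleD:
  assumes i: "i \<in> \<Omega>" and j: "j \<in> \<Omega>"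
    and iso: "module_iso H (P_module G \<chi> g n (V i)) (P_module G \<chi> g n (V j))"
  shows "orbit \<tau> i = orbit \<tau> j"
proof -
  obtain s where "module_iso kG (V i) (twist s (V j))"
    using tower_iso_base[OF tower_module_P[OF i] tower_module_P[OF j]] iso
    unfolding P_module_def by blast
  then have "module_iso kG (V i) (V ((\<tau> ^^ s) j))"
    using twist_perm_pow[OF j, of s] module_iso_trans by blast
  then have "i = (\<tau> ^^ s) j" using simples_distinct[OF i] twist_perm_pow[OF j, of s] by blast
  then have "i \<in> orbit \<tau> j" using orbit_eq[OF j] by blast
  then show ?thesis by (rule orbit_cong[OF j])
qed

lemma M_module_not_iso_P_module:
  assumes i: "i \<in> \<Omega>" "lam i = 1" "1 \<le> k" "k \<le> n" and j: "j \<in> \<Omega>" "lam j \<noteq> 1"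
  shows "\<not> module_iso H (M_module G \<chi> k (V i)) (P_module G \<chi> g n (V j))"
  using tower_iso_base[OF tower_module_M[OF i] tower_module_P[OF j(1)]] lam_twist_iso[OF i(1) j(1)] i(2) j(2)
  unfolding M_module_def P_module_def by metis

end

theorem theorem2p9:
  fixes G :: "'g monoid"
    and \<chi> :: "'g \<Rightarrow> 'k::{alg_closed_field, field_char_0}"
    and g :: 'g and n :: nat
    and \<Omega> :: "'i set"
    and V :: "'i \<Rightarrow> ('g \<Rightarrow> 'k, 'v) module"
    and rep :: "'i set \<Rightarrow> 'i"
  defines "kG \<equiv> (monoid_algebra G :: ('g \<Rightarrow> 'k) ring)"
    and "H \<equiv> H_algebra G \<chi> g n"
    and "\<tau> \<equiv> twist_perm G \<chi> \<Omega> V"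
    and "\<Omega>\<^sub>0 \<equiv> {i \<in> \<Omega>. central_scalar G g n (V i) = 1}"
    and "\<Omega>\<^sub>1 \<equiv> {i \<in> \<Omega>. central_scalar G g n (V i) \<noteq> 1}"
  defines "I \<equiv> ({1..n} \<times> \<Omega>\<^sub>0) <+> (orbit \<tau> ` \<Omega>\<^sub>1)"
    and "L \<equiv> case_sum (\<lambda>(k, i). M_module G \<chi> k (V i)) (\<lambda>J. P_module G \<chi> g n (V (rep J)))"
  assumes datum: "nonnilpotent_group_datum G \<chi> g n"
    and simples: "\<And>i. i \<in> \<Omega> \<Longrightarrow>
          simple_module kG (V i) \<and> finite_dim (group_algebra_scalar G) (V i)"
    and simples_distinct: "\<And>i j. \<lbrakk>i \<in> \<Omega>; j \<in> \<Omega>; module_iso kG (V i) (V j)\<rbrakk> \<Longrightarrow> i = j"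
    and simples_complete: "\<And>S :: ('g \<Rightarrow> 'k, nat \<Rightarrow> 'k) module.
          \<lbrakk>simple_module kG S; finite_dim (group_algebra_scalar G) S\<rbrakk> \<Longrightarrow>
          \<exists>i\<in>\<Omega>. module_iso kG S (V i)"
    and rep: "\<And>j. j \<in> \<Omega>\<^sub>1 \<Longrightarrow> rep (orbit \<tau> j) \<in> orbit \<tau> j"
  shows "(\<forall>a\<in>I. indecomposable_module H (L a) \<and> finite_dim (H_scalar G \<chi> g n) (L a)) \<and>
         (\<forall>a\<in>I. \<forall>b\<in>I. module_iso H (L a) (L b) \<longrightarrow> a = b) \<and>
         (\<forall>X :: (('g generator list \<Rightarrow> 'k) set, 'x) module.
            indecomposable_module H X \<and> finite_dim (H_scalar G \<chi> g n) X \<longrightarrow>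
            (\<exists>a\<in>I. module_iso H X (L a)))"
proof -
  interpret S: simple_modules G \<chi> g n \<Omega> V
    using datum simples simples_distinct simples_complete
    unfolding kG_def simple_modules_def simple_modules_axioms_def by blast
  \<comment> \<open>As \<open>lam\<close> is constant on an orbit, the representative has a scalar
    different from 1 as well, and its orbit is the given one.\<close>
  have rep': "rep J \<in> \<Omega>" "S.lam (rep J) \<noteq> 1" "orbit \<tau> (rep J) = J" if J: "J \<in> orbit \<tau> ` \<Omega>\<^sub>1" for J
  proof -
    obtain j where j: "j \<in> \<Omega>\<^sub>1" "J = orbit \<tau> j" using J by blast
    have jO: "j \<in> \<Omega>" "S.lam j \<noteq> 1" using j(1) by (simp_all add: \<Omega>\<^sub>1_def)
    have r: "rep J \<in> orbit \<tau> j" using rep[OF j(1)] j(2) by simp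
    then obtain s where s: "rep J = (\<tau> ^^ s) j" using S.orbit_eq[OF jO(1)] unfolding \<tau>_def by blast
    show "rep J \<in> \<Omega>" "S.lam (rep J) \<noteq> 1"
      using S.twist_perm_pow[OF jO(1), of s] S.lam_twist_perm_pow[OF jO(1), of s] jO(2)
      by (simp_all add: s \<tau>_def)
    show "orbit \<tau> (rep J) = J" using S.orbit_cong[OF jO(1)] r j(2) unfolding \<tau>_def by simp
  qed
  have cases_I: "(\<exists>k i. a = Inl (k, i) \<and> L a = M_module G \<chi> k (V i) \<and> i \<in> \<Omega> \<and> S.lam i = 1 \<and> 1 \<le> k \<and> k \<le> n) \<or>
      (\<exists>J. a = Inr J \<and> L a = P_module G \<chi> g n (V (rep J)) \<and> J \<in> orbit \<tau> ` \<Omega>\<^sub>1)" if "a \<in> I" for a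
    using that by (auto simp: I_def L_def \<Omega>\<^sub>0_def)
  have "indecomposable_module H (L a) \<and> finite_dim (H_scalar G \<chi> g n) (L a)" if "a \<in> I" for a
    using cases_I[OF that] S.M_module_indecomposable S.P_module_indecomposable rep'
    unfolding H_def by metis
  moreover have "a = b" if a: "a \<in> I" and b: "b \<in> I" and iso: "module_iso H (L a) (L b)" for a b
  proof -
    \<comment> \<open>\<open>M_module_not_iso_P_module\<close> covers one direction only, so the
      mixed cases need the isomorphism in both directions.\<close>
    have iso': "module_iso H (L b) (L a)"
      using module_iso_sym[OF _ iso] calculation[OF a] by (simp add: indecomposable_module_def)
    from cases_I[OF a] cases_I[OF b] show ?thesis
    proof (elim disjE exE conjE)
      fix k i l j
      assume *: "a = Inl (k, i)" "L a = M_module G \<chi> k (V i)" "i \<in> \<Omega>" "S.lam i = 1" "1 \<le> k" "k \<le> n"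
        "b = Inl (l, j)" "L b = M_module G \<chi> l (V j)" "j \<in> \<Omega>" "S.lam j = 1" "1 \<le> l" "l \<le> n"
      show ?thesis using S.M_module_iso_M_moduleD[OF *(3-6,9-12)] iso *(1,2,7,8) unfolding H_def by simp
    next
      fix k i J
      assume *: "L a = M_module G \<chi> k (V i)" "i \<in> \<Omega>" "S.lam i = 1" "1 \<le> k" "k \<le> n"
        "L b = P_module G \<chi> g n (V (rep J))" "J \<in> orbit \<tau> ` \<Omega>\<^sub>1"
      show ?thesis using S.M_module_not_iso_P_module[OF *(2-5) rep'(1,2)[OF *(7)]] iso *(1,6) unfolding H_def by simp
    next
      fix k i J
      assume *: "L a = P_module G \<chi> g n (V (rep J))" "J \<in> orbit \<tau> ` \<Omega>\<^sub>1"
        "L b = M_module G \<chi> k (V i)" "i \<in> \<Omega>" "S.lam i = 1" "1 \<le> k" "k \<le> n"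
      show ?thesis using S.M_module_not_iso_P_module[OF *(4-7) rep'(1,2)[OF *(2)]] iso' *(1,3) unfolding H_def by simp
    next
      fix J J'
      assume *: "a = Inr J" "L a = P_module G \<chi> g n (V (rep J))" "J \<in> orbit \<tau> ` \<Omega>\<^sub>1"
        "b = Inr J'" "L b = P_module G \<chi> g n (V (rep J'))" "J' \<in> orbit \<tau> ` \<Omega>\<^sub>1"
      have "orbit \<tau> (rep J) = orbit \<tau> (rep J')" unfolding \<tau>_def
        by (rule S.P_module_iso_P_moduleD[OF rep'(1)[OF *(3)] rep'(1)[OF *(6)]]) (use iso *(2,5) in \<open>simp add: H_def\<close>)
      then show ?thesis using rep'(3)[OF *(3)] rep'(3)[OF *(6)] *(1,4) by simp
    qed
  qed
  moreover have "\<exists>a\<in>I. module_iso H X (L a)"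
    if X: "indecomposable_module H X" for X :: "(('g generator list \<Rightarrow> 'k) set, 'x) module"
    using S.indecomposable_classification[OF X[unfolded H_def]]
  proof (elim disjE bexE exE conjE)
    fix i k assume *: "i \<in> \<Omega>" "S.lam i = 1" "1 \<le> k" "k \<le> n" "module_iso S.H X (M_module G \<chi> k (V i))"
    then show ?thesis
      by (intro bexI[of _ "Inl (k, i)"]) (auto simp: L_def I_def \<Omega>\<^sub>0_def H_def)
  next
    fix i assume *: "i \<in> \<Omega>" "S.lam i \<noteq> 1" "\<forall>j\<in>orbit S.\<tau> i. module_iso S.H X (P_module G \<chi> g n (V j))"
    then have i: "i \<in> \<Omega>\<^sub>1" by (simp add: \<Omega>\<^sub>1_def)
    have "module_iso H X (P_module G \<chi> g n (V (rep (orbit \<tau> i))))"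
      using *(3) rep[OF i] unfolding H_def \<tau>_def by blast
    then show ?thesis using i by (intro bexI[of _ "Inr (orbit \<tau> i)"]) (auto simp: L_def I_def)
  qed
  ultimately show ?thesis by blast
qed

end
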